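(* Let $(W,I)$ be a right-angled Coxeter system with $I$ finite, and let $X$ be a thick semi-regular building of type $(W,I)$. Assume that $(W,I)$ is irreducible and non-spherical. Then the group $\mathrm{Aut}(X)^+$ of type-preserving automorphisms of $X$ is abstractly simple, and it acts strongly transitively on $X$.
   Context: A Coxeter system $(W,I)$ with Coxeter matrix $(m_{i,j})$ is right-angled if $m_{i,j}\in\{2,\infty\}$ for all $i\neq j$. It is irreducible if $I$ is non-empty and is not the union of two disjoint non-empty subsets commuting elementwise; it is non-spherical if $W$ is infinite. A building $X$ of type $(W,I)$ is viewed as a set of chambers $\mathrm{Ch}(X)$ with a Weyl distance $\delta:\mathrm{Ch}(X)\times\mathrm{Ch}(X)\to W$. For $i\in I$, an $i$-panel is a residue of type $\{i\}$, i.e. a set $\{d : \delta(c,d)\in\{1,i\}\}$ for a chamber $c$. $X$ is semi-regular if for each $i\in I$ all $i$-panels have the same cardinality $q_i$ (a possibly infinite cardinal); it is thick if every panel contains at least three chambers. $\mathrm{Aut}(X)^+$ is the group of permutations of $\mathrm{Ch}(X)$ preserving $\delta$. Apartments are taken in the complete apartment system: the images of $W$, with Weyl distance $(v,w)\mapsto v^{-1}w$, under $\delta$-preserving maps into $\mathrm{Ch}(X)$. A group acts strongly transitively if it is transitive on the pairs $(c,A)$ with $c$ a chamber and $A$ an apartment containing $c$. Abstractly simple means simple as an abstract group. *)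

theory Defs
  imports
    "HOL-Algebra.Algebra"
    "HOL-Library.Extended_Nat"
    "HOL-Library.Equipollence"
begin

section \<open>Coxeter systems\<close>

text \<open>The generating set \<open>I\<close> is a subset of the group \<open>W\<close> and indexes the Coxeter matrix \<open>m\<close>,
  of which only the values on \<open>I\<close> matter.\<close>

definition coxeter_matrix :: "'w set \<Rightarrow> ('w \<Rightarrow> 'w \<Rightarrow> enat) \<Rightarrow> bool" where
  "coxeter_matrix I m \<longleftrightarrow>
     (\<forall>i\<in>I. m i i = 1) \<and>
     (\<forall>i\<in>I. \<forall>j\<in>I. m i j = m j i) \<and>
     (\<forall>i\<in>I. \<forall>j\<in>I. i \<noteq> j \<longrightarrow> 2 \<le> m i j)"

definition word_value :: "('w, 'b) monoid_scheme \<Rightarrow> 'w list \<Rightarrow> 'w" where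
  "word_value W u = foldr (\<otimes>\<^bsub>W\<^esub>) u \<one>\<^bsub>W\<^esub>"

text \<open>One step deletes a relator \<open>(ij)\<^sup>m\<close> with \<open>m = m i j\<close> finite. As \<open>m i i = 1\<close>, the relators
  contain all \<open>ii\<close>, so words in \<open>I\<close> need no formal inverses: the words modulo the generated
  equivalence are the group presented by the generators \<open>I\<close> and the relations
  \<open>(ij)\<^sup>m = 1\<close>.\<close>

inductive coxeter_step :: "'w set \<Rightarrow> ('w \<Rightarrow> 'w \<Rightarrow> enat) \<Rightarrow> 'w list \<Rightarrow> 'w list \<Rightarrow> bool"
  for I :: "'w set" and m :: "'w \<Rightarrow> 'w \<Rightarrow> enat" where
  "\<lbrakk>i \<in> I; j \<in> I; m i j = enat n; u \<in> lists I; v \<in> lists I\<rbrakk>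
     \<Longrightarrow> coxeter_step I m (u @ concat (replicate n [i, j]) @ v) (u @ v)"

locale coxeter_system = group W
  for W :: "('w, 'b) monoid_scheme" (structure) +
  fixes I :: "'w set" and m :: "'w \<Rightarrow> 'w \<Rightarrow> enat"
  assumes generators_subset: "I \<subseteq> carrier W"
    and coxeter_matrix: "coxeter_matrix I m"
    and generate_eq: "generate W I = carrier W"
    and presentation: "\<And>u v. \<lbrakk>u \<in> lists I; v \<in> lists I\<rbrakk> \<Longrightarrow>
      word_value W u = word_value W v \<longleftrightarrow> equivclp (coxeter_step I m) u v"

definition right_angled :: "'w set \<Rightarrow> ('w \<Rightarrow> 'w \<Rightarrow> enat) \<Rightarrow> bool" where
  "right_angled I m \<longleftrightarrow> (\<forall>i\<in>I. \<forall>j\<in>I. i \<noteq> j \<longrightarrow> m i j \<in> {2, \<infinity>})"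

definition irreducible_type :: "('w, 'b) monoid_scheme \<Rightarrow> 'w set \<Rightarrow> bool" where
  "irreducible_type W I \<longleftrightarrow> I \<noteq> {} \<and>
     \<not> (\<exists>J K. J \<noteq> {} \<and> K \<noteq> {} \<and> J \<inter> K = {} \<and> J \<union> K = I \<and>
            (\<forall>j\<in>J. \<forall>k\<in>K. j \<otimes>\<^bsub>W\<^esub> k = k \<otimes>\<^bsub>W\<^esub> j))"

definition non_spherical :: "('w, 'b) monoid_scheme \<Rightarrow> bool" where
  "non_spherical W \<longleftrightarrow> infinite (carrier W)"

definition word_length :: "('w, 'b) monoid_scheme \<Rightarrow> 'w set \<Rightarrow> 'w \<Rightarrow> nat" where
  "word_length W I w = (LEAST n. \<exists>u\<in>lists I. length u = n \<and> word_value W u = w)"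


section \<open>Buildings\<close>

text \<open>The axioms for a building as a \<open>W\<close>-metric space.\<close>

locale building = coxeter_system W I m
  for W :: "('w, 'b) monoid_scheme" (structure)
    and I :: "'w set" and m :: "'w \<Rightarrow> 'w \<Rightarrow> enat" +
  fixes C :: "'c set" and \<delta> :: "'c \<Rightarrow> 'c \<Rightarrow> 'w"
  assumes chambers_nonempty: "C \<noteq> {}"
    and dist_closed: "\<lbrakk>c \<in> C; d \<in> C\<rbrakk> \<Longrightarrow> \<delta> c d \<in> carrier W"
    and dist_one_iff: "\<lbrakk>c \<in> C; d \<in> C\<rbrakk> \<Longrightarrow> \<delta> c d = \<one> \<longleftrightarrow> c = d"
    and dist_adjacent: "\<lbrakk>b \<in> C; c \<in> C; d \<in> C; i \<in> I; \<delta> b c = i\<rbrakk>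
      \<Longrightarrow> \<delta> b d \<in> {i \<otimes> \<delta> c d, \<delta> c d}"
    and dist_adjacent_up: "\<lbrakk>b \<in> C; c \<in> C; d \<in> C; i \<in> I; \<delta> b c = i;
        word_length W I (i \<otimes> \<delta> c d) = word_length W I (\<delta> c d) + 1\<rbrakk>
      \<Longrightarrow> \<delta> b d = i \<otimes> \<delta> c d"
    and ex_adjacent: "\<lbrakk>c \<in> C; d \<in> C; i \<in> I\<rbrakk>
      \<Longrightarrow> \<exists>b\<in>C. \<delta> b c = i \<and> \<delta> b d = i \<otimes> \<delta> c d"

definition panel :: "('w, 'b) monoid_scheme \<Rightarrow> 'c set \<Rightarrow> ('c \<Rightarrow> 'c \<Rightarrow> 'w) \<Rightarrow> 'w \<Rightarrow> 'c \<Rightarrow> 'c set" where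
  "panel W C \<delta> i c = {d \<in> C. \<delta> c d \<in> {\<one>\<^bsub>W\<^esub>, i}}"

definition semi_regular ::
    "('w, 'b) monoid_scheme \<Rightarrow> 'w set \<Rightarrow> 'c set \<Rightarrow> ('c \<Rightarrow> 'c \<Rightarrow> 'w) \<Rightarrow> bool" where
  "semi_regular W I C \<delta> \<longleftrightarrow>
     (\<forall>i\<in>I. \<forall>c\<in>C. \<forall>d\<in>C. panel W C \<delta> i c \<approx> panel W C \<delta> i d)"

text \<open>The first disjunct is needed because \<^const>\<open>card\<close> is \<open>0\<close> on infinite sets.\<close>

definition thick ::
    "('w, 'b) monoid_scheme \<Rightarrow> 'w set \<Rightarrow> 'c set \<Rightarrow> ('c \<Rightarrow> 'c \<Rightarrow> 'w) \<Rightarrow> bool" where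
  "thick W I C \<delta> \<longleftrightarrow>
     (\<forall>i\<in>I. \<forall>c\<in>C. infinite (panel W C \<delta> i c) \<or> 3 \<le> card (panel W C \<delta> i c))"

definition apartments ::
    "('w, 'b) monoid_scheme \<Rightarrow> 'c set \<Rightarrow> ('c \<Rightarrow> 'c \<Rightarrow> 'w) \<Rightarrow> 'c set set" where
  "apartments W C \<delta> = {\<alpha> ` carrier W | \<alpha>. \<alpha> \<in> carrier W \<rightarrow> C \<and>
     (\<forall>v\<in>carrier W. \<forall>w\<in>carrier W. \<delta> (\<alpha> v) (\<alpha> w) = inv\<^bsub>W\<^esub> v \<otimes>\<^bsub>W\<^esub> w)}"


section \<open>Type-preserving automorphisms\<close>

definition Aut_plus :: "'c set \<Rightarrow> ('c \<Rightarrow> 'c \<Rightarrow> 'w) \<Rightarrow> ('c \<Rightarrow> 'c) monoid" where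
  "Aut_plus C \<delta> =
     (BijGroup C)\<lparr>carrier := {g \<in> Bij C. \<forall>c\<in>C. \<forall>d\<in>C. \<delta> (g c) (g d) = \<delta> c d}\<rparr>"

definition strongly_transitive ::
    "('g, 'd) monoid_scheme \<Rightarrow> ('g \<Rightarrow> 'c \<Rightarrow> 'c) \<Rightarrow> ('w, 'b) monoid_scheme \<Rightarrow> 'c set \<Rightarrow>
      ('c \<Rightarrow> 'c \<Rightarrow> 'w) \<Rightarrow> bool" where
  "strongly_transitive G \<phi> W C \<delta> \<longleftrightarrow> group_action G C \<phi> \<and>
     (\<forall>A\<in>apartments W C \<delta>. \<forall>A'\<in>apartments W C \<delta>. \<forall>c\<in>A. \<forall>c'\<in>A'.
        \<exists>g\<in>carrier G. \<phi> g c = c' \<and> \<phi> g ` A = A')"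

text \<open>The locale \<^locale>\<open>simple_group\<close> requires \<open>order G > 1\<close>, which fails for every infinite group,
  since the order of an infinite group is \<open>0\<close>.\<close>

definition abstractly_simple :: "('g, 'd) monoid_scheme \<Rightarrow> bool" where
  "abstractly_simple G \<longleftrightarrow> group G \<and> carrier G \<noteq> {\<one>\<^bsub>G\<^esub>} \<and>
     (\<forall>N. N \<lhd> G \<longrightarrow> N = carrier G \<or> N = {\<one>\<^bsub>G\<^esub>})"

end

theory Submission
  imports Defs
begin

text \<open>In a right-angled building the chambers of an \<open>i\<close>-panel cut the building into wings, and an
  \<open>i\<close>-colouring that is bijective on \<open>i\<close>-panels and constant along the parallelism classes of these
  panels can be chosen freely on each tree-wall. Relative to a base chamber a chamber is coded by the
  type and the colours of a minimal gallery, so any two systems of colourings differ by a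
  type-preserving automorphism. This extends suitable partial isometries to automorphisms, and gives
  strong transitivity directly.

  For simplicity, let \<open>N\<close> be a non-trivial normal subgroup. It is transitive on chambers, because the
  types of the panels contained in its orbits form a union of components of the diagram. By Tits'
  commutator trick it contains every automorphism supported in a wing, hence every automorphism fixing
  a wing pointwise. An automorphism fixing the \<open>J\<close>-residue of a chamber pointwise can be corrected by
  two such elements to one fixing the \<open>J \<union> {k}\<close>-residue pointwise. As \<open>I\<close> is finite, \<open>N\<close> contains the
  stabiliser of a chamber.\<close>

section \<open>Right-angled Coxeter systems\<close>

text \<open>Word combinatorics has to be extracted from the bare presentation. The only relators are
  \<open>ii\<close> and \<open>ijij\<close>, so the parity with which a word crosses a wall is an
  invariant of its value; exchange, descents and reduced products are all read off from the
  resulting inversion sets. The right-angled hypothesis acts through one fact: two distinct descents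
  of an element commute (\<open>two_descents\<close>). It has two consequences. Two last steps of
  minimal galleries to the same chamber close up to a square, and an \<open>i\<close>-colour does
  not change along a step commuting with \<open>i\<close>; hence the coding by colours does not
  depend on the gallery. And if \<open>i\<close> and \<open>j\<close> do not commute, every chamber
  outside the \<open>j\<close>-wing of \<open>c\<close> lies in the \<open>i\<close>-wing of
  \<open>c\<close>; hence fixing an \<open>i\<close>-wing means being supported in a
  \<open>j\<close>-wing, and an element of \<open>N\<close> can push a wing into a disjoint one. The
  obstacle in extending a partial isometry is that panels may be infinite: an injection between
  panels need not extend to a bijection. A bijection on one panel of every tree-wall that is met is
  therefore part of the hypotheses of \<open>extend_isometry\<close>.\<close>

locale right_angled_coxeter_system = coxeter_system W I m
  for W :: "('w, 'b) monoid_scheme" (structure)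
    and I :: "'w set" and m :: "'w \<Rightarrow> 'w \<Rightarrow> enat" +
  assumes right_angled: "right_angled I m"
begin

section \<open>Words, lengths and relators\<close>

abbreviation "val \<equiv> word_value W"
abbreviation "len \<equiv> word_length W I"

lemma gen_closed [simp, intro]: "i \<in> I \<Longrightarrow> i \<in> carrier W"
  using generators_subset by blast

lemma val_Nil [simp]: "val [] = \<one>"
  and val_Cons [simp]: "val (i # u) = i \<otimes> val u"
  by (simp_all add: word_value_def)

lemma val_closed [simp, intro]: "u \<in> lists I \<Longrightarrow> val u \<in> carrier W"
  by (induction u) auto

lemma val_append [simp]: "u \<in> lists I \<Longrightarrow> v \<in> lists I \<Longrightarrow> val (u @ v) = val u \<otimes> val v"
  by (induction u) (auto simp: m_assoc)

lemma step_val: "coxeter_step I m u v \<Longrightarrow> u \<in> lists I \<Longrightarrow> v \<in> lists I \<Longrightarrow> val u = val v"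
  using presentation by blast

lemma m_diag: "i \<in> I \<Longrightarrow> m i i = 1"
  and m_sym: "i \<in> I \<Longrightarrow> j \<in> I \<Longrightarrow> m i j = m j i"
  using coxeter_matrix by (auto simp: coxeter_matrix_def)

lemma gen_sq [simp]: assumes "i \<in> I" shows "i \<otimes> i = \<one>"
proof -
  have "coxeter_step I m ([] @ concat (replicate 1 [i, i]) @ []) ([] @ [])"
    by (rule coxeter_step.intros) (use assms m_diag in \<open>auto simp: one_enat_def\<close>)
  then show ?thesis using step_val[of "[i,i]" "[]"] assms by simp
qed

lemma gen_sq_left [simp]: "i \<in> I \<Longrightarrow> w \<in> carrier W \<Longrightarrow> i \<otimes> (i \<otimes> w) = w"
  by (simp flip: m_assoc)

lemma gen_inv [simp]: "i \<in> I \<Longrightarrow> inv i = i"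
  by (simp add: inv_equality)

lemma gen_commute: assumes "i \<in> I" "j \<in> I" "m i j = 2" shows "i \<otimes> j = j \<otimes> i"
proof -
  have "coxeter_step I m ([] @ concat (replicate 2 [i, j]) @ []) ([] @ [])"
    by (rule coxeter_step.intros) (use assms in \<open>auto simp: numeral_eq_enat\<close>)
  then have "i \<otimes> (j \<otimes> (i \<otimes> j)) = \<one>"
    using step_val[of "[i,j,i,j]" "[]"] assms by (simp add: numeral_2_eq_2)
  then have "(i \<otimes> j) \<otimes> (i \<otimes> j) = \<one>" using assms by (simp add: m_assoc)
  then have "inv (i \<otimes> j) = i \<otimes> j" using assms by (simp add: inv_equality)
  then show ?thesis using assms by (simp add: inv_mult_group)
qed

text \<open>A finite Coxeter number is 1 on the diagonal and 2 off it, so only the relators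
  \<open>ii\<close> and \<open>ijij\<close> occur.\<close>

lemma relator_cases:
  assumes "i \<in> I" "j \<in> I" "m i j = enat n"
  obtains "i = j" "n = 1" | "i \<noteq> j" "n = 2" "m i j = 2"
proof (cases "i = j")
  case True then show ?thesis using assms m_diag[of i] that by (simp add: one_enat_def)
next
  case False
  then have "m i j \<in> {2, \<infinity>}" using right_angled assms unfolding right_angled_def by blast
  then have "m i j = 2" using assms(3) by auto
  moreover from this have "n = 2" using assms(3) by (simp add: numeral_eq_enat)
  ultimately show ?thesis using False that by simp
qed

lemma ex_word: assumes "w \<in> carrier W" obtains u where "u \<in> lists I" "val u = w"
proof -
  have "w \<in> generate W I" using assms generate_eq by simp
  then have "\<exists>u\<in>lists I. val u = w"
  proof induction
    case one show ?case by (rule bexI[of _ "[]"]) auto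
  next
    case (incl h) then show ?case by (intro bexI[of _ "[h]"]) auto
  next
    case (inv h) then show ?case by (intro bexI[of _ "[h]"]) auto
  next
    case (eng h1 h2)
    then obtain u v where "u \<in> lists I" "val u = h1" "v \<in> lists I" "val v = h2" by blast
    then show ?case by (intro bexI[of _ "u @ v"]) auto
  qed
  then show ?thesis using that by blast
qed

lemma len_le: "u \<in> lists I \<Longrightarrow> len (val u) \<le> length u"
  unfolding word_length_def by (rule Least_le) blast

lemma ex_reduced_word:
  assumes "w \<in> carrier W" obtains u where "u \<in> lists I" "val u = w" "length u = len w"
proof -
  have "\<exists>n. \<exists>u\<in>lists I. length u = n \<and> val u = w" using ex_word[OF assms] by metis
  from LeastI_ex[OF this] show ?thesis using that unfolding word_length_def by blast
qed

text \<open>\<open>crossed u t\<close>: the gallery of type \<open>u\<close> issuing from \<open>\<one>\<close> crosses the wall of the reflection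
  \<open>t\<close> an odd number of times. In a right-angled system this depends only on the value of \<open>u\<close>.\<close>

primrec crossed :: "'w list \<Rightarrow> 'w \<Rightarrow> bool" where
  "crossed [] t = False"
| "crossed (i # u) t = ((t = i) \<noteq> crossed u (i \<otimes> t \<otimes> i))"

lemma crossed_append:
  "u \<in> lists I \<Longrightarrow> v \<in> lists I \<Longrightarrow> t \<in> carrier W \<Longrightarrow>
    crossed (u @ v) t = (crossed u t \<noteq> crossed v (inv (val u) \<otimes> t \<otimes> val u))"
  by (induction u arbitrary: t) (auto simp: inv_mult_group m_assoc)

lemma conj_gen_eq_iff:
  "i \<in> I \<Longrightarrow> t \<in> carrier W \<Longrightarrow> s \<in> carrier W \<Longrightarrow> i \<otimes> t \<otimes> i = s \<longleftrightarrow> t = i \<otimes> s \<otimes> i"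
  by (auto simp: m_assoc)

text \<open>In \<open>ii\<close> the wall of \<open>i\<close> is crossed twice. In
  \<open>ijij\<close> conjugation by \<open>i\<close> or \<open>j\<close> fixes both
  \<open>i\<close> and \<open>j\<close>, so each of the two walls is crossed exactly twice; every
  other wall is left to \<open>v\<close>.\<close>

lemma crossed_relator:
  assumes "i \<in> I" "j \<in> I" "m i j = enat n" "v \<in> lists I" "t \<in> carrier W"
  shows "crossed (concat (replicate n [i, j]) @ v) t = crossed v t"
  using assms(1-3)
proof (cases rule: relator_cases)
  case 1
  have "i \<otimes> (i \<otimes> t \<otimes> i) \<otimes> i = t" "(i \<otimes> t \<otimes> i = i) = (t = i)"
    using assms 1 conj_gen_eq_iff[of i t i] by (simp_all add: m_assoc)
  then show ?thesis using 1 by auto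
next
  case 2
  note c = gen_commute[OF assms(1,2) 2(3)]
  have c': "i \<otimes> (j \<otimes> x) = j \<otimes> (i \<otimes> x)" if "x \<in> carrier W" for x
    using c that assms by (metis gen_closed m_assoc)
  have iji: "i \<otimes> j \<otimes> i = j" "j \<otimes> i \<otimes> j = i" using assms by (simp_all add: m_assoc c c')
  let ?X = "i \<otimes> t \<otimes> i" and ?Y = "j \<otimes> (i \<otimes> t \<otimes> i) \<otimes> j"
  have sq: "i \<otimes> i \<otimes> i = i" "j \<otimes> j \<otimes> j = j" using assms by simp_all
  have X: "(?X = j) = (t = j)" "(?X = i) = (t = i)"
    using assms conj_gen_eq_iff[of i t j] conj_gen_eq_iff[of i t i] iji sq by auto
  have Y: "(?Y = i) = (?X = i)" "(?Y = j) = (?X = j)"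
    using assms conj_gen_eq_iff[of j ?X i] conj_gen_eq_iff[of j ?X j] iji sq by auto
  have Z: "(i \<otimes> ?Y \<otimes> i = j) = (?Y = j)"
    using assms conj_gen_eq_iff[of i ?Y j] iji by auto
  have "j \<otimes> (i \<otimes> ?Y \<otimes> i) \<otimes> j = t"
    using assms by (simp add: m_assoc c c')
  note X Y Z this
  then show ?thesis using 2 by (auto simp: numeral_2_eq_2)
qed

lemma crossed_step:
  assumes "coxeter_step I m u v" "t \<in> carrier W" shows "crossed u t = crossed v t"
  using assms
proof cases
  case (1 i j n p q)
  have r: "concat (replicate n [i, j]) \<in> lists I" using 1(3,4) by (induction n) auto
  have "crossed (concat (replicate n [i, j]) @ q) s = crossed q s" if "s \<in> carrier W" for s
    by (rule crossed_relator) (use 1 that in auto)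
  then show ?thesis using 1 assms r crossed_append[of p "concat (replicate n [i, j]) @ q" t]
    crossed_append[of p q t] by simp
qed

lemma crossed_cong:
  assumes "u \<in> lists I" "v \<in> lists I" "val u = val v" "t \<in> carrier W"
  shows "crossed u t = crossed v t"
proof -
  have "equivclp (coxeter_step I m) u v" using presentation assms by blast
  then show ?thesis
    by (induction rule: equivclp_induct) (use crossed_step assms in blast)+
qed

section \<open>Inversion sets\<close>

definition inversions :: "'w \<Rightarrow> 'w set" where
  "inversions w = {t \<in> carrier W. \<exists>u\<in>lists I. val u = w \<and> crossed u t}"

lemma inversions_val:
  "u \<in> lists I \<Longrightarrow> t \<in> inversions (val u) \<longleftrightarrow> t \<in> carrier W \<and> crossed u t"
  unfolding inversions_def using crossed_cong by blast

lemma inversions_closed: "t \<in> inversions w \<Longrightarrow> t \<in> carrier W"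
  by (simp add: inversions_def)

lemma inversions_one [simp]: "inversions \<one> = {}"
  using inversions_val[of "[]"] by auto

text \<open>\<open>inversions w\<close> is the usual set of reflections whose walls separate
  \<open>\<one>\<close> from \<open>w\<close>; this is its cocycle identity, the inversions of
  \<open>v \<otimes> w\<close> being the symmetric difference of those of \<open>v\<close> and the
  \<open>v\<close>-conjugates of those of \<open>w\<close>. A generator is in the set exactly when
  it is a left descent.\<close>

lemma inversions_mult:
  assumes "v \<in> carrier W" "w \<in> carrier W" "t \<in> carrier W"
  shows "t \<in> inversions (v \<otimes> w) \<longleftrightarrow> (t \<in> inversions v) \<noteq> (inv v \<otimes> t \<otimes> v \<in> inversions w)"
proof -
  obtain a b where ab: "a \<in> lists I" "val a = v" "b \<in> lists I" "val b = w"
    using assms ex_word by metis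
  have "v \<otimes> w = val (a @ b)" using ab by simp
  then show ?thesis
    using inversions_val[of "a @ b" t] inversions_val[OF ab(1)] inversions_val[OF ab(3)] ab assms
    by (auto simp: crossed_append)
qed

lemma inversions_gen: assumes "i \<in> I" shows "inversions i = {i}"
  using inversions_val[of "[i]"] assms by auto

lemma inversions_gen_mult:
  assumes "i \<in> I" "w \<in> carrier W" "t \<in> carrier W"
  shows "t \<in> inversions (i \<otimes> w) \<longleftrightarrow> (t = i) \<noteq> (i \<otimes> t \<otimes> i \<in> inversions w)"
  using assms by (simp add: inversions_mult inversions_gen)

lemma inversions_gen_self [simp]:
  "i \<in> I \<Longrightarrow> w \<in> carrier W \<Longrightarrow> i \<in> inversions (i \<otimes> w) \<longleftrightarrow> i \<notin> inversions w"
  by (simp add: inversions_gen_mult)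

lemma inversions_inv:
  assumes "w \<in> carrier W" "t \<in> carrier W"
  shows "t \<in> inversions (inv w) \<longleftrightarrow> w \<otimes> t \<otimes> inv w \<in> inversions w"
  using inversions_mult[of "inv w" w t] assms by auto

section \<open>Parabolic subgroups, exchange and descents\<close>

definition parabolic :: "'w set \<Rightarrow> 'w set" where
  "parabolic J = word_value W ` lists J"

lemma lists_sub: "J \<subseteq> I \<Longrightarrow> u \<in> lists J \<Longrightarrow> u \<in> lists I"
  by auto

lemma parabolic_closed: "J \<subseteq> I \<Longrightarrow> w \<in> parabolic J \<Longrightarrow> w \<in> carrier W"
  unfolding parabolic_def using lists_sub val_closed by blast

lemma parabolic_one [simp]: "\<one> \<in> parabolic J"
  unfolding parabolic_def by (rule image_eqI[of _ _ "[]"]) auto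

lemma parabolic_gen: "J \<subseteq> I \<Longrightarrow> i \<in> J \<Longrightarrow> i \<in> parabolic J"
  unfolding parabolic_def by (rule image_eqI[of _ _ "[i]"]) auto

lemma parabolic_mult:
  assumes "J \<subseteq> I" "v \<in> parabolic J" "w \<in> parabolic J" shows "v \<otimes> w \<in> parabolic J"
proof -
  obtain a b where "a \<in> lists J" "b \<in> lists J" "v = val a" "w = val b"
    using assms by (auto simp: parabolic_def)
  then show ?thesis unfolding parabolic_def using lists_sub[OF assms(1)]
    by (intro image_eqI[of _ _ "a @ b"]) auto
qed

lemma parabolic_inv: assumes "J \<subseteq> I" "w \<in> parabolic J" shows "inv w \<in> parabolic J"
proof -
  obtain a where "a \<in> lists J" "w = val a" using assms by (auto simp: parabolic_def)
  then show ?thesis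
  proof (induction a arbitrary: w)
    case (Cons i a)
    then have "i \<in> I" "val a \<in> carrier W" using assms(1) by (auto intro!: val_closed)
    then have "inv w = inv (val a) \<otimes> i" using Cons by (simp add: inv_mult_group)
    then show ?case using Cons assms(1) parabolic_mult parabolic_gen by auto
  qed auto
qed

lemma parabolic_mono: "J \<subseteq> K \<Longrightarrow> parabolic J \<subseteq> parabolic K"
  unfolding parabolic_def by (intro image_mono lists_mono)

lemma parabolic_I: "parabolic I = carrier W"
  unfolding parabolic_def using ex_word val_closed by blast

text \<open>Delete a letter at which the gallery crosses the wall of \<open>t\<close>; moving past
  an earlier letter conjugates \<open>t\<close> by it. The shorter word keeps its letters in
  \<open>J\<close>, which makes the statement usable inside parabolic subgroups.\<close>

lemma exchange:
  assumes "J \<subseteq> I" "u \<in> lists J" "t \<in> inversions (val u)"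
  shows "\<exists>u'\<in>lists J. Suc (length u') = length u \<and> val u' = t \<otimes> val u"
proof -
  have "t \<in> carrier W" "crossed u t" using assms inversions_val lists_sub by blast+
  then show ?thesis using assms(2)
  proof (induction u arbitrary: t)
    case (Cons i u)
    then have i: "i \<in> I" and u: "u \<in> lists I" using assms(1) by auto
    show ?case
    proof (cases "t = i")
      case True then show ?thesis using i u Cons.prems by (intro bexI[of _ u]) auto
    next
      case False
      then have "crossed u (i \<otimes> t \<otimes> i)" using Cons.prems by simp
      then obtain u' where "u' \<in> lists J" "Suc (length u') = length u"
        "val u' = i \<otimes> t \<otimes> i \<otimes> val u" using Cons i by (metis Cons_in_lists_iff gen_closed m_closed)
      then show ?thesis using i u Cons.prems by (intro bexI[of _ "i # u'"]) (auto simp: m_assoc)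
    qed
  qed simp
qed

text \<open>By exchange \<open>t \<otimes> w\<close> is again in the subgroup, hence so is
  \<open>t\<close>.\<close>

lemma inversions_parabolic:
  assumes "J \<subseteq> I" "w \<in> parabolic J" "t \<in> inversions w" shows "t \<in> parabolic J"
proof -
  obtain u where u: "u \<in> lists J" "w = val u" using assms by (auto simp: parabolic_def)
  then obtain u' where "u' \<in> lists J" "val u' = t \<otimes> w" using exchange assms by metis
  then have "t \<otimes> w \<in> parabolic J" unfolding parabolic_def by (metis image_eqI)
  then have "t \<otimes> w \<otimes> inv w \<in> parabolic J" using assms parabolic_mult parabolic_inv by blast
  moreover have "t \<otimes> w \<otimes> inv w = t"
    using assms parabolic_closed[OF assms(1,2)] inversions_closed[OF assms(3)] by (simp add: m_assoc)
  ultimately show ?thesis by simp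
qed

lemma inversion_len_less:
  assumes "w \<in> carrier W" "t \<in> inversions w" shows "len (t \<otimes> w) < len w"
proof -
  obtain u where u: "u \<in> lists I" "val u = w" "length u = len w" using ex_reduced_word assms by blast
  then obtain u' where "u' \<in> lists I" "Suc (length u') = length u" "val u' = t \<otimes> w"
    using exchange[of I u t] assms by auto
  then show ?thesis using len_le[of u'] u by simp
qed

lemma len_gen_mult_le: "i \<in> I \<Longrightarrow> w \<in> carrier W \<Longrightarrow> len (i \<otimes> w) \<le> Suc (len w)"
proof -
  assume "i \<in> I" "w \<in> carrier W"
  moreover then obtain u where "u \<in> lists I" "val u = w" "length u = len w"
    using ex_reduced_word by blast
  ultimately show ?thesis using len_le[of "i # u"] by simp
qed

text \<open>Multiplying by \<open>i\<close> toggles whether \<open>i\<close> is an inversion, so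
  going back from \<open>i \<otimes> w\<close> to \<open>w\<close> shortens.\<close>

lemma len_up:
  assumes "i \<in> I" "w \<in> carrier W" "i \<notin> inversions w" shows "len (i \<otimes> w) = len w + 1"
proof -
  have "i \<in> inversions (i \<otimes> w)" using assms by simp
  then have "len (i \<otimes> (i \<otimes> w)) < len (i \<otimes> w)" using inversion_len_less assms by blast
  then show ?thesis using len_gen_mult_le[OF assms(1,2)] assms by simp
qed

lemma len_down:
  assumes "i \<in> I" "w \<in> carrier W" "i \<in> inversions w" shows "len (i \<otimes> w) < len w"
  using inversion_len_less assms by blast

lemma ex_descent:
  assumes "J \<subseteq> I" "w \<in> parabolic J" "w \<noteq> \<one>" shows "\<exists>j\<in>J. j \<in> inversions w"
proof -
  \<comment> \<open>The minimum is over words in \<open>J\<close>, because it is not known here that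
    \<open>len\<close>, a minimum over words in \<open>I\<close>, is attained by such a
    word.\<close>
  define u where "u = (ARG_MIN length u. u \<in> lists J \<and> val u = w)"
  have ex: "\<exists>u. u \<in> lists J \<and> val u = w" using assms by (auto simp: parabolic_def)
  have u: "u \<in> lists J" "val u = w"
    using arg_min_natI[of "\<lambda>u. u \<in> lists J \<and> val u = w"] ex unfolding u_def by blast+
  have min: "length u \<le> length v" if "v \<in> lists J" "val v = w" for v
    unfolding u_def by (rule arg_min_nat_le) (use that in auto)
  obtain j v where jv: "u = j # v" using u assms(3) by (cases u) auto
  have j: "j \<in> J" "j \<in> I" "v \<in> lists J" "v \<in> lists I" using u jv assms(1) by auto
  have "j \<in> inversions w"
  proof (rule ccontr)
    assume "j \<notin> inversions w"
    then have "j \<in> inversions (val v)" using j jv u by (metis inversions_gen_self val_Cons val_closed)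
    then obtain u' where "u' \<in> lists J" "Suc (length u') = length v" "val u' = j \<otimes> val v"
      using exchange[OF assms(1) j(3), of j] by metis
    then show False using min[of u'] u jv by simp
  qed
  then show ?thesis using j by blast
qed

text \<open>The presentation does not state that generators are non-trivial; the crossing parity
  detects it.\<close>

lemma one_notin_gens: "\<one> \<notin> I"
  by (metis inversions_gen inversions_one insert_not_empty)

lemma gen_in_parabolic_iff: "J \<subseteq> I \<Longrightarrow> i \<in> I \<Longrightarrow> i \<in> parabolic J \<longleftrightarrow> i \<in> J"
  using ex_descent[of J i] inversions_gen[of i] one_notin_gens parabolic_gen by (metis singletonD)

text \<open>A descent taken from \<open>J\<close> is an inversion of an element of
  \<open>parabolic K\<close>, so it lies in \<open>K\<close> as well and can be split off.\<close>

lemma parabolic_Int: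
  assumes "J \<subseteq> I" "K \<subseteq> I" shows "parabolic J \<inter> parabolic K = parabolic (J \<inter> K)"
proof
  show "parabolic (J \<inter> K) \<subseteq> parabolic J \<inter> parabolic K" by (simp add: parabolic_mono)
  have "w \<in> parabolic (J \<inter> K)" if "w \<in> parabolic J" "w \<in> parabolic K" for w
    using that
  proof (induction "len w" arbitrary: w rule: less_induct)
    case less
    show ?case
    proof (cases "w = \<one>")
      case False
      have w: "w \<in> carrier W" using parabolic_closed assms less.prems by blast
      obtain j where j: "j \<in> J" "j \<in> inversions w" using ex_descent less.prems assms False by blast
      then have "j \<in> K" using inversions_parabolic[of K w j] gen_in_parabolic_iff assms less.prems by blast
      then have jw: "j \<otimes> w \<in> parabolic (J \<inter> K)"
        using less j assms w by (meson inversion_len_less parabolic_gen parabolic_mult)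
      have "j \<otimes> (j \<otimes> w) \<in> parabolic (J \<inter> K)"
        by (rule parabolic_mult[OF _ parabolic_gen jw]) (use j \<open>j \<in> K\<close> assms in auto)
      then show ?thesis using j assms w by auto
    qed simp
  qed
  then show "parabolic J \<inter> parabolic K \<subseteq> parabolic (J \<inter> K)" by blast
qed

text \<open>This encodes additivity of the length on \<open>v \<otimes> w\<close>: no wall is
  crossed both by \<open>v\<close> and by the following \<open>w\<close>. In terms of inversion
  sets, associativity and inversion are plain set arguments.\<close>

definition reduced_product :: "'w \<Rightarrow> 'w \<Rightarrow> bool" where
  "reduced_product v w \<longleftrightarrow> (\<forall>t\<in>inversions v. inv v \<otimes> t \<otimes> v \<notin> inversions w)"

lemma reduced_product_subset:
  "v \<in> carrier W \<Longrightarrow> w \<in> carrier W \<Longrightarrow> reduced_product v w \<Longrightarrow> inversions v \<subseteq> inversions (v \<otimes> w)"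
  unfolding reduced_product_def using inversions_mult inversions_closed by blast

lemma reduced_product_gen:
  "i \<in> I \<Longrightarrow> reduced_product i w \<longleftrightarrow> i \<notin> inversions w"
  by (simp add: reduced_product_def inversions_gen)

lemma conj_inv_cancel: "v \<in> carrier W \<Longrightarrow> t \<in> carrier W \<Longrightarrow> v \<otimes> (inv v \<otimes> t \<otimes> v) \<otimes> inv v = t"
  by (simp add: m_assoc) (simp flip: m_assoc)

lemma reduced_product_inv:
  assumes "v \<in> carrier W" "w \<in> carrier W" "reduced_product v w"
  shows "reduced_product (inv w) (inv v)"
  unfolding reduced_product_def
proof
  fix t assume t: "t \<in> inversions (inv w)"
  then have tc: "t \<in> carrier W" by (rule inversions_closed)
  define s where "s = w \<otimes> t \<otimes> inv w"
  have s: "s \<in> carrier W" "s \<in> inversions w" using t tc assms inversions_inv by (auto simp: s_def)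
  have "v \<otimes> s \<otimes> inv v \<notin> inversions v"
  proof
    assume "v \<otimes> s \<otimes> inv v \<in> inversions v"
    then have "inv v \<otimes> (v \<otimes> s \<otimes> inv v) \<otimes> v \<notin> inversions w"
      using assms by (simp add: reduced_product_def)
    moreover have "inv v \<otimes> (v \<otimes> s \<otimes> inv v) \<otimes> v = s"
      using conj_inv_cancel[of "inv v" s] s assms by simp
    ultimately show False using s by simp
  qed
  then show "inv (inv w) \<otimes> t \<otimes> inv w \<notin> inversions (inv v)"
    using inversions_inv[of v s] s assms by (simp add: s_def)
qed

text \<open>A common wall would yield a reflection in \<open>parabolic J\<close> that is an
  inversion of \<open>w\<close>, and multiplying by it would shorten \<open>w\<close>, which is
  minimal in its coset.\<close>

lemma parabolic_reduced_product:
  assumes "J \<subseteq> I" "v \<in> parabolic J" "w \<in> carrier W"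
    and min: "\<And>a. a \<in> parabolic J \<Longrightarrow> len w \<le> len (a \<otimes> w)"
  shows "reduced_product v w"
  unfolding reduced_product_def
proof
  fix t assume "t \<in> inversions v"
  then have "t \<in> parabolic J" using inversions_parabolic assms by blast
  then have "inv v \<otimes> t \<otimes> v \<in> parabolic J" using assms by (simp add: parabolic_mult parabolic_inv)
  then show "inv v \<otimes> t \<otimes> v \<notin> inversions w"
    using min inversion_len_less assms(3) by (meson not_less)
qed

text \<open>The infinite dihedral group acts on the integers by the reflections in 0 and 2; the base
  point 1 is on the positive side of the first and the negative side of the second one.\<close>

primrec line_act :: "'w \<Rightarrow> 'w \<Rightarrow> 'w list \<Rightarrow> int \<Rightarrow> int" where
  "line_act i j [] x = x"
| "line_act i j (s # u) x =
     (if s = i then - line_act i j u x else if s = j then 4 - line_act i j u x else line_act i j u x)"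

lemma line_act_append: "line_act i j (u @ v) x = line_act i j u (line_act i j v x)"
  by (induction u) auto

text \<open>Letters other than \<open>i\<close> and \<open>j\<close> act trivially, and the relator
  \<open>ijij\<close> is absent because \<open>m i j\<close> is not 2; each remaining relator
  applies every reflection an even number of times in succession.\<close>

lemma line_act_cong:
  assumes "i \<in> I" "j \<in> I" "m i j \<noteq> 2" "i \<noteq> j" "u \<in> lists I" "v \<in> lists I" "val u = val v"
  shows "line_act i j u x = line_act i j v x"
proof -
  have step: "line_act i j a x = line_act i j b x" if "coxeter_step I m a b" for a b x
    using that
  proof cases
    case (1 p q n c d)
    from 1(3-5) have "line_act i j (concat (replicate n [p, q])) y = y" for y
      by (cases rule: relator_cases)
        (use assms m_sym in \<open>auto simp: numeral_2_eq_2\<close>)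
    then show ?thesis using 1 by (simp add: line_act_append)
  qed
  have "equivclp (coxeter_step I m) u v" using presentation assms by blast
  then show ?thesis by (induction rule: equivclp_induct) (use step in metis)+
qed

text \<open>The position of the image of 1 relative to the fixed points 0 and 2 shows the descents.
  A descent \<open>s\<close> can be moved to the front of the word; the shorter rest has no descent
  \<open>s\<close>, so induction places its point on the near side of the wall and the reflection
  carries it across.\<close>

lemma two_descents_dihedral:
  assumes ij: "i \<in> I" "j \<in> I" "m i j \<noteq> 2" "i \<noteq> j" and u: "u \<in> lists {i, j}"
  shows "(i \<in> inversions (val u) \<longrightarrow> line_act i j u 1 \<le> 0) \<and>
    (i \<notin> inversions (val u) \<longrightarrow> line_act i j u 1 \<ge> 0) \<and>
    (j \<in> inversions (val u) \<longrightarrow> line_act i j u 1 \<ge> 2) \<and>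
    (j \<notin> inversions (val u) \<longrightarrow> line_act i j u 1 \<le> 2)"
  using u
proof (induction "length u" arbitrary: u rule: less_induct)
  case less
  have sub: "{i,j} \<subseteq> I" using ij by auto
  have uI: "u \<in> lists I" using less.prems sub by auto
  have desc: "\<exists>v\<in>lists {i,j}. length v < length u \<and> line_act i j u 1 = line_act i j (s # v) 1
      \<and> s \<notin> inversions (val v)"
    if s: "s \<in> {i,j}" "s \<in> inversions (val u)" for s
  proof -
    obtain v where v: "v \<in> lists {i,j}" "Suc (length v) = length u" "val v = s \<otimes> val u"
      using exchange[OF sub less.prems s(2)] by blast
    have "val (s # v) = val u" using v s sub val_closed[OF uI] by auto
    moreover have "s # v \<in> lists I" using lists_sub[OF sub v(1)] s(1) sub by auto
    ultimately have "line_act i j u 1 = line_act i j (s # v) 1"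
      using line_act_cong[OF ij uI, of "s # v"] by metis
    moreover have "s \<notin> inversions (val v)" using v s sub val_closed[OF uI] by auto
    ultimately show ?thesis using v by (intro bexI[of _ v]) simp_all
  qed
  have iD: "line_act i j u 1 \<le> 0" if i: "i \<in> inversions (val u)"
  proof -
    obtain v where v: "v \<in> lists {i,j}" "length v < length u" "i \<notin> inversions (val v)"
      "line_act i j u 1 = - line_act i j v 1" using desc[OF _ i] by auto
    then show ?thesis using less.hyps[OF v(2,1)] by simp
  qed
  have jD: "line_act i j u 1 \<ge> 2" if j: "j \<in> inversions (val u)"
  proof -
    obtain v where v: "v \<in> lists {i,j}" "length v < length u" "j \<notin> inversions (val v)"
      "line_act i j u 1 = 4 - line_act i j v 1" using desc[OF _ j] ij(4) by auto
    then show ?thesis using less.hyps[OF v(2,1)] by simp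
  qed
  have "line_act i j u 1 = 1" if "i \<notin> inversions (val u)" "j \<notin> inversions (val u)"
  proof -
    have "val u \<in> parabolic {i,j}" using less.prems by (auto simp: parabolic_def)
    then have "val u = val []" using ex_descent[OF sub] that by auto
    then show ?thesis using line_act_cong[OF ij uI, of "[]"] by simp
  qed
  then show ?case using iD jD by fastforce
qed

text \<open>Write \<open>v = inv a \<otimes> w\<close> with \<open>w\<close> shortest in its coset
  of the subgroup generated by \<open>i\<close> and \<open>j\<close>. The descents \<open>i\<close>
  and \<open>j\<close> of \<open>v\<close> then belong to \<open>inv a\<close>, and in the infinite
  dihedral case the point of \<open>inv a\<close> would be both at most 0 and at least 2.\<close>

lemma two_descents:
  assumes ij: "i \<in> I" "j \<in> I" "i \<noteq> j" and v: "v \<in> carrier W" "i \<in> inversions v" "j \<in> inversions v"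
  shows "m i j = 2"
proof (rule ccontr)
  assume m: "m i j \<noteq> 2"
  let ?P = "parabolic {i,j}"
  have sub: "{i,j} \<subseteq> I" using ij by auto
  define a where "a = (ARG_MIN (\<lambda>a. len (a \<otimes> v)) a. a \<in> ?P)"
  have a: "a \<in> ?P" using arg_min_natI[of "\<lambda>a. a \<in> ?P" \<one>] unfolding a_def by simp
  have min: "len (a \<otimes> v) \<le> len (b \<otimes> v)" if "b \<in> ?P" for b
    unfolding a_def by (rule arg_min_nat_le) (rule that)
  define w where "w = a \<otimes> v"
  have ac: "a \<in> carrier W" and w: "w \<in> carrier W" using parabolic_closed[OF sub a] v by (auto simp: w_def)
  have minw: "len w \<le> len (b \<otimes> w)" if "b \<in> ?P" for b
    using min[of "b \<otimes> a"] that a sub v parabolic_closed[OF sub that] ac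
    by (simp add: w_def m_assoc parabolic_mult)
  have vw: "v = inv a \<otimes> w" using v ac by (simp add: w_def flip: m_assoc)
  have d: "inv a \<in> ?P" using a sub parabolic_inv by blast
  \<comment> \<open>Otherwise a conjugate of \<open>s\<close>, still in
    \<open>parabolic {i,j}\<close>, would be an inversion of the minimal \<open>w\<close>.\<close>
  have *: "s \<in> inversions (inv a)" if "s \<in> {i,j}" "s \<in> inversions v" for s
  proof (rule ccontr)
    assume "s \<notin> inversions (inv a)"
    then have "inv (inv a) \<otimes> s \<otimes> inv a \<in> inversions w"
      using that inversions_mult[of "inv a" w s] vw ac w sub by auto
    moreover have "inv (inv a) \<otimes> s \<otimes> inv a \<in> ?P"
      using that d a ac sub parabolic_gen[OF sub that(1)] by (simp add: parabolic_mult)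
    ultimately show False using inversion_len_less[OF w] minw by (meson not_less)
  qed
  obtain u where "u \<in> lists {i,j}" "inv a = val u" using d by (auto simp: parabolic_def)
  then show False using two_descents_dihedral[OF ij(1,2) m ij(3)] * v by fastforce
qed

section \<open>Generators commuting with a given one\<close>

definition perp :: "'w \<Rightarrow> 'w set" where
  "perp i = {j \<in> I. j \<noteq> i \<and> m i j = 2}"

lemma perp_subset [simp]: "perp i \<subseteq> I"
  by (auto simp: perp_def)

lemma insert_perp_subset [simp]: "i \<in> I \<Longrightarrow> insert i (perp i) \<subseteq> I"
  by (auto simp: perp_def)

lemma commute_perp:
  assumes "i \<in> I" "w \<in> parabolic (perp i)" shows "i \<otimes> w = w \<otimes> i"
proof -
  obtain u where "u \<in> lists (perp i)" "w = val u" using assms by (auto simp: parabolic_def)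
  then show ?thesis
  proof (induction u arbitrary: w)
    case (Cons j u)
    have j: "j \<in> I" "m i j = 2" "val u \<in> carrier W" using Cons by (auto simp: perp_def)
    have "i \<otimes> (j \<otimes> val u) = j \<otimes> (i \<otimes> val u)"
      using gen_commute[OF assms(1) j(1,2)] j assms by (simp flip: m_assoc)
    also have "\<dots> = j \<otimes> val u \<otimes> i" using Cons j assms by (simp add: m_assoc)
    finally show ?case using Cons by simp
  qed (use assms in simp)
qed

lemma gen_notin_parabolic_perp: "i \<in> I \<Longrightarrow> i \<notin> parabolic (perp i)"
  by (simp add: gen_in_parabolic_iff) (simp add: perp_def)

lemma parabolic_insert_perp:
  assumes "i \<in> I" "w \<in> parabolic (insert i (perp i))"
  shows "w \<in> parabolic (perp i) \<or> i \<otimes> w \<in> parabolic (perp i)"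
proof -
  obtain u where "u \<in> lists (insert i (perp i))" "w = val u" using assms by (auto simp: parabolic_def)
  then show ?thesis
  proof (induction u arbitrary: w)
    case (Cons j u)
    have u: "val u \<in> carrier W" using Cons assms(1) by (intro val_closed) (auto simp: perp_def)
    consider "j = i" | "j \<in> perp i" using Cons by auto
    then show ?case
    proof cases
      case 1 then show ?thesis using Cons u assms by auto
    next
      case 2
      then have j: "j \<in> I" "m i j = 2" by (auto simp: perp_def)
      have "i \<otimes> (j \<otimes> val u) = j \<otimes> (i \<otimes> val u)"
        using gen_commute[OF assms(1) j] u assms j(1) by (simp flip: m_assoc)
      then show ?thesis using Cons 2 parabolic_mult[OF perp_subset parabolic_gen[OF perp_subset 2]] by auto
    qed
  qed simp
qed

lemma perp_conj:
  assumes "i \<in> I" "w \<in> parabolic (perp i)" shows "inv w \<otimes> i \<otimes> w = i"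
  using commute_perp[OF assms] parabolic_closed[OF perp_subset assms(2)] assms(1)
  by (simp add: m_assoc) (simp flip: m_assoc)

lemma descent_perp_mult:
  assumes "i \<in> I" "v \<in> parabolic (perp i)" "w \<in> carrier W"
  shows "i \<in> inversions (v \<otimes> w) \<longleftrightarrow> i \<in> inversions w"
proof -
  have "i \<notin> inversions v"
    using inversions_parabolic[OF perp_subset assms(2)] gen_notin_parabolic_perp assms(1) by blast
  then show ?thesis
    using inversions_mult[of v w i] assms perp_conj parabolic_closed[OF perp_subset assms(2)] by simp
qed

text \<open>A panel crossing the wall of \<open>k\<close> lies in the tree-wall of \<open>k\<close>.\<close>

lemma conj_gen_eq_gen:
  assumes "w \<in> carrier W" "i \<in> I" "k \<in> I" "w \<otimes> i \<otimes> inv w = k" "k \<notin> inversions w"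
  shows "i = k \<and> w \<in> parabolic (perp k)"
  using assms
proof (induction "len (inv w)" arbitrary: w rule: less_induct)
  case less
  show ?case
  proof (cases "w = \<one>")
    case False
    let ?v = "inv w"
    have v: "?v \<in> carrier W" "?v \<noteq> \<one>" using less.prems False by auto
    then obtain j where j: "j \<in> I" "j \<in> inversions ?v"
      using ex_descent[of I ?v] parabolic_I by auto
    define w' where "w' = w \<otimes> j"
    have w': "w' \<in> carrier W" "inv w' = j \<otimes> ?v" "w = w' \<otimes> j"
      using j less.prems by (auto simp: w'_def inv_mult_group m_assoc)
    have shorter: "len (inv w') < len ?v" using j v w' len_down by simp
    have i_notin: "i \<notin> inversions ?v" using less.prems inversions_inv[of w i] by simp
    have ij: "i \<noteq> j" using i_notin j by blast
    have kw: "w \<otimes> i = k \<otimes> w" using less.prems by (metis gen_closed inv_closed inv_solve_right m_closed)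
    then have iv: "i \<otimes> ?v = ?v \<otimes> k"
      using less.prems by (metis gen_closed gen_inv inv_mult_group)
    \<comment> \<open>Both \<open>i\<close> and \<open>j\<close> are descents of
      \<open>i \<otimes> inv w\<close>, which equals \<open>inv w \<otimes> k\<close>. Hence they
      commute, and \<open>j\<close> can be stripped from the right end of \<open>w\<close> without
      changing the conjugate of \<open>i\<close>.\<close>
    have "j \<in> inversions (?v \<otimes> k)"
    proof -
      have "inv ?v \<otimes> j \<otimes> ?v \<noteq> k"
      proof
        assume "inv ?v \<otimes> j \<otimes> ?v = k"
        then have "w \<otimes> j \<otimes> inv w = w \<otimes> i \<otimes> inv w" using less.prems by simp
        then have "j = i" using less.prems j by (metis gen_closed inv_closed m_closed l_cancel r_cancel)
        then show False using ij by simp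
      qed
      then show ?thesis using j v less.prems inversions_gen[of k] by (simp add: inversions_mult)
    qed
    then have "j \<in> inversions (i \<otimes> ?v)" using iv by simp
    moreover have "i \<in> inversions (i \<otimes> ?v)" using i_notin less.prems v by simp
    ultimately have mij: "m i j = 2" using two_descents[of i j "i \<otimes> ?v"] ij j less.prems v by auto
    then have "i \<otimes> j = j \<otimes> i" using gen_commute less.prems j by blast
    then have jij: "j \<otimes> i \<otimes> j = i" using j less.prems by (simp add: m_assoc)
    have conj: "w' \<otimes> i \<otimes> inv w' = k"
    proof -
      have "w' \<otimes> i \<otimes> inv w' = w \<otimes> (j \<otimes> i \<otimes> j) \<otimes> inv w"
        using less.prems(1,2) j(1) by (simp add: w'_def inv_mult_group m_assoc)
      then show ?thesis using jij less.prems by simp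
    qed
    have "k \<notin> inversions w'"
    proof -
      have "inv w' \<otimes> k \<otimes> w' = i"
        using conj w' less.prems by (metis conj_inv_cancel gen_closed inv_closed inv_inv)
      then show ?thesis
        using inversions_mult[of w' j k] less.prems w' j ij inversions_gen[of j] by auto
    qed
    then have ih: "i = k" "w' \<in> parabolic (perp k)"
      using less.hyps[OF shorter w'(1) less.prems(2,3) conj] by auto
    then have "j \<in> perp k" using mij ij j by (auto simp: perp_def)
    then show ?thesis using ih w' parabolic_mult parabolic_gen perp_subset by metis
  qed (use less.prems in auto)
qed

end

context right_angled_coxeter_system
begin

lemma reduced_product_assoc_left:
  assumes "a \<in> carrier W" "b \<in> carrier W" "c \<in> carrier W"
    and "reduced_product b c" "reduced_product a (b \<otimes> c)"
  shows "reduced_product a b" "reduced_product (a \<otimes> b) c"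
proof -
  have sub: "inversions b \<subseteq> inversions (b \<otimes> c)" using reduced_product_subset assms by blast
  then show "reduced_product a b" using assms(5) unfolding reduced_product_def by blast
  show "reduced_product (a \<otimes> b) c"
    unfolding reduced_product_def
  proof
    fix t assume t: "t \<in> inversions (a \<otimes> b)"
    define s where "s = inv a \<otimes> t \<otimes> a"
    have tc: "t \<in> carrier W" using t inversions_closed by blast
    have sc: "s \<in> carrier W" using tc assms by (simp add: s_def)
    have eq: "inv (a \<otimes> b) \<otimes> t \<otimes> (a \<otimes> b) = inv b \<otimes> s \<otimes> b"
      using tc assms by (simp add: s_def inv_mult_group m_assoc)
    consider "t \<in> inversions a" | "s \<in> inversions b"
      using t tc assms inversions_mult[of a b t] by (auto simp: s_def)
    then have "inv b \<otimes> s \<otimes> b \<notin> inversions c"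
    proof cases
      case 1
      then have "s \<notin> inversions (b \<otimes> c)" using assms(5) by (simp add: reduced_product_def s_def)
      then show ?thesis using inversions_mult[of b c s] sub sc assms by auto
    next
      case 2 then show ?thesis using assms(4) by (simp add: reduced_product_def)
    qed
    then show "inv (a \<otimes> b) \<otimes> t \<otimes> (a \<otimes> b) \<notin> inversions c" by (simp add: eq)
  qed
qed

lemma reduced_product_assoc_right:
  assumes "a \<in> carrier W" "b \<in> carrier W" "c \<in> carrier W"
    and "reduced_product a b" "reduced_product (a \<otimes> b) c"
  shows "reduced_product a (b \<otimes> c)"
  unfolding reduced_product_def
proof
  fix t assume t: "t \<in> inversions a"
  define s where "s = inv a \<otimes> t \<otimes> a"
  have tc: "t \<in> carrier W" using t inversions_closed by blast
  have sc: "s \<in> carrier W" using tc assms by (simp add: s_def)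
  have "inv (a \<otimes> b) \<otimes> t \<otimes> (a \<otimes> b) = inv b \<otimes> s \<otimes> b"
    using tc assms by (simp add: s_def inv_mult_group m_assoc)
  moreover have "t \<in> inversions (a \<otimes> b)" using reduced_product_subset[of a b] assms t by blast
  ultimately have "inv b \<otimes> s \<otimes> b \<notin> inversions c" using assms(5) by (metis reduced_product_def)
  moreover have "s \<notin> inversions b" using assms(4) t by (simp add: reduced_product_def s_def)
  ultimately have "s \<notin> inversions (b \<otimes> c)" using inversions_mult[of b c s] assms sc by blast
  then show "inv a \<otimes> t \<otimes> a \<notin> inversions (b \<otimes> c)" by (simp add: s_def)
qed

end

section \<open>Panels, residues and wings\<close>

locale right_angled_building = building W I m C \<delta> + right_angled_coxeter_system W I m
  for W :: "('w, 'b) monoid_scheme" (structure)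
    and I :: "'w set" and m :: "'w \<Rightarrow> 'w \<Rightarrow> enat"
    and C :: "'c set" and \<delta> :: "'c \<Rightarrow> 'c \<Rightarrow> 'w"
begin

section \<open>Gates of panels and composition of distances\<close>

abbreviation "pan \<equiv> panel W C \<delta>"

lemma dist_closed' [simp]: "c \<in> C \<Longrightarrow> d \<in> C \<Longrightarrow> \<delta> c d \<in> carrier W"
  by (rule dist_closed)

lemma dist_self [simp]: "c \<in> C \<Longrightarrow> \<delta> c c = \<one>"
  by (simp add: dist_one_iff)

lemma dist_gen_neq: "i \<in> I \<Longrightarrow> c \<in> C \<Longrightarrow> \<delta> c d = i \<Longrightarrow> c \<noteq> d"
  using one_notin_gens dist_self by metis

lemma adj_sym: assumes "x \<in> C" "y \<in> C" "i \<in> I" "\<delta> x y = i" shows "\<delta> y x = i"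
proof -
  have "\<one> \<in> {i \<otimes> \<delta> y x, \<delta> y x}"
    using dist_adjacent[of x y x i] assms by simp
  moreover have "\<delta> y x \<noteq> \<one>" using dist_gen_neq[of i x y] assms dist_one_iff by blast
  ultimately have "i \<otimes> \<delta> y x = \<one>" by auto
  then show ?thesis using assms by (metis dist_closed gen_closed gen_sq l_cancel)
qed

lemma panel_iff: "x \<in> C \<Longrightarrow> y \<in> pan i x \<longleftrightarrow> y \<in> C \<and> (y = x \<or> \<delta> x y = i)"
  by (auto simp: panel_def dist_one_iff)

lemma panel_in_C: "y \<in> pan i x \<Longrightarrow> y \<in> C"
  by (auto simp: panel_def)

lemma panel_self [simp]: "x \<in> C \<Longrightarrow> x \<in> pan i x"
  by (simp add: panel_iff)

lemma panel_sym: "i \<in> I \<Longrightarrow> x \<in> C \<Longrightarrow> y \<in> pan i x \<Longrightarrow> x \<in> pan i y"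
  by (auto intro: adj_sym simp: panel_iff)

lemma panel_dist:
  assumes "i \<in> I" "x \<in> C" "y \<in> pan i x" "z \<in> pan i x" "y \<noteq> z" shows "\<delta> y z = i"
proof -
  have C: "y \<in> C" "z \<in> C" using assms panel_in_C by blast+
  show ?thesis
  proof (cases "y = x \<or> z = x")
    case True
    then show ?thesis using assms C by (auto intro: adj_sym simp: panel_iff)
  next
    case False
    then have "\<delta> y x = i" "\<delta> x z = i" using assms C by (auto intro: adj_sym simp: panel_iff)
    then have "\<delta> y z \<in> {i \<otimes> i, i}" using dist_adjacent[of y x z i] assms C by simp
    then show ?thesis using assms C dist_one_iff by auto
  qed
qed

lemma panel_eq: assumes "i \<in> I" "x \<in> C" "y \<in> pan i x" shows "pan i y = pan i x"
proof -
  have y: "y \<in> C" using assms panel_in_C by blast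
  have "pan i a \<subseteq> pan i b" if "a \<in> C" "b \<in> C" "a \<in> pan i b" for a b
  proof
    fix y assume y: "y \<in> pan i a"
    have "b \<in> pan i a" using panel_sym[OF assms(1) that(2,3)] .
    then have "\<delta> b y = i \<or> y = b" using panel_dist[OF assms(1) that(1) _ y, of b] by blast
    then show "y \<in> pan i b" using that(2) panel_in_C[OF y] panel_iff[OF that(2)] by blast
  qed
  then show ?thesis using panel_sym assms y by blast
qed

lemma dist_up:
  assumes "b \<in> C" "c \<in> C" "d \<in> C" "i \<in> I" "\<delta> b c = i" "i \<notin> inversions (\<delta> c d)"
  shows "\<delta> b d = i \<otimes> \<delta> c d"
  using dist_adjacent_up[OF assms(1-5)] len_up assms by simp

text \<open>\<open>i \<notin> inversions (\<delta> p d)\<close> is the form in which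
  \<open>p\<close> is said to be the gate (projection) of \<open>d\<close> on its
  \<open>i\<close>-panel; all other chambers of the panel are one step further from
  \<open>d\<close>.\<close>

lemma panel_gate:
  assumes "i \<in> I" "p \<in> C" "d \<in> C" "y \<in> pan i p" "y \<noteq> p" "i \<notin> inversions (\<delta> p d)"
  shows "\<delta> y d = i \<otimes> \<delta> p d" "i \<in> inversions (\<delta> y d)"
proof -
  have y: "y \<in> C" "\<delta> y p = i" using assms panel_in_C by (auto intro: adj_sym simp: panel_iff)
  show "\<delta> y d = i \<otimes> \<delta> p d" by (rule dist_up) (use y assms in auto)
  then show "i \<in> inversions (\<delta> y d)" using assms by simp
qed

lemma gate_unique:
  assumes "i \<in> I" "x \<in> C" "d \<in> C" "y \<in> pan i x" "z \<in> pan i x"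
    "i \<notin> inversions (\<delta> y d)" "i \<notin> inversions (\<delta> z d)"
  shows "y = z"
  using panel_gate(2)[of i y d z] assms panel_eq panel_in_C by blast

text \<open>The engine of the inductions on distance: a descent \<open>i\<close> of
  \<open>\<delta> x d\<close> gives an \<open>i\<close>-neighbour of \<open>x\<close> that is nearer
  to \<open>d\<close> and is the gate of \<open>d\<close> on their common panel.\<close>

lemma descent_gate:
  assumes "x \<in> C" "d \<in> C" "i \<in> I" "i \<in> inversions (\<delta> x d)"
  obtains p where "p \<in> pan i x" "p \<in> C" "p \<noteq> x" "\<delta> p d = i \<otimes> \<delta> x d" "\<delta> x d = i \<otimes> \<delta> p d"
    "i \<notin> inversions (\<delta> p d)" "len (\<delta> p d) < len (\<delta> x d)" "x \<in> pan i p"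
proof -
  obtain p where p: "p \<in> C" "\<delta> p x = i" "\<delta> p d = i \<otimes> \<delta> x d" using ex_adjacent assms by blast
  have *: "p \<in> pan i x" "p \<noteq> x" using p assms dist_gen_neq by (auto intro: adj_sym simp: panel_iff)
  have "i \<notin> inversions (\<delta> p d)" using assms p by simp
  moreover have "len (\<delta> p d) < len (\<delta> x d)" using len_down p assms by simp
  moreover have "\<delta> x d = i \<otimes> \<delta> p d" using p assms by simp
  ultimately show ?thesis using that p * panel_sym assms by blast
qed

lemma ex_gate:
  assumes "x \<in> C" "d \<in> C" "i \<in> I" obtains p where "p \<in> pan i x" "p \<in> C" "i \<notin> inversions (\<delta> p d)"
  using assms descent_gate[OF assms] panel_self by metis

lemma dist_comp:
  assumes "a \<in> C" "b \<in> C" "c \<in> C" "reduced_product (\<delta> a b) (\<delta> b c)"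
  shows "\<delta> a c = \<delta> a b \<otimes> \<delta> b c"
  using assms
proof (induction "len (\<delta> a b)" arbitrary: a rule: less_induct)
  case less
  show ?case
  proof (cases "a = b")
    case False
    then have "\<delta> a b \<noteq> \<one>" using less.prems dist_one_iff by blast
    then obtain i where i: "i \<in> I" "i \<in> inversions (\<delta> a b)"
      using ex_descent[of I "\<delta> a b"] parabolic_I less.prems by auto
    obtain p where p: "p \<in> C" "\<delta> p b = i \<otimes> \<delta> a b" "\<delta> a b = i \<otimes> \<delta> p b" "i \<notin> inversions (\<delta> p b)"
      "len (\<delta> p b) < len (\<delta> a b)" "a \<in> pan i p" "p \<noteq> a"
      using descent_gate[OF less.prems(1,2) i] by metis
    have ri: "reduced_product i (\<delta> p b)" using p i reduced_product_gen by blast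
    \<comment> \<open>Dropping the first letter keeps the product with \<open>\<delta> b c\<close>
      reduced: conjugation by \<open>i\<close> carries inversions of \<open>\<delta> p b\<close> to
      inversions of \<open>i \<otimes> \<delta> p b\<close>, since \<open>i\<close> itself is not
      among the former.\<close>
    have "reduced_product i (\<delta> p b \<otimes> \<delta> b c) \<and> reduced_product (\<delta> p b) (\<delta> b c)"
    proof -
      let ?a = "\<delta> p b" and ?c = "\<delta> b c"
      have cl: "?a \<in> carrier W" "?c \<in> carrier W" "i \<in> carrier W" using p less.prems i by auto
      have r: "reduced_product (i \<otimes> ?a) ?c" using less.prems(4) p(3) by metis
      have "reduced_product ?a ?c"
        unfolding reduced_product_def
      proof
        fix t assume t: "t \<in> inversions ?a"
        then have tc: "t \<in> carrier W" using inversions_closed by blast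
        have "t \<noteq> i" using t p by blast
        then have "i \<otimes> t \<otimes> i \<noteq> i" using i(1) tc conj_gen_eq_iff[of i t i] by simp
        then have "i \<otimes> t \<otimes> i \<in> inversions (i \<otimes> ?a)"
        proof -
          have "i \<otimes> (i \<otimes> t \<otimes> i) \<otimes> i = t" using i(1) tc by (simp add: m_assoc)
          then show ?thesis
            using inversions_gen_mult[OF i(1) cl(1), of "i \<otimes> t \<otimes> i"] i(1) tc t \<open>i \<otimes> t \<otimes> i \<noteq> i\<close> by simp
        qed
        then have "inv (i \<otimes> ?a) \<otimes> (i \<otimes> t \<otimes> i) \<otimes> (i \<otimes> ?a) \<notin> inversions ?c"
          using r by (simp add: reduced_product_def)
        moreover have "inv (i \<otimes> ?a) \<otimes> (i \<otimes> t \<otimes> i) \<otimes> (i \<otimes> ?a) = inv ?a \<otimes> t \<otimes> ?a"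
          using i cl tc by (simp add: inv_mult_group m_assoc)
        ultimately show "inv ?a \<otimes> t \<otimes> ?a \<notin> inversions ?c" by simp
      qed
      then show ?thesis using reduced_product_assoc_right[of i ?a ?c] cl ri r by blast
    qed
    then have r: "reduced_product i (\<delta> p b \<otimes> \<delta> b c)" "reduced_product (\<delta> p b) (\<delta> b c)" by auto
    have pc: "\<delta> p c = \<delta> p b \<otimes> \<delta> b c" using less.hyps[OF p(5,1)] less.prems r by blast
    then have "i \<notin> inversions (\<delta> p c)" using r i reduced_product_gen by simp
    then have "\<delta> a c = i \<otimes> \<delta> p c" using panel_gate(1)[of i p c a] p i less.prems by blast
    also have "\<dots> = i \<otimes> \<delta> p b \<otimes> \<delta> b c" using pc p(1) i(1) less.prems(2,3) by (simp add: m_assoc)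
    finally show ?thesis using p(3) by metis
  qed (use less.prems in simp)
qed

text \<open>The axioms move only the first argument of \<open>\<delta>\<close>. Symmetry comes from
  reversing a minimal gallery one step at a time, inverses of reduced products being
  reduced.\<close>

lemma dist_inv:
  assumes "c \<in> C" "d \<in> C" shows "\<delta> d c = inv (\<delta> c d)"
  using assms
proof (induction "len (\<delta> c d)" arbitrary: c rule: less_induct)
  case less
  show ?case
  proof (cases "c = d")
    case False
    then have "\<delta> c d \<noteq> \<one>" using less.prems dist_one_iff by blast
    then obtain i where i: "i \<in> I" "i \<in> inversions (\<delta> c d)"
      using ex_descent[of I "\<delta> c d"] parabolic_I less.prems by auto
    obtain p where p: "p \<in> C" "\<delta> c d = i \<otimes> \<delta> p d" "i \<notin> inversions (\<delta> p d)"
      "len (\<delta> p d) < len (\<delta> c d)" "p \<in> pan i c" "p \<noteq> c"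
      using descent_gate[OF less.prems i] by metis
    have dp: "\<delta> d p = inv (\<delta> p d)" using less p by blast
    have pc: "\<delta> p c = i" using p i less.prems by (auto intro: adj_sym simp: panel_iff)
    have "reduced_product i (\<delta> p d)" using p i reduced_product_gen by blast
    then have "reduced_product (inv (\<delta> p d)) i"
      using reduced_product_inv[of i "\<delta> p d"] i p less.prems by simp
    then have "\<delta> d c = \<delta> d p \<otimes> \<delta> p c" using dist_comp less.prems p dp pc by metis
    then show ?thesis using dp pc p i less.prems by (simp add: inv_mult_group)
  qed (use less.prems in simp)
qed

section \<open>Residues and their gates\<close>

lemma residue_shift:
  assumes "J \<subseteq> I" "x \<in> C" "y \<in> C" "d \<in> C" "\<delta> x y \<in> parabolic J"
  shows "\<exists>a\<in>parabolic J. \<delta> x d = a \<otimes> \<delta> y d"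
proof -
  obtain u where "u \<in> lists J" "\<delta> x y = val u" using assms by (auto simp: parabolic_def)
  then show ?thesis using assms(2)
  proof (induction u arbitrary: x)
    case Nil
    then show ?case using assms dist_one_iff by (intro bexI[of _ \<one>]) auto
  next
    case (Cons j u)
    then have j: "j \<in> J" "j \<in> I" "u \<in> lists I" using assms(1) by auto
    obtain b where b: "b \<in> C" "\<delta> b x = j" "\<delta> b y = j \<otimes> \<delta> x y" using ex_adjacent Cons assms j by blast
    have "\<delta> b y = val u" using b Cons j by simp
    then obtain a where a: "a \<in> parabolic J" "\<delta> b d = a \<otimes> \<delta> y d" using Cons b by auto
    have ac: "a \<in> carrier W" using a assms(1) parabolic_closed by blast
    have "\<delta> x b = j" using b j Cons adj_sym by blast
    \<comment> \<open>Without a length condition either value may occur; both differ from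
      \<open>\<delta> y d\<close> by a left factor in \<open>parabolic J\<close>.\<close>
    then have "\<delta> x d \<in> {j \<otimes> \<delta> b d, \<delta> b d}" using dist_adjacent[of x b d j] Cons b j assms by blast
    then have "\<delta> x d = (j \<otimes> a) \<otimes> \<delta> y d \<or> \<delta> x d = a \<otimes> \<delta> y d"
      using a ac j assms by (auto simp: m_assoc)
    then show ?case using a parabolic_mult[OF assms(1) parabolic_gen[OF assms(1) j(1)]] by blast
  qed
qed

lemma residue_trans:
  assumes "J \<subseteq> I" "x \<in> C" "y \<in> C" "z \<in> C" "\<delta> x y \<in> parabolic J" "\<delta> y z \<in> parabolic J"
  shows "\<delta> x z \<in> parabolic J"
  using residue_shift[of J x y z] assms parabolic_mult by metis

lemma residue_sym:
  "J \<subseteq> I \<Longrightarrow> x \<in> C \<Longrightarrow> y \<in> C \<Longrightarrow> \<delta> x y \<in> parabolic J \<Longrightarrow> \<delta> y x \<in> parabolic J"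
  using dist_inv parabolic_inv by metis

lemma panel_residue: "J \<subseteq> I \<Longrightarrow> i \<in> J \<Longrightarrow> x \<in> C \<Longrightarrow> y \<in> pan i x \<Longrightarrow> \<delta> x y \<in> parabolic J"
  using parabolic_gen by (auto simp: panel_iff)

lemma ex_left_translate:
  assumes "J \<subseteq> I" "z \<in> C" "x \<in> C" "a \<in> parabolic J"
  shows "\<exists>y\<in>C. \<delta> z y \<in> parabolic J \<and> \<delta> y x = a \<otimes> \<delta> z x"
proof -
  obtain u where "u \<in> lists J" "a = val u" using assms by (auto simp: parabolic_def)
  then show ?thesis
  proof (induction u arbitrary: a)
    case Nil then show ?case using assms by (intro bexI[of _ z]) auto
  next
    case (Cons j u)
    then have j: "j \<in> J" "j \<in> I" "val u \<in> carrier W" using assms(1) lists_sub by auto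
    obtain y where y: "y \<in> C" "\<delta> z y \<in> parabolic J" "\<delta> y x = val u \<otimes> \<delta> z x" using Cons by auto
    obtain b where b: "b \<in> C" "\<delta> b y = j" "\<delta> b x = j \<otimes> \<delta> y x" using ex_adjacent y assms j by blast
    have "\<delta> y b \<in> parabolic J" using b j y adj_sym parabolic_gen assms(1) by metis
    then have "\<delta> z b \<in> parabolic J" using residue_trans assms y b by blast
    then show ?case using b y Cons j assms by (intro bexI[of _ b]) (auto simp: m_assoc)
  qed
qed

text \<open>Take \<open>z\<close> nearest to \<open>x\<close> in the residue. By
  \<open>ex_left_translate\<close> every element of the coset of \<open>\<delta> z x\<close> is a
  distance from the residue to \<open>x\<close>, so \<open>\<delta> z x\<close> is shortest in its
  coset.\<close>

lemma residue_gate: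
  assumes "J \<subseteq> I" "c \<in> C" "x \<in> C"
  obtains z where "z \<in> C" "\<delta> c z \<in> parabolic J"
    "\<And>y. y \<in> C \<Longrightarrow> \<delta> c y \<in> parabolic J \<Longrightarrow> reduced_product (\<delta> y z) (\<delta> z x)"
proof -
  let ?P = "\<lambda>z. z \<in> C \<and> \<delta> c z \<in> parabolic J"
  define z where "z = (ARG_MIN (\<lambda>z. len (\<delta> z x)) z. ?P z)"
  have "?P c" using assms by simp
  then have z: "?P z" unfolding z_def by (rule arg_min_natI)
  have min: "len (\<delta> z x) \<le> len (\<delta> y x)" if "?P y" for y
    unfolding z_def by (rule arg_min_nat_le) (rule that)
  have "len (\<delta> z x) \<le> len (a \<otimes> \<delta> z x)" if a: "a \<in> parabolic J" for a
  proof -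
    obtain y where y: "y \<in> C" "\<delta> z y \<in> parabolic J" "\<delta> y x = a \<otimes> \<delta> z x"
      using ex_left_translate[OF assms(1) _ assms(3) a] z by blast
    then have "\<delta> c y \<in> parabolic J" using residue_trans[OF assms(1,2), of z y] z by blast
    then show ?thesis using min[of y] y by simp
  qed
  moreover have "\<delta> y z \<in> parabolic J" if "y \<in> C" "\<delta> c y \<in> parabolic J" for y
    using that z residue_trans[OF assms(1), of y c z] residue_sym assms by blast
  ultimately show ?thesis using that z parabolic_reduced_product assms by (metis dist_closed)
qed

text \<open>Panels of type \<open>i\<close> meeting a \<open>same_wall i\<close>-class form a tree-wall; the \<open>parallel i\<close>-classes in
  it correspond to the wings that the tree-wall bounds.\<close>

definition parallel :: "'w \<Rightarrow> 'c \<Rightarrow> 'c \<Rightarrow> bool" where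
  "parallel i x y \<longleftrightarrow> x \<in> C \<and> y \<in> C \<and> \<delta> x y \<in> parabolic (perp i)"

definition same_wall :: "'w \<Rightarrow> 'c \<Rightarrow> 'c \<Rightarrow> bool" where
  "same_wall i x y \<longleftrightarrow> x \<in> C \<and> y \<in> C \<and> \<delta> x y \<in> parabolic (insert i (perp i))"

text \<open>The chambers whose gate on the \<open>i\<close>-panel of \<open>c\<close> is
  \<open>c\<close> itself.\<close>

definition wing :: "'w \<Rightarrow> 'c \<Rightarrow> 'c set" where
  "wing i c = {x \<in> C. i \<notin> inversions (\<delta> c x)}"

lemma parallel_refl: "x \<in> C \<Longrightarrow> parallel i x x"
  by (simp add: parallel_def)

lemma parallel_sym: "parallel i x y \<Longrightarrow> parallel i y x"
  using residue_sym perp_subset by (auto simp: parallel_def)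

lemma parallel_trans: "parallel i x y \<Longrightarrow> parallel i y z \<Longrightarrow> parallel i x z"
  unfolding parallel_def using residue_trans perp_subset by blast

lemma parallel_in_C: "parallel i x y \<Longrightarrow> x \<in> C" "parallel i x y \<Longrightarrow> y \<in> C"
  by (auto simp: parallel_def)

lemma same_wall_refl: "x \<in> C \<Longrightarrow> same_wall i x x"
  by (simp add: same_wall_def)

lemma same_wall_sym: "i \<in> I \<Longrightarrow> same_wall i x y \<Longrightarrow> same_wall i y x"
  using residue_sym insert_perp_subset by (auto simp: same_wall_def)

lemma same_wall_trans: "i \<in> I \<Longrightarrow> same_wall i x y \<Longrightarrow> same_wall i y z \<Longrightarrow> same_wall i x z"
  unfolding same_wall_def using residue_trans insert_perp_subset by blast

lemma same_wall_in_C: "same_wall i x y \<Longrightarrow> x \<in> C" "same_wall i x y \<Longrightarrow> y \<in> C"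
  by (auto simp: same_wall_def)

lemma parallel_same_wall: "parallel i x y \<Longrightarrow> same_wall i x y"
  using parabolic_mono[of "perp i" "insert i (perp i)"] by (auto simp: parallel_def same_wall_def)

lemma panel_same_wall: "i \<in> I \<Longrightarrow> x \<in> C \<Longrightarrow> y \<in> pan i x \<Longrightarrow> same_wall i x y"
  using panel_residue[of "insert i (perp i)" i x y] panel_in_C by (auto simp: same_wall_def)

lemma panel_parallel_eq:
  assumes "i \<in> I" "x \<in> C" "y \<in> pan i x" "z \<in> pan i x" "parallel i y z" shows "y = z"
  using panel_dist[of i x y z] assms gen_notin_parabolic_perp by (auto simp: parallel_def)

text \<open>\<open>parabolic (insert i (perp i))\<close> is the product of
  \<open>{\<one>, i}\<close> and \<open>parabolic (perp i)\<close>; at most one step in the panel of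
  \<open>x\<close> removes the factor \<open>i\<close>.\<close>

lemma wall_split:
  assumes "i \<in> I" "same_wall i x y" obtains z where "z \<in> pan i x" "parallel i z y"
proof -
  have C: "x \<in> C" "y \<in> C" using assms same_wall_in_C by blast+
  consider "\<delta> x y \<in> parabolic (perp i)" | "i \<otimes> \<delta> x y \<in> parabolic (perp i)"
    using assms parabolic_insert_perp by (auto simp: same_wall_def)
  then show ?thesis
  proof cases
    case 1 then show ?thesis using that[of x] C by (simp add: parallel_def)
  next
    case 2
    obtain b where "b \<in> C" "\<delta> b x = i" "\<delta> b y = i \<otimes> \<delta> x y" using ex_adjacent C assms by blast
    then show ?thesis using 2 C that[of b] assms(1) by (auto intro: adj_sym simp: parallel_def panel_iff)
  qed
qed

lemma parallel_descent:
  assumes "i \<in> I" "parallel i x y" "d \<in> C"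
  shows "i \<in> inversions (\<delta> x d) \<longleftrightarrow> i \<in> inversions (\<delta> y d)"
  using residue_shift[of "perp i" x y d] descent_perp_mult assms
  by (metis dist_closed parallel_def perp_subset)

lemma wing_parallel: "i \<in> I \<Longrightarrow> parallel i x y \<Longrightarrow> wing i x = wing i y"
  using parallel_descent by (auto simp: wing_def)

lemma wing_self: "c \<in> C \<Longrightarrow> c \<in> wing i c"
  by (simp add: wing_def)

lemma wing_subset: "wing i c \<subseteq> C"
  by (auto simp: wing_def)

lemma panel_wing:
  assumes "k \<in> I" "c \<in> C" "y \<in> pan k c" shows "y \<in> wing k c \<longleftrightarrow> y = c"
proof (cases "y = c")
  case False
  then have "\<delta> c y = k" using assms by (simp add: panel_iff)
  then have "k \<in> inversions (\<delta> c y)" using inversions_gen[OF assms(1)] by simp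
  then show ?thesis using False by (simp add: wing_def)
qed (use assms wing_self in simp)

lemma wing_in_panel:
  assumes "x \<in> C" "c \<in> C" "i \<in> I" shows "\<exists>!p. p \<in> pan i c \<and> x \<in> wing i p"
proof -
  obtain p where "p \<in> pan i c" "p \<in> C" "i \<notin> inversions (\<delta> p x)" using ex_gate assms by blast
  then have "p \<in> pan i c \<and> x \<in> wing i p" using assms by (simp add: wing_def)
  moreover have "q = p" if "q \<in> pan i c \<and> x \<in> wing i q" for q
    using gate_unique[of i c x q p] that calculation assms by (simp add: wing_def)
  ultimately show ?thesis by blast
qed

text \<open>The gate \<open>p\<close> lies on a minimal gallery from \<open>c\<close> to
  \<open>x\<close>, so the walls between \<open>c\<close> and \<open>p\<close> are among those
  between \<open>c\<close> and \<open>x\<close>.\<close>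

lemma wing_gate_closed:
  assumes "k \<in> I" "c \<in> C" "x \<in> wing k c" "i \<in> I" "p \<in> pan i x" "i \<notin> inversions (\<delta> p c)"
  shows "p \<in> wing k c"
proof (cases "p = x")
  case False
  have C: "x \<in> C" "p \<in> C" using assms panel_in_C by (auto simp: wing_def)
  have "x \<in> pan i p" using assms C panel_sym by blast
  then have "\<delta> x c = i \<otimes> \<delta> p c" using panel_gate(1)[of i p c x] assms C False by blast
  then have cx: "\<delta> c x = \<delta> c p \<otimes> i"
    using dist_inv[of x c] dist_inv[of p c] C assms by (simp add: inv_mult_group)
  have "reduced_product i (\<delta> p c)" using assms reduced_product_gen by blast
  then have "reduced_product (\<delta> c p) i"
    using reduced_product_inv[of i "\<delta> p c"] dist_inv[of p c] C assms by simp
  then have "inversions (\<delta> c p) \<subseteq> inversions (\<delta> c x)"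
    using reduced_product_subset[of "\<delta> c p" i] cx C assms by simp
  then show ?thesis using assms C by (auto simp: wing_def)
qed (use assms in simp)

text \<open>A step leaving the wing crosses the wall of \<open>k\<close>, which makes its type
  \<open>i\<close> conjugate to \<open>k\<close> by \<open>\<delta> c x\<close>;
  \<open>conj_gen_eq_gen\<close> then forces \<open>i = k\<close> and the parallelism.\<close>

lemma wing_boundary:
  assumes "k \<in> I" "c \<in> C" "i \<in> I" "x \<in> wing k c" "y \<in> pan i x" "y \<notin> wing k c"
  shows "i = k" "parallel k c x"
proof -
  have C: "x \<in> C" "y \<in> C" using assms panel_in_C by (auto simp: wing_def)
  have "y \<noteq> x" using assms by blast
  then have "\<delta> y x = i" using panel_dist[of i x y x] C assms by simp
  then have "\<delta> y c \<in> {i \<otimes> \<delta> x c, \<delta> x c}" using dist_adjacent[of y x c i] C assms by blast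
  then have "inv (\<delta> y c) \<in> {inv (\<delta> x c) \<otimes> i, inv (\<delta> x c)}"
    using C assms by (auto simp: inv_mult_group)
  then have "\<delta> c y \<in> {\<delta> c x \<otimes> i, \<delta> c x}"
    using dist_inv[of x c] dist_inv[of y c] C assms by simp
  moreover have k: "k \<in> inversions (\<delta> c y)" "k \<notin> inversions (\<delta> c x)" using assms C by (auto simp: wing_def)
  ultimately have "\<delta> c y = \<delta> c x \<otimes> i" by auto
  then have "inv (\<delta> c x) \<otimes> k \<otimes> \<delta> c x = i"
    using k inversions_mult[of "\<delta> c x" i k] inversions_gen[of i] C assms by simp
  then have "\<delta> c x \<otimes> i \<otimes> inv (\<delta> c x) = k" using conj_inv_cancel[of "\<delta> c x" k] C assms by simp
  then show "i = k" "parallel k c x"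
    using conj_gen_eq_gen[of "\<delta> c x" i k] k C assms by (simp_all add: parallel_def)
qed

text \<open>A minimal gallery from outside to \<open>z\<close> must enter the wing, and by
  \<open>wing_boundary\<close> it does so at a chamber \<open>r\<close> parallel to
  \<open>c\<close>.\<close>

lemma wing_crossing:
  assumes "k \<in> I" "J \<subseteq> I" "c \<in> C" "z \<in> wing k c" "y \<in> C" "y \<notin> wing k c" "\<delta> y z \<in> parabolic J"
  shows "\<exists>r. parallel k c r \<and> \<delta> y r \<in> parabolic J \<and> reduced_product (\<delta> y r) (\<delta> r z)"
  using assms(5-7)
proof (induction "len (\<delta> y z)" arbitrary: y rule: less_induct)
  case less
  have z: "z \<in> C" using assms by (auto simp: wing_def)
  have "\<delta> y z \<noteq> \<one>" using less.prems assms(4) z dist_one_iff by blast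
  then obtain i where i: "i \<in> J" "i \<in> inversions (\<delta> y z)" using ex_descent assms less.prems by blast
  then have iI: "i \<in> I" using assms by blast
  obtain p where p: "p \<in> C" "p \<in> pan i y" "\<delta> p z = i \<otimes> \<delta> y z" "i \<notin> inversions (\<delta> p z)"
    "len (\<delta> p z) < len (\<delta> y z)" "y \<in> pan i p" "p \<noteq> y"
    using descent_gate[OF less.prems(1) z iI i(2)] by metis
  have yp: "\<delta> y p = i" using p iI less.prems by (auto simp: panel_iff)
  show ?case
  proof (cases "p \<in> wing k c")
    case True
    then have "parallel k c p" using wing_boundary(2)[of k c i p y] assms iI p less.prems by blast
    then show ?thesis using yp p iI i parabolic_gen[OF assms(2)] reduced_product_gen by auto
  next
    case False
    have pz: "\<delta> p z \<in> parabolic J" using p i parabolic_gen parabolic_mult less.prems assms(2) by metis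
    then obtain r where r: "parallel k c r" "\<delta> p r \<in> parabolic J" "reduced_product (\<delta> p r) (\<delta> r z)"
      using less.hyps[OF p(5,1)] False by blast
    have rC: "r \<in> C" using r parallel_in_C by blast
    have eq: "\<delta> p z = \<delta> p r \<otimes> \<delta> r z" using dist_comp r p rC z by blast
    have "reduced_product i (\<delta> p r \<otimes> \<delta> r z)" using p eq iI reduced_product_gen by metis
    then have red: "reduced_product i (\<delta> p r)" "reduced_product (i \<otimes> \<delta> p r) (\<delta> r z)"
      using reduced_product_assoc_left[of i "\<delta> p r" "\<delta> r z"] r rC p z iI by auto
    then have "\<delta> y r = i \<otimes> \<delta> p r" using dist_comp[of y p r] yp less.prems p rC by simp
    then show ?thesis using r red i parabolic_mult parabolic_gen assms(2) by metis
  qed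
qed

text \<open>The gate \<open>z\<close> of \<open>x\<close> on the residue is still in the wing, so
  the crossing happens inside the residue, between \<open>y\<close> and \<open>z\<close>. Distances
  from outside into the wing are thus controlled by boundary chambers of the residue.\<close>

lemma residue_wing_crossing:
  assumes "J \<subseteq> I" "k \<in> I" "c \<in> C" "x \<in> wing k c"
    and y: "y \<in> C" "\<delta> c y \<in> parabolic J" "y \<notin> wing k c"
  obtains r where "parallel k c r" "\<delta> c r \<in> parabolic J" "reduced_product (\<delta> y r) (\<delta> r x)"
proof -
  have x: "x \<in> C" using assms by (auto simp: wing_def)
  obtain z where z: "z \<in> C" "\<delta> c z \<in> parabolic J"
    and gate: "\<And>y. y \<in> C \<Longrightarrow> \<delta> c y \<in> parabolic J \<Longrightarrow> reduced_product (\<delta> y z) (\<delta> z x)"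
    using residue_gate[OF assms(1,3) x] by blast
  have "reduced_product (\<delta> c z) (\<delta> z x)" using gate assms by simp
  then have "inversions (\<delta> c z) \<subseteq> inversions (\<delta> c x)"
    using reduced_product_subset[of "\<delta> c z" "\<delta> z x"] dist_comp[of c z x] z x assms by simp
  then have zw: "z \<in> wing k c" using assms z by (auto simp: wing_def)
  have "\<delta> y z \<in> parabolic J" using y z residue_trans residue_sym assms(1,3) by blast
  then obtain r where r: "parallel k c r" "\<delta> y r \<in> parabolic J" "reduced_product (\<delta> y r) (\<delta> r z)"
    using wing_crossing[OF assms(2,1,3) zw y(1,3)] by blast
  have rC: "r \<in> C" using r parallel_in_C by blast
  have cr: "\<delta> c r \<in> parabolic J" using r y rC residue_trans assms(1,3) by blast
  have "\<delta> r x = \<delta> r z \<otimes> \<delta> z x" using dist_comp[of r z x] gate[OF rC cr] z x rC by blast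
  moreover have "\<delta> y z = \<delta> y r \<otimes> \<delta> r z" using dist_comp r y rC z by blast
  ultimately have "reduced_product (\<delta> y r) (\<delta> r x)"
    using reduced_product_assoc_right[of "\<delta> y r" "\<delta> r z" "\<delta> z x"] r gate[OF y(1,2)] y rC z x by simp
  then show ?thesis using that r cr by blast
qed

end

section \<open>Colourings and the extension of isometries\<close>

lemma bij_betw_pointed:
  assumes "bij_betw b A B" "a \<in> A" "v \<in> B" shows "\<exists>f. bij_betw f A B \<and> f a = v"
proof -
  obtain a' where a': "a' \<in> A" "b a' = v" using assms by (metis bij_betw_imp_surj_on imageE)
  have "bij_betw (b(a := v, a' := b a)) A B" if "a \<noteq> a'"
    using assms a' that unfolding bij_betw_def inj_on_def by (auto simp: image_iff)
  then show ?thesis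
    using assms a' by (cases "a = a'") (auto intro!: exI[of _ "b(a' := b a, a := v)"] simp: fun_upd_twist)
qed

context right_angled_building
begin

text \<open>Follow a minimal gallery back from \<open>y\<close>: injectivity gives
  \<open>f x \<noteq> f p\<close>, so the image step leaves the gate and lengthens the distance in
  the same way.\<close>

lemma isometry_if_adjacency_preserving:
  assumes "f ` C \<subseteq> C" "inj_on f C"
    and adj: "\<And>i x y. i \<in> I \<Longrightarrow> x \<in> C \<Longrightarrow> y \<in> pan i x \<Longrightarrow> f y \<in> pan i (f x)"
    and "x \<in> C" "y \<in> C"
  shows "\<delta> (f x) (f y) = \<delta> x y"
  using \<open>x \<in> C\<close>
proof (induction "len (\<delta> x y)" arbitrary: x rule: less_induct)
  case less
  have fC: "f z \<in> C" if "z \<in> C" for z using assms(1) that by blast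
  show ?case
  proof (cases "x = y")
    case False
    then have "\<delta> x y \<noteq> \<one>" using less.prems assms(5) dist_one_iff by blast
    then obtain i where i: "i \<in> I" "i \<in> inversions (\<delta> x y)"
      using ex_descent[of I "\<delta> x y"] parabolic_I less.prems assms(5) by auto
    obtain p where p: "p \<in> C" "p \<noteq> x" "\<delta> x y = i \<otimes> \<delta> p y" "i \<notin> inversions (\<delta> p y)"
      "len (\<delta> p y) < len (\<delta> x y)" "x \<in> pan i p"
      using descent_gate[OF less.prems assms(5) i] by metis
    have ih: "\<delta> (f p) (f y) = \<delta> p y" using less.hyps p by blast
    have "f x \<in> pan i (f p)" using adj i p by blast
    moreover have "f x \<noteq> f p" using assms(2) p less.prems by (metis inj_onD)
    ultimately have "\<delta> (f x) (f y) = i \<otimes> \<delta> (f p) (f y)"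
      using panel_gate(1)[OF i(1) fC[OF p(1)] fC[OF assms(5)]] ih p(4) by metis
    then show ?thesis using ih p(3) by metis
  qed (use fC assms in simp)
qed

definition colouring :: "'w \<Rightarrow> ('c \<Rightarrow> 'd) \<Rightarrow> 'd set \<Rightarrow> bool" where
  "colouring i \<chi> Y \<longleftrightarrow>
     (\<forall>x\<in>C. bij_betw \<chi> (pan i x) Y) \<and> (\<forall>x y. parallel i x y \<longrightarrow> \<chi> x = \<chi> y)"

lemma colouring_inj:
  "colouring i \<chi> Y \<Longrightarrow> x \<in> C \<Longrightarrow> y \<in> pan i x \<Longrightarrow> z \<in> pan i x \<Longrightarrow> \<chi> y = \<chi> z \<Longrightarrow> y = z"
  by (meson bij_betw_imp_inj_on colouring_def inj_onD)

lemma colouring_surj: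
  assumes "colouring i \<chi> Y" "x \<in> C" "v \<in> Y" obtains y where "y \<in> pan i x" "\<chi> y = v"
proof -
  have "\<chi> ` pan i x = Y" using assms(1,2) unfolding colouring_def bij_betw_def by blast
  then show ?thesis using assms(3) that by blast
qed

lemma colouring_mem: "colouring i \<chi> Y \<Longrightarrow> x \<in> C \<Longrightarrow> \<chi> x \<in> Y"
  by (meson bij_betw_apply colouring_def panel_self)

lemma colouring_parallel: "colouring i \<chi> Y \<Longrightarrow> parallel i x y \<Longrightarrow> \<chi> x = \<chi> y"
  by (simp add: colouring_def)

text \<open>\<open>K\<close> lists prescribed pairs of a chamber and its colour. A colouring of a
  tree-wall is determined by a bijection on one of its panels, the other chambers copying the colour
  of the parallel one there; compatibility with \<open>K\<close> is therefore required on a single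
  panel \<open>r\<close>.\<close>

lemma ex_colouring:
  assumes i: "i \<in> I"
    and K: "\<And>d v. (d, v) \<in> K \<Longrightarrow> d \<in> C"
    and ex: "\<And>x. x \<in> C \<Longrightarrow> \<exists>r \<beta>. same_wall i x r \<and> bij_betw \<beta> (pan i r) Y \<and>
      (\<forall>d v z. (d, v) \<in> K \<longrightarrow> z \<in> pan i r \<longrightarrow> parallel i d z \<longrightarrow> \<beta> z = v)"
  shows "\<exists>\<chi>. colouring i \<chi> Y \<and> (\<forall>d v. (d, v) \<in> K \<longrightarrow> \<chi> d = v)"
proof -
  define good where "good S p \<longleftrightarrow> (case p of (r, \<beta>) \<Rightarrow> r \<in> S \<and> bij_betw \<beta> (pan i r) Y \<and>
      (\<forall>d v z. (d, v) \<in> K \<longrightarrow> z \<in> pan i r \<longrightarrow> parallel i d z \<longrightarrow> \<beta> z = v))" for S p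
  \<comment> \<open>The choice uses \<open>x\<close> only through its tree-wall, so all chambers of
    a tree-wall receive the same panel and bijection.\<close>
  define R where "R x = (SOME p. good {y. same_wall i x y} p)" for x
  define r where "r x = fst (R x)" for x
  define \<beta> where "\<beta> x = snd (R x)" for x
  have "good {y. same_wall i x y} (R x)" if x: "x \<in> C" for x
  proof -
    obtain a b where "good {y. same_wall i x y} (a, b)" using ex[OF x] by (auto simp: good_def)
    then show ?thesis unfolding R_def by (rule someI)
  qed
  then have R: "same_wall i x (r x)" "bij_betw (\<beta> x) (pan i (r x)) Y"
    "\<And>d v z. (d, v) \<in> K \<Longrightarrow> z \<in> pan i (r x) \<Longrightarrow> parallel i d z \<Longrightarrow> \<beta> x z = v" if "x \<in> C" for x
    using that by (simp_all add: good_def r_def \<beta>_def case_prod_beta)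
  have Req: "r x = r y" "\<beta> x = \<beta> y" if "same_wall i x y" for x y
  proof -
    have "{z. same_wall i x z} = {z. same_wall i y z}"
      using that same_wall_sym same_wall_trans i by blast
    then show "r x = r y" "\<beta> x = \<beta> y" by (simp_all add: r_def \<beta>_def R_def)
  qed
  have ex1: "\<exists>!z. z \<in> pan i (r x) \<and> parallel i z x" if x: "x \<in> C" for x
  proof -
    have rC: "r x \<in> C" using R(1)[OF x] same_wall_in_C by blast
    obtain z where "z \<in> pan i (r x)" "parallel i z x"
      using wall_split[OF i same_wall_sym[OF i R(1)[OF x]]] by blast
    moreover have "z' = z" if "z' \<in> pan i (r x)" "parallel i z' x" for z'
      using panel_parallel_eq[OF i rC that(1) calculation(1)] that calculation parallel_trans parallel_sym
      by blast
    ultimately show ?thesis by blast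
  qed
  \<comment> \<open>The chamber of the selected panel that is parallel to \<open>x\<close>.\<close>
  define q where "q x = (THE z. z \<in> pan i (r x) \<and> parallel i z x)" for x
  have q: "q x \<in> pan i (r x)" "parallel i (q x) x" if "x \<in> C" for x
    using theI'[OF ex1[OF that]] unfolding q_def by blast+
  have q_eq: "q x = z" if "x \<in> C" "z \<in> pan i (r x)" "parallel i z x" for x z
    using ex1[OF that(1)] q[OF that(1)] that by blast
  define \<chi> where "\<chi> x = \<beta> x (q x)" for x
  have par: "\<chi> x = \<chi> y" if "parallel i x y" for x y
  proof -
    have C: "x \<in> C" "y \<in> C" using that parallel_in_C by blast+
    have "same_wall i x y" using that parallel_same_wall by blast
    note e = Req[OF this]
    have "q y = q x" using q_eq[OF C(2), of "q x"] q[OF C(1)] that parallel_trans e by simp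
    then show ?thesis using e by (simp add: \<chi>_def)
  qed
  have bij: "bij_betw \<chi> (pan i x) Y" if x: "x \<in> C" for x
  proof -
    have rC: "r x \<in> C" using R(1)[OF x] same_wall_in_C by blast
    have e: "r y = r x" "\<beta> y = \<beta> x" "y \<in> C" if "y \<in> pan i x" for y
      using Req[OF panel_same_wall[OF i x that]] that panel_in_C by auto
    have "bij_betw q (pan i x) (pan i (r x))"
    proof (rule bij_betw_imageI)
      show "inj_on q (pan i x)"
      proof
        fix y z assume yz: "y \<in> pan i x" "z \<in> pan i x" "q y = q z"
        then have "parallel i y z" using q(2) e(3) parallel_sym parallel_trans by metis
        then show "y = z" using panel_parallel_eq i x yz by blast
      qed
      show "q ` pan i x = pan i (r x)"
      proof
        show "q ` pan i x \<subseteq> pan i (r x)" using q(1) e by fastforce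
        show "pan i (r x) \<subseteq> q ` pan i x"
        proof
          fix z assume z: "z \<in> pan i (r x)"
          have "same_wall i x z"
            using R(1)[OF x] panel_same_wall[OF i rC z] same_wall_trans i by blast
          then obtain y where y: "y \<in> pan i x" "parallel i y z" using wall_split i by blast
          then have "q y = z" using q_eq[of y z] e[OF y(1)] z parallel_sym by simp
          then show "z \<in> q ` pan i x" using y by blast
        qed
      qed
    qed
    then have "bij_betw (\<beta> x \<circ> q) (pan i x) Y" using R(2)[OF x] bij_betw_trans by blast
    then show ?thesis by (rule bij_betw_cong[THEN iffD1, rotated]) (simp add: \<chi>_def e)
  qed
  have "\<chi> d = v" if "(d, v) \<in> K" for d v
    using R(3)[OF K[OF that] that q(1)[OF K[OF that]]] q(2)[OF K[OF that]] parallel_sym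
    by (simp add: \<chi>_def)
  then show ?thesis using par bij unfolding colouring_def by blast
qed

end

text \<open>The colour \<open>o0 i\<close> is reserved for the gate of the base chamber on every
  \<open>i\<close>-panel. A different colour thus marks a step away from the base, and equal colours
  mean equal progress in both systems.\<close>

locale based_colourings = right_angled_building W I m C \<delta>
  for W :: "('w, 'b) monoid_scheme" (structure)
    and I :: "'w set" and m :: "'w \<Rightarrow> 'w \<Rightarrow> enat"
    and C :: "'c set" and \<delta> :: "'c \<Rightarrow> 'c \<Rightarrow> 'w" +
  fixes c0 c0' :: 'c and \<chi> \<chi>' :: "'w \<Rightarrow> 'c \<Rightarrow> 'd" and Y :: "'w \<Rightarrow> 'd set" and o0 :: "'w \<Rightarrow> 'd"
  assumes c0: "c0 \<in> C" and c0': "c0' \<in> C"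
    and col: "i \<in> I \<Longrightarrow> colouring i (\<chi> i) (Y i)" and col': "i \<in> I \<Longrightarrow> colouring i (\<chi>' i) (Y i)"
    and base: "i \<in> I \<Longrightarrow> p \<in> C \<Longrightarrow> i \<notin> inversions (\<delta> p c0) \<Longrightarrow> \<chi> i p = o0 i"
    and base': "i \<in> I \<Longrightarrow> p \<in> C \<Longrightarrow> i \<notin> inversions (\<delta> p c0') \<Longrightarrow> \<chi>' i p = o0 i"
begin

text \<open>Pairs of chambers reached from the two bases by galleries with the same types and
  colours. It is a relation because a chamber has many minimal galleries. That \<open>x'\<close>
  also moves away from its base need not be demanded: the reserved colour ensures it.\<close>

inductive sync :: "'c \<Rightarrow> 'c \<Rightarrow> bool" where
  sync_base: "sync c0 c0'"
| sync_step: "\<lbrakk>sync p p'; i \<in> I; x \<in> pan i p; x \<noteq> p; i \<notin> inversions (\<delta> p c0);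
    x' \<in> pan i p'; \<chi>' i x' = \<chi> i x\<rbrakk> \<Longrightarrow> sync x x'"

lemma sync_step_neq:
  assumes "p \<in> C" "p' \<in> C" "\<delta> p' c0' = \<delta> p c0" "i \<in> I" "x \<in> pan i p" "x \<noteq> p"
    "i \<notin> inversions (\<delta> p c0)" "x' \<in> pan i p'" "\<chi>' i x' = \<chi> i x"
  shows "x' \<noteq> p'"
proof
  assume "x' = p'"
  then have "\<chi> i x = \<chi> i p" using base' base assms by metis
  then show False using colouring_inj[OF col, of i p x p] assms by simp
qed

lemma sync_dist: "sync x x' \<Longrightarrow> x \<in> C \<and> x' \<in> C \<and> \<delta> x' c0' = \<delta> x c0"
proof (induction rule: sync.induct)
  case sync_base then show ?case using c0 c0' by simp
next
  case (sync_step p p' i x x')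
  then have "x' \<noteq> p'" using sync_step_neq by blast
  then have "\<delta> x' c0' = i \<otimes> \<delta> p' c0'" "\<delta> x c0 = i \<otimes> \<delta> p c0"
    using panel_gate(1) sync_step c0 c0' by (metis, blast)
  then show ?case using sync_step panel_in_C by metis
qed

lemma sync_step_sym:
  assumes "sync p p'" "i \<in> I" "x \<in> pan i p" "x \<noteq> p" "i \<notin> inversions (\<delta> p c0)"
    "x' \<in> pan i p'" "\<chi>' i x' = \<chi> i x"
  shows "x' \<noteq> p'" "i \<notin> inversions (\<delta> p' c0')"
  using sync_dist[OF assms(1)] sync_step_neq[of p p' i x x'] assms by auto

lemma sync_total: "x \<in> C \<Longrightarrow> \<exists>x'. sync x x'"
proof (induction "len (\<delta> x c0)" arbitrary: x rule: less_induct)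
  case less
  show ?case
  proof (cases "x = c0")
    case False
    then have "\<delta> x c0 \<noteq> \<one>" using less.prems c0 dist_one_iff by blast
    then obtain i where i: "i \<in> I" "i \<in> inversions (\<delta> x c0)"
      using ex_descent[of I "\<delta> x c0"] parabolic_I less.prems c0 by auto
    obtain p where p: "p \<in> C" "p \<noteq> x" "i \<notin> inversions (\<delta> p c0)" "x \<in> pan i p"
      "len (\<delta> p c0) < len (\<delta> x c0)"
      using descent_gate[OF less.prems c0 i] by metis
    obtain p' where p': "sync p p'" using less.hyps p by blast
    obtain x' where "x' \<in> pan i p'" "\<chi>' i x' = \<chi> i x"
      using colouring_surj[OF col'] colouring_mem[OF col] i less.prems sync_dist[OF p'] by metis
    then show ?thesis using sync_step p p' i by metis
  qed (use sync_base in blast)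
qed

text \<open>If the last steps have one type, both leave the same gate. If the types differ, they are
  two descents and commute; completing a square on each side, the partner of \<open>x\<close> is the
  one corner whose \<open>i\<close>-colour and \<open>j\<close>-colour both fit.\<close>

lemma sync_unique: "sync x x1 \<Longrightarrow> sync x x2 \<Longrightarrow> x1 = x2"
proof (induction "len (\<delta> x c0)" arbitrary: x x1 x2 rule: less_induct)
  case less
  have x: "x \<in> C" "\<delta> x1 c0' = \<delta> x c0" "\<delta> x2 c0' = \<delta> x c0" "x1 \<in> C" "x2 \<in> C"
    using sync_dist less.prems by blast+
  show ?case
  proof (cases "x = c0")
    case True
    then have "x1 = c0'" "x2 = c0'" using x c0 c0' dist_one_iff by auto
    then show ?thesis by simp
  next
    case False
    obtain p p' i where p: "sync p p'" "i \<in> I" "x \<in> pan i p" "x \<noteq> p" "i \<notin> inversions (\<delta> p c0)"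
      "x1 \<in> pan i p'" "\<chi>' i x1 = \<chi> i x"
      using less.prems(1) False by (cases rule: sync.cases) auto
    obtain q q' j where q: "sync q q'" "j \<in> I" "x \<in> pan j q" "x \<noteq> q" "j \<notin> inversions (\<delta> q c0)"
      "x2 \<in> pan j q'" "\<chi>' j x2 = \<chi> j x"
      using less.prems(2) False by (cases rule: sync.cases) auto
    have C: "p \<in> C" "p' \<in> C" "q \<in> C" "q' \<in> C" and d: "\<delta> p' c0' = \<delta> p c0" "\<delta> q' c0' = \<delta> q c0"
      using sync_dist p q by blast+
    have px: "\<delta> x c0 = i \<otimes> \<delta> p c0" "i \<in> inversions (\<delta> x c0)"
      using panel_gate[OF p(2) C(1) c0 p(3-5)] by auto
    have qx: "\<delta> x c0 = j \<otimes> \<delta> q c0" "j \<in> inversions (\<delta> x c0)"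
      using panel_gate[OF q(2) C(3) c0 q(3-5)] by auto
    have pl: "len (\<delta> p c0) < len (\<delta> x c0)" "len (\<delta> q c0) < len (\<delta> x c0)"
      using px qx len_up[OF p(2) _ p(5)] len_up[OF q(2) _ q(5)] C c0 by simp_all
    show ?thesis
    proof (cases "i = j")
      case True
      have "p \<in> pan i x" "q \<in> pan i x" using p q True panel_sym C by blast+
      then have "p = q" using gate_unique[OF p(2) x(1) c0] p q True by blast
      then have "p' = q'" using less.hyps pl p q by blast
      then show ?thesis using colouring_inj[OF col'[OF p(2)] C(2), of x1 x2] p q True by simp
    next
      case ij: False
      have m2: "m i j = 2" using two_descents[OF p(2) q(2) ij _ px(2) qx(2)] x c0 by simp
      have perp: "j \<in> perp i" "i \<in> perp j" using m2 ij p q m_sym by (auto simp: perp_def)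
      have ji: "j \<otimes> i = i \<otimes> j" using gen_commute p q m2 by metis
      have iji: "i \<otimes> j \<otimes> i = j" "j \<otimes> i \<otimes> j = i" using p q by (simp_all add: m_assoc flip: ji)
      have par_perp: "parallel k a b" if "k \<in> I" "l \<in> perp k" "a \<in> C" "b \<in> pan l a" for k l a b
        using that panel_in_C panel_residue[of "perp k" l a b] by (auto simp: parallel_def)
      have jp: "j \<in> inversions (\<delta> p c0)"
        using px qx ij inversions_gen_mult[of i "\<delta> p c0" j] p q C c0 iji by simp
      \<comment> \<open>The corner of the square opposite to \<open>x\<close>, nearer to the base
        than both \<open>p\<close> and \<open>q\<close>.\<close>
      obtain u where u: "u \<in> C" "u \<noteq> p" "u \<in> pan j p" "p \<in> pan j u" "\<delta> u c0 = j \<otimes> \<delta> p c0"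
        "j \<notin> inversions (\<delta> u c0)" "len (\<delta> u c0) < len (\<delta> p c0)"
        using descent_gate[OF C(1) c0 q(2) jp] by metis
      have iu: "i \<notin> inversions (\<delta> u c0)"
        using parallel_descent[OF p(2) par_perp[OF p(2) perp(1) C(1) u(3)] c0] p by blast
      \<comment> \<open>Two successive steps of commuting types can be taken in the other
        order.\<close>
      have square: "\<exists>b. b \<in> pan l a \<and> b \<in> pan k e"
        if ae: "a \<in> C" "e \<in> C" "g \<in> C" "g \<in> pan k a" "g \<in> pan l e" "g \<noteq> a" "g \<noteq> e"
          and kl: "k \<in> I" "l \<in> I" "k \<noteq> l" "k \<otimes> l = l \<otimes> k" for a e g k l
      proof -
        have ag: "\<delta> a g = k" using that by (simp add: panel_iff)
        have ge: "\<delta> g e = l" using that panel_sym panel_iff by metis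
        have "reduced_product k l" using reduced_product_gen inversions_gen that by auto
        then have dae: "\<delta> a e = k \<otimes> l" using dist_comp[of a g e] ag ge that by simp
        obtain b where b: "b \<in> C" "\<delta> b a = l" "\<delta> b e = l \<otimes> \<delta> a e" using ex_adjacent ae(1,2) kl(2) by blast
        have "\<delta> b e = k" using b(3) dae that by simp
        then have "a \<in> pan l b" "e \<in> pan k b" using b that by (auto simp: panel_iff)
        then show ?thesis using panel_sym that b by blast
      qed
      obtain b where b: "b \<in> pan j x" "b \<in> pan i u"
        using square[of x u p i j] panel_sym x u p q C ij ji by metis
      have "b \<noteq> u"
      proof
        assume "b = u"
        then have "u \<in> pan j x" using b by simp
        then have "x \<in> pan j u" using panel_sym q(2) x(1) by blast
        then have "\<delta> p x = j" using panel_dist[OF q(2) u(1) u(4)] p(4) by metis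
        moreover have "\<delta> p x = i" using p C by (simp add: panel_iff)
        ultimately show False using ij by simp
      qed
      then have bu: "\<delta> b c0 = i \<otimes> \<delta> u c0" using panel_gate(1)[OF p(2) u(1) c0 b(2) _ iu] by simp
      have bC: "b \<in> C" using b panel_in_C by blast
      have "j \<notin> inversions (\<delta> b c0)"
        using inversions_gen_mult[OF p(2), of "\<delta> u c0" j] bu q(2) u(1,6) c0 iji(1) ij by simp
      \<comment> \<open>Both are gates of \<open>c0\<close> on the \<open>j\<close>-panel of
        \<open>x\<close>, so the square closes up at \<open>q\<close>.\<close>
      then have bq: "b = q"
        using gate_unique[OF q(2) x(1) c0 b(1)] q panel_sym C by blast
      obtain u' where u': "sync u u'" using sync_total u by blast
      have u'C: "u' \<in> C" "\<delta> u' c0' = \<delta> u c0" using sync_dist u' by blast+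
      \<comment> \<open>A step from \<open>u\<close> has some partner next to \<open>u'\<close>; by
        the uniqueness already known nearer to the base, it is the given one.\<close>
      have lift: "y' \<in> pan k u' \<and> \<chi>' k y' = \<chi> k y \<and> y' \<noteq> u'"
        if y: "y \<in> pan k u" "y \<noteq> u" "sync y y'" "k \<in> I" "k \<notin> inversions (\<delta> u c0)"
          "len (\<delta> y c0) < len (\<delta> x c0)" for k y y'
      proof -
        obtain y1 where y1: "y1 \<in> pan k u'" "\<chi>' k y1 = \<chi> k y"
          using colouring_surj[OF col'[OF y(4)] u'C(1)] colouring_mem[OF col[OF y(4)]] y(1) panel_in_C
          by metis
        have "sync y y1" using sync_step[OF u' y(4,1,2,5) y1] .
        then have "y1 = y'" using less.hyps[OF y(6) _ y(3)] by blast
        then show ?thesis using y1 sync_step_sym(1)[OF u' y(4,1,2,5) y1] by simp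
      qed
      have p'u: "p' \<in> pan j u'" "\<chi>' j p' = \<chi> j p" "p' \<noteq> u'"
        using lift[OF u(4) _ p(1) q(2) u(6)] u pl by auto
      have q'u: "q' \<in> pan i u'" "\<chi>' i q' = \<chi> i q" "q' \<noteq> u'"
        using lift[of q i q'] b bq \<open>b \<noteq> u\<close> q(1) p(2) iu pl by auto
      \<comment> \<open>The fourth corner on the other side. An \<open>i\<close>-colour is constant
        along \<open>j\<close>-steps and conversely, so \<open>y\<close> has the
        \<open>i\<close>-colour that singles out \<open>x1\<close> and the \<open>j\<close>-colour
        that singles out \<open>x2\<close>.\<close>
      obtain y where y: "y \<in> pan i p'" "y \<in> pan j q'"
        using square[of p' q' u' j i] panel_sym p'u q'u C u'C p(2) q(2) ij ji by metis
      have "\<chi>' i y = \<chi>' i q'"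
        using colouring_parallel[OF col'[OF p(2)] par_perp[OF p(2) perp(1) C(4) y(2)]] by simp
      moreover have "\<chi> i q = \<chi> i x"
        using colouring_parallel[OF col[OF p(2)] par_perp[OF p(2) perp(1) C(3) q(3)]] by simp
      ultimately have "y = x1"
        using colouring_inj[OF col'[OF p(2)] C(2) y(1) p(6)] q'u p(7) by simp
      have "\<chi>' j y = \<chi>' j p'"
        using colouring_parallel[OF col'[OF q(2)] par_perp[OF q(2) perp(2) C(2) y(1)]] by simp
      moreover have "\<chi> j p = \<chi> j x"
        using colouring_parallel[OF col[OF q(2)] par_perp[OF q(2) perp(2) C(1) p(3)]] by simp
      ultimately have "y = x2"
        using colouring_inj[OF col'[OF q(2)] C(4) y(2) q(6)] p'u q(7) by simp
      then show ?thesis using \<open>y = x1\<close> by simp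
    qed
  qed
qed

lemma swap: "based_colourings W I m C \<delta> c0' c0 \<chi>' \<chi> Y o0"
  using c0 c0' col col' base base' by unfold_locales

lemma sync_swap:
  assumes "sync x x'" shows "based_colourings.sync W I C \<delta> c0' c0 \<chi>' \<chi> x' x"
proof -
  interpret s: based_colourings W I m C \<delta> c0' c0 \<chi>' \<chi> Y o0 by (rule swap)
  show ?thesis
    using assms
  proof (induction rule: sync.induct)
    case (sync_step p p' i x x')
    note n = sync_step_sym[OF sync_step(1,2,3,4,5,6,7)]
    show ?case by (rule s.sync_step[OF sync_step.IH sync_step(2) sync_step(6) n sync_step(3)])
      (use sync_step in metis)
  qed (rule s.sync_base)
qed

text \<open>Existence and uniqueness of partners on both sides make \<open>sync\<close> the graph of
  a bijection. Within a panel everything is compared with its gate, so panels map to panels colour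
  by colour.\<close>

lemma ex_automorphism:
  "\<exists>f. bij_betw f C C \<and> (\<forall>x\<in>C. \<forall>y\<in>C. \<delta> (f x) (f y) = \<delta> x y) \<and> f c0 = c0' \<and>
     (\<forall>i\<in>I. \<forall>x\<in>C. \<chi>' i (f x) = \<chi> i x)"
proof -
  interpret s: based_colourings W I m C \<delta> c0' c0 \<chi>' \<chi> Y o0 by (rule swap)
  define f where "f x = (THE x'. sync x x')" for x
  have f: "sync x (f x)" if "x \<in> C" for x
    unfolding f_def by (rule theI') (use sync_total[OF that] sync_unique in blast)
  have f_eq: "f x = x'" if "sync x x'" for x x'
    unfolding f_def using that sync_unique by blast
  have fC: "f x \<in> C" if "x \<in> C" for x using f sync_dist that by blast
  have s_swap: "sync x x'" if "s.sync x' x" for x x'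
    using s.sync_swap[OF that] .
  have inj: "inj_on f C"
  proof
    fix x y assume "x \<in> C" "y \<in> C" "f x = f y"
    then have "s.sync (f x) x" "s.sync (f x) y" using f sync_swap by metis+
    then show "x = y" using s.sync_unique by blast
  qed
  have surj: "f ` C = C"
  proof
    show "C \<subseteq> f ` C"
    proof
      fix y assume "y \<in> C"
      then obtain x where "s.sync y x" using s.sync_total by blast
      then have "sync x y" using s_swap by blast
      then show "y \<in> f ` C" using f_eq sync_dist by blast
    qed
  qed (use fC in blast)
  \<comment> \<open>For \<open>y = p\<close> both colours are the reserved one; otherwise this is a
    defining step of \<open>sync\<close>.\<close>
  have gate: "f y \<in> pan i (f p) \<and> \<chi>' i (f y) = \<chi> i y"
    if ipy: "i \<in> I" "p \<in> C" "y \<in> pan i p" "i \<notin> inversions (\<delta> p c0)" for i p y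
  proof (cases "y = p")
    case True
    have "i \<notin> inversions (\<delta> (f p) c0')" using sync_dist[OF f[OF that(2)]] that(4) by simp
    then show ?thesis using True that fC base base' by simp
  next
    case False
    obtain y' where y': "y' \<in> pan i (f p)" "\<chi>' i y' = \<chi> i y"
      using colouring_surj[OF col'[OF ipy(1)] fC[OF ipy(2)]] colouring_mem[OF col[OF ipy(1)]] ipy(3)
        panel_in_C by metis
    then have "f y = y'" using sync_step[OF f[OF that(2)] that(1,3) False that(4)] f_eq by blast
    then show ?thesis using y' by simp
  qed
  have adj: "f y \<in> pan i (f x)" if ix: "i \<in> I" "x \<in> C" "y \<in> pan i x" for i x y
  proof -
    obtain p where p: "p \<in> pan i x" "p \<in> C" "i \<notin> inversions (\<delta> p c0)" using ex_gate ix c0 by blast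
    have "pan i p = pan i x" using panel_eq that p by blast
    then have "f x \<in> pan i (f p)" "f y \<in> pan i (f p)" using gate p that by auto
    then show ?thesis using panel_eq[OF that(1) fC[OF p(2)]] by blast
  qed
  have "\<chi>' i (f x) = \<chi> i x" if ix: "i \<in> I" "x \<in> C" for i x
  proof -
    obtain p where p: "p \<in> pan i x" "p \<in> C" "i \<notin> inversions (\<delta> p c0)" using ex_gate ix c0 by blast
    then show ?thesis using gate[OF that(1) p(2) _ p(3)] panel_sym that by blast
  qed
  moreover have "\<delta> (f x) (f y) = \<delta> x y" if "x \<in> C" "y \<in> C" for x y
    using isometry_if_adjacency_preserving[OF _ inj adj that] surj by blast
  ultimately show ?thesis using inj surj f_eq[OF sync_base] unfolding bij_betw_def by blast
qed

end

section \<open>Extending partial isometries\<close>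

locale semi_regular_building = right_angled_building W I m C \<delta>
  for W :: "('w, 'b) monoid_scheme" (structure)
    and I :: "'w set" and m :: "'w \<Rightarrow> 'w \<Rightarrow> enat"
    and C :: "'c set" and \<delta> :: "'c \<Rightarrow> 'c \<Rightarrow> 'w" +
  assumes semi_regular: "semi_regular W I C \<delta>"
begin

lemma ex_panel_bij:
  assumes "i \<in> I" "x \<in> C" "y \<in> C" "a \<in> pan i x" "v \<in> pan i y"
  shows "\<exists>b. bij_betw b (pan i x) (pan i y) \<and> b a = v"
proof -
  have "pan i x \<approx> pan i y" using semi_regular assms by (simp add: semi_regular_def)
  then show ?thesis using bij_betw_pointed assms(4,5) by (auto simp: eqpoll_def)
qed

text \<open>\<open>closed\<close> lets every chamber of \<open>D\<close> be reached from
  \<open>c0\<close> by a minimal gallery inside \<open>D\<close>. \<open>local\<close> says that on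
  each tree-wall meeting \<open>D\<close> the map on parallelism classes induced by
  \<open>\<phi>\<close> extends to a bijection. Colour the source freely, transport the colours
  along \<open>\<phi>\<close> to the target, and take the automorphism matching the two
  systems.\<close>

theorem extend_isometry:
  assumes D: "D \<subseteq> C" "c0 \<in> D" and \<phi>C: "\<phi> ` D \<subseteq> C"
    and iso: "\<And>x y. x \<in> D \<Longrightarrow> y \<in> D \<Longrightarrow> \<delta> (\<phi> x) (\<phi> y) = \<delta> x y"
    and closed: "\<And>i x p. i \<in> I \<Longrightarrow> x \<in> D \<Longrightarrow> p \<in> pan i x \<Longrightarrow> i \<notin> inversions (\<delta> p c0) \<Longrightarrow> p \<in> D"
    and local: "\<And>i x. i \<in> I \<Longrightarrow> x \<in> D \<Longrightarrow> \<exists>y b. y \<in> D \<and> same_wall i x y \<and>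
      bij_betw b (pan i y) (pan i (\<phi> y)) \<and>
      (\<forall>d z. d \<in> D \<longrightarrow> z \<in> pan i y \<longrightarrow> parallel i d z \<longrightarrow> parallel i (\<phi> d) (b z))"
  shows "\<exists>f. bij_betw f C C \<and> (\<forall>x\<in>C. \<forall>y\<in>C. \<delta> (f x) (f y) = \<delta> x y) \<and> (\<forall>x\<in>D. f x = \<phi> x)"
proof -
  define c0' where "c0' = \<phi> c0"
  have c0: "c0 \<in> C" "c0' \<in> C" using D \<phi>C by (auto simp: c0'_def)
  have \<phi>_in: "\<phi> x \<in> C" if "x \<in> D" for x using that \<phi>C by blast
  have parallel_\<phi>: "parallel i (\<phi> x) (\<phi> y) \<longleftrightarrow> parallel i x y" if "x \<in> D" "y \<in> D" for i x y
    using that iso \<phi>_in D by (auto simp: parallel_def)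
  have wall_\<phi>: "same_wall i (\<phi> x) (\<phi> y) \<longleftrightarrow> same_wall i x y" if "x \<in> D" "y \<in> D" for i x y
    using that iso \<phi>_in D by (auto simp: same_wall_def)
  have "\<exists>\<chi> \<chi>'. colouring i \<chi> (pan i c0) \<and> colouring i \<chi>' (pan i c0) \<and>
     (\<forall>p\<in>C. i \<notin> inversions (\<delta> p c0) \<longrightarrow> \<chi> p = c0) \<and>
     (\<forall>p\<in>C. i \<notin> inversions (\<delta> p c0') \<longrightarrow> \<chi>' p = c0) \<and> (\<forall>x\<in>D. \<chi>' (\<phi> x) = \<chi> x)" if i: "i \<in> I" for i
  proof -
    \<comment> \<open>The colour set is \<open>pan i c0\<close>, with \<open>c0\<close> as the
      reserved colour. On one panel per tree-wall the gate gets this colour, and no other chamber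
      there is parallel to a gate of \<open>e\<close>.\<close>
    have base_good: "\<exists>r \<beta>. same_wall i x r \<and> bij_betw \<beta> (pan i r) (pan i c0) \<and> r \<in> pan i x \<and> r \<in> C \<and>
        i \<notin> inversions (\<delta> r e) \<and>
        (\<forall>d z. d \<in> C \<longrightarrow> i \<notin> inversions (\<delta> d e) \<longrightarrow> z \<in> pan i r \<longrightarrow> parallel i d z \<longrightarrow> \<beta> z = c0)"
      if x: "x \<in> C" and e: "e \<in> C" for x e
    proof -
      obtain r where r: "r \<in> pan i x" "r \<in> C" "i \<notin> inversions (\<delta> r e)" using ex_gate x e i by blast
      obtain \<beta> where \<beta>: "bij_betw \<beta> (pan i r) (pan i c0)" "\<beta> r = c0"
        using ex_panel_bij[OF i r(2) c0(1), of r c0] r c0 by auto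
      have "z = r" if "d \<in> C" "i \<notin> inversions (\<delta> d e)" "z \<in> pan i r" "parallel i d z" for d z
        using that gate_unique[OF i r(2) e that(3), of r] parallel_descent[OF i that(4) e] r by simp
      then show ?thesis using r \<beta> panel_same_wall[OF i x r(1)] by blast
    qed
    have "\<exists>\<chi>. colouring i \<chi> (pan i c0) \<and>
        (\<forall>d v. (d, v) \<in> {(p, c0) |p. p \<in> C \<and> i \<notin> inversions (\<delta> p c0)} \<longrightarrow> \<chi> d = v)"
    proof (rule ex_colouring[OF i])
      fix x assume "x \<in> C"
      from base_good[OF this c0(1)] show "\<exists>r \<beta>. same_wall i x r \<and> bij_betw \<beta> (pan i r) (pan i c0) \<and>
        (\<forall>d v z. (d, v) \<in> {(p, c0) |p. p \<in> C \<and> i \<notin> inversions (\<delta> p c0)} \<longrightarrow> z \<in> pan i r \<longrightarrow>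
          parallel i d z \<longrightarrow> \<beta> z = v)" by blast
    qed auto
    then obtain \<chi> where \<chi>: "colouring i \<chi> (pan i c0)" "\<forall>p\<in>C. i \<notin> inversions (\<delta> p c0) \<longrightarrow> \<chi> p = c0"
      by auto
    define K where "K = {(p, c0) |p. p \<in> C \<and> i \<notin> inversions (\<delta> p c0')} \<union> {(\<phi> d, \<chi> d) |d. d \<in> D}"
    have "\<exists>\<chi>'. colouring i \<chi>' (pan i c0) \<and> (\<forall>d v. (d, v) \<in> K \<longrightarrow> \<chi>' d = v)"
    proof (rule ex_colouring[OF i])
      show "d \<in> C" if "(d, v) \<in> K" for d v using that \<phi>_in by (auto simp: K_def)
      fix x assume x: "x \<in> C"
      show "\<exists>r \<beta>. same_wall i x r \<and> bij_betw \<beta> (pan i r) (pan i c0) \<and>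
        (\<forall>d v z. (d, v) \<in> K \<longrightarrow> z \<in> pan i r \<longrightarrow> parallel i d z \<longrightarrow> \<beta> z = v)"
      proof (cases "\<exists>d\<in>D. same_wall i x (\<phi> d)")
        case False
        obtain r \<beta> where r: "same_wall i x r" "bij_betw \<beta> (pan i r) (pan i c0)" "r \<in> pan i x" "r \<in> C"
          and \<beta>: "\<And>d z. d \<in> C \<Longrightarrow> i \<notin> inversions (\<delta> d c0') \<Longrightarrow> z \<in> pan i r \<Longrightarrow> parallel i d z \<Longrightarrow> \<beta> z = c0"
          using base_good[OF x c0(2)] by blast
        have "\<beta> z = v" if "(d, v) \<in> K" "z \<in> pan i r" "parallel i d z" for d v z
        proof (cases "d \<in> \<phi> ` D")
          case True
          have "same_wall i x z" using r that panel_same_wall[OF i r(4)] same_wall_trans i by blast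
          then have "same_wall i x d"
            using that(3) parallel_same_wall parallel_sym same_wall_trans i by blast
          then show ?thesis using False True by blast
        next
          case False
          then show ?thesis using that \<beta> by (auto simp: K_def)
        qed
        then show ?thesis using r by blast
      next
        case True
        then obtain d0 where d0: "d0 \<in> D" "same_wall i x (\<phi> d0)" by blast
        obtain y b where y: "y \<in> D" "same_wall i d0 y" "bij_betw b (pan i y) (pan i (\<phi> y))"
          and b: "\<And>d z. d \<in> D \<Longrightarrow> z \<in> pan i y \<Longrightarrow> parallel i d z \<Longrightarrow> parallel i (\<phi> d) (b z)"
          using local[OF i d0(1)] by blast
        have yC: "y \<in> C" "\<phi> y \<in> C" using y D \<phi>_in by auto
        \<comment> \<open>Chosen so that \<open>b z\<close> receives the colour of
          \<open>z\<close>.\<close>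
        define \<beta> where "\<beta> = \<chi> \<circ> inv_into (pan i y) b"
        have inv: "inv_into (pan i y) b (b z) = z" if "z \<in> pan i y" for z
          using that y(3) by (simp add: bij_betw_def)
        have bpan: "b z \<in> pan i (\<phi> y)" if "z \<in> pan i y" for z using y(3) that bij_betwE by blast
        have bij: "bij_betw \<beta> (pan i (\<phi> y)) (pan i c0)"
          unfolding \<beta>_def using \<chi>(1) yC by (intro bij_betw_trans[OF bij_betw_inv_into[OF y(3)]])
            (simp add: colouring_def)
        have wall: "same_wall i x (\<phi> y)" using d0 y wall_\<phi> same_wall_trans i by blast
        \<comment> \<open>The gate on the source panel lies in \<open>D\<close>, and
          \<open>\<phi>\<close> sends it to the gate on the target panel; this is where the two
          demands in \<open>K\<close> meet, and both give \<open>c0\<close>.\<close>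
        obtain p where p: "p \<in> pan i y" "p \<in> C" "i \<notin> inversions (\<delta> p c0)" using ex_gate yC c0 i by blast
        have pD: "p \<in> D" using closed i y p by blast
        have p\<phi>: "i \<notin> inversions (\<delta> (\<phi> p) c0')" using iso[OF pD D(2)] p by (simp add: c0'_def)
        have "\<delta> (\<phi> y) (\<phi> p) = \<delta> y p" using iso y pD by blast
        then have p\<phi>y: "\<phi> p \<in> pan i (\<phi> y)"
          using p yC \<phi>_in[OF pD] by (auto simp: panel_iff dist_one_iff)
        have "parallel i (\<phi> p) (b p)" using b[OF pD p(1)] parallel_refl p by blast
        then have bp: "b p = \<phi> p" using panel_parallel_eq[OF i yC(2) p\<phi>y bpan[OF p(1)]] by simp
        have "\<beta> z = v" if z: "(d, v) \<in> K" "z \<in> pan i (\<phi> y)" "parallel i d z" for d v z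
        proof -
          consider (base) "d \<in> C" "i \<notin> inversions (\<delta> d c0')" "v = c0"
            | (pres) d1 where "d1 \<in> D" "d = \<phi> d1" "v = \<chi> d1" using z(1) by (auto simp: K_def)
          then show ?thesis
          proof cases
            case base
            have "i \<notin> inversions (\<delta> z c0')" using parallel_descent[OF i z(3) c0(2)] base by blast
            then have "z = \<phi> p" using gate_unique[OF i yC(2) c0(2) z(2) p\<phi>y _ p\<phi>] by blast
            then have "\<beta> z = \<chi> p" using inv[OF p(1)] bp by (simp add: \<beta>_def)
            then show ?thesis using \<chi>(2) p base by simp
          next
            case pres
            have "same_wall i (\<phi> d1) (\<phi> y)"
              using parallel_same_wall[OF z(3)] panel_same_wall[OF i yC(2) z(2)] pres
                same_wall_sym same_wall_trans i by blast
            then have "same_wall i y d1" using wall_\<phi> pres y same_wall_sym i by blast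
            then obtain w where w: "w \<in> pan i y" "parallel i w d1" using wall_split i by blast
            have "parallel i d (b w)" using b[OF pres(1) w(1)] parallel_sym[OF w(2)] pres by blast
            then have "parallel i z (b w)" using z(3) parallel_sym parallel_trans by blast
            then have "z = b w" using panel_parallel_eq[OF i yC(2) z(2) bpan[OF w(1)]] by blast
            then have "\<beta> z = \<chi> w" using inv[OF w(1)] by (simp add: \<beta>_def)
            then show ?thesis using colouring_parallel[OF \<chi>(1) w(2)] pres by simp
          qed
        qed
        then show ?thesis using wall bij by blast
      qed
    qed
    then obtain \<chi>' where \<chi>': "colouring i \<chi>' (pan i c0)" "\<And>d v. (d, v) \<in> K \<Longrightarrow> \<chi>' d = v" by blast
    have "\<chi>' p = c0" if "p \<in> C" "i \<notin> inversions (\<delta> p c0')" for p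
      by (rule \<chi>'(2)) (use that in \<open>auto simp: K_def\<close>)
    moreover have "\<chi>' (\<phi> x) = \<chi> x" if "x \<in> D" for x
      by (rule \<chi>'(2)) (use that in \<open>auto simp: K_def\<close>)
    ultimately show ?thesis using \<chi> \<chi>'(1) by blast
  qed
  then have "\<forall>i\<in>I. \<exists>p. colouring i (fst p) (pan i c0) \<and> colouring i (snd p) (pan i c0) \<and>
     (\<forall>x\<in>C. i \<notin> inversions (\<delta> x c0) \<longrightarrow> fst p x = c0) \<and>
     (\<forall>x\<in>C. i \<notin> inversions (\<delta> x c0') \<longrightarrow> snd p x = c0) \<and> (\<forall>x\<in>D. snd p (\<phi> x) = fst p x)"
    by simp
  then obtain P where P: "\<forall>i\<in>I. colouring i (fst (P i)) (pan i c0) \<and> colouring i (snd (P i)) (pan i c0) \<and>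
     (\<forall>x\<in>C. i \<notin> inversions (\<delta> x c0) \<longrightarrow> fst (P i) x = c0) \<and>
     (\<forall>x\<in>C. i \<notin> inversions (\<delta> x c0') \<longrightarrow> snd (P i) x = c0) \<and> (\<forall>x\<in>D. snd (P i) (\<phi> x) = fst (P i) x)"
    by (rule bchoice[THEN exE])
  define \<chi> \<chi>' where "\<chi> i = fst (P i)" and "\<chi>' i = snd (P i)" for i
  have \<chi>: "\<And>i. i \<in> I \<Longrightarrow> colouring i (\<chi> i) (pan i c0)"
      "\<And>i. i \<in> I \<Longrightarrow> colouring i (\<chi>' i) (pan i c0)"
      "\<And>i p. i \<in> I \<Longrightarrow> p \<in> C \<Longrightarrow> i \<notin> inversions (\<delta> p c0) \<Longrightarrow> \<chi> i p = c0"
      "\<And>i p. i \<in> I \<Longrightarrow> p \<in> C \<Longrightarrow> i \<notin> inversions (\<delta> p c0') \<Longrightarrow> \<chi>' i p = c0"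
    and \<chi>\<phi>: "\<And>i x. i \<in> I \<Longrightarrow> x \<in> D \<Longrightarrow> \<chi>' i (\<phi> x) = \<chi> i x"
    unfolding \<chi>_def \<chi>'_def using P by blast+
  interpret based_colourings W I m C \<delta> c0 c0' \<chi> \<chi>' "\<lambda>i. pan i c0" "\<lambda>_. c0"
    using c0 \<chi> by unfold_locales
  obtain f where f: "bij_betw f C C" "\<And>x y. x \<in> C \<Longrightarrow> y \<in> C \<Longrightarrow> \<delta> (f x) (f y) = \<delta> x y" "f c0 = c0'"
      "\<And>i x. i \<in> I \<Longrightarrow> x \<in> C \<Longrightarrow> \<chi>' i (f x) = \<chi> i x"
    using ex_automorphism by blast
  have fC: "f x \<in> C" if "x \<in> C" for x using f(1) that bij_betwE by blast
  \<comment> \<open>Along a gallery in \<open>D\<close>, the chambers \<open>f x\<close> and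
    \<open>\<phi> x\<close> lie in the same panel and carry the same colour.\<close>
  have "f x = \<phi> x" if "x \<in> D" for x
    using that
  proof (induction "len (\<delta> x c0)" arbitrary: x rule: less_induct)
    case less
    have xC: "x \<in> C" using less.prems D by blast
    show ?case
    proof (cases "x = c0")
      case False
      then have "\<delta> x c0 \<noteq> \<one>" using xC c0 dist_one_iff by blast
      then obtain i where i: "i \<in> I" "i \<in> inversions (\<delta> x c0)"
        using ex_descent[of I "\<delta> x c0"] parabolic_I xC c0 by auto
      obtain p where p: "p \<in> C" "p \<in> pan i x" "i \<notin> inversions (\<delta> p c0)" "x \<in> pan i p"
        "len (\<delta> p c0) < len (\<delta> x c0)"
        using descent_gate[OF xC c0(1) i] by metis
      have pD: "p \<in> D" using closed i less.prems p by blast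
      have fp: "f p = \<phi> p" using less.hyps p pD by blast
      have "f x \<in> pan i (f p)" using f(2)[OF p(1) xC] p xC fC by (auto simp: panel_iff dist_one_iff)
      moreover have "\<phi> x \<in> pan i (f p)"
        using iso[OF pD less.prems] p xC fC[OF p(1)] \<phi>_in[OF less.prems] fp
        by (auto simp: panel_iff dist_one_iff)
      ultimately show ?thesis
        using colouring_inj[OF \<chi>(2)[OF i(1)] fC[OF p(1)]] f(4)[OF i(1) xC] \<chi>\<phi>[OF i(1) less.prems] by simp
    qed (use f in \<open>simp add: c0'_def\<close>)
  qed
  then show ?thesis using f by blast
qed

end

section \<open>The automorphism group\<close>

lemma bij_betw_two_pointed:
  assumes "bij_betw b A B" "b a = v" "a \<in> A" "a' \<in> A" "a' \<noteq> a" "v' \<in> B" "v' \<noteq> v"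
  shows "\<exists>f. bij_betw f A B \<and> f a = v \<and> f a' = v'"
proof -
  have "bij_betw b (A - {a}) (B - {v})" using assms(1-3) bij_betw_DiffI[of b A B "{a}" "{v}"] bij_betwE[OF assms(1)] by fastforce
  then obtain f where f: "bij_betw f (A - {a}) (B - {v})" "f a' = v'"
    using bij_betw_pointed[of b "A - {a}" "B - {v}" a' v'] assms by blast
  have "bij_betw (f(a := v)) (A - {a}) (B - {v})"
    using f(1) by (rule bij_betw_cong[THEN iffD1, rotated]) simp
  then have "bij_betw (f(a := v)) (insert a (A - {a})) (insert v (B - {v}))"
    using notIn_Un_bij_betw[of a "A - {a}" "f(a := v)" "B - {v}"] by simp
  moreover have "v \<in> B" using assms(1-3) bij_betwE by blast
  ultimately show ?thesis using f assms by (intro exI[of _ "f(a := v)"]) (simp add: insert_absorb)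
qed

context right_angled_building
begin

abbreviation "Aut \<equiv> Aut_plus C \<delta>"

lemma Aut_iff:
  "g \<in> carrier Aut \<longleftrightarrow> g \<in> extensional C \<and> bij_betw g C C \<and> (\<forall>x\<in>C. \<forall>y\<in>C. \<delta> (g x) (g y) = \<delta> x y)"
  by (auto simp: Aut_plus_def Bij_def)

lemma Aut_closed: "g \<in> carrier Aut \<Longrightarrow> x \<in> C \<Longrightarrow> g x \<in> C"
  using bij_betwE by (auto simp: Aut_iff)

lemma Aut_dist: "g \<in> carrier Aut \<Longrightarrow> x \<in> C \<Longrightarrow> y \<in> C \<Longrightarrow> \<delta> (g x) (g y) = \<delta> x y"
  by (simp add: Aut_iff)

lemma Aut_inj: "g \<in> carrier Aut \<Longrightarrow> x \<in> C \<Longrightarrow> y \<in> C \<Longrightarrow> g x = g y \<longleftrightarrow> x = y"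
  by (metis Aut_iff bij_betw_imp_inj_on inj_onD)

lemma Aut_surj: "g \<in> carrier Aut \<Longrightarrow> y \<in> C \<Longrightarrow> \<exists>x\<in>C. g x = y"
  by (metis Aut_iff bij_betw_imp_surj_on imageE)

lemma Aut_eqI:
  "g \<in> carrier Aut \<Longrightarrow> h \<in> carrier Aut \<Longrightarrow> (\<And>x. x \<in> C \<Longrightarrow> g x = h x) \<Longrightarrow> g = h"
  by (metis Aut_iff extensionalityI)

lemma restrict_in_Aut:
  assumes "bij_betw f C C" "\<And>x y. x \<in> C \<Longrightarrow> y \<in> C \<Longrightarrow> \<delta> (f x) (f y) = \<delta> x y"
  shows "restrict f C \<in> carrier Aut"
  using assms by (simp add: Aut_iff)

lemma Aut_mult: "g \<in> carrier Aut \<Longrightarrow> h \<in> carrier Aut \<Longrightarrow> x \<in> C \<Longrightarrow> (g \<otimes>\<^bsub>Aut\<^esub> h) x = g (h x)"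
  by (simp add: Aut_plus_def BijGroup_def compose_def)

lemma Aut_one: "x \<in> C \<Longrightarrow> \<one>\<^bsub>Aut\<^esub> x = x"
  by (simp add: Aut_plus_def BijGroup_def)

lemma Aut_carrier_subset: "carrier Aut \<subseteq> carrier (BijGroup C)"
  by (auto simp: Aut_plus_def BijGroup_def)

lemma group_Aut: "group Aut"
proof -
  interpret B: group "BijGroup C" by (rule group_BijGroup)
  have inv: "inv\<^bsub>BijGroup C\<^esub> g = (\<lambda>x\<in>C. (inv_into C g) x)" if "g \<in> Bij C" for g
    using inv_BijGroup that .
  have "subgroup (carrier Aut) (BijGroup C)"
  proof (rule B.subgroupI)
    show "carrier Aut \<subseteq> carrier (BijGroup C)" by (rule Aut_carrier_subset)
    have "\<one>\<^bsub>BijGroup C\<^esub> \<in> carrier Aut" by (auto simp: BijGroup_def Aut_iff bij_betw_def inj_on_def)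
    then show "carrier Aut \<noteq> {}" by blast
  next
    fix g assume g: "g \<in> carrier Aut"
    then have gb: "bij_betw g C C" "g \<in> Bij C" by (auto simp: Aut_iff Bij_def)
    have "\<delta> (inv_into C g x) (inv_into C g y) = \<delta> x y" if "x \<in> C" "y \<in> C" for x y
      using Aut_dist[OF g, of "inv_into C g x" "inv_into C g y"] gb(1) that
      by (simp add: bij_betw_def f_inv_into_f inv_into_into)
    then show "inv\<^bsub>BijGroup C\<^esub> g \<in> carrier Aut"
      unfolding inv[OF gb(2)] by (intro restrict_in_Aut bij_betw_inv_into gb(1))
  next
    fix g h assume gh: "g \<in> carrier Aut" "h \<in> carrier Aut"
    then have b: "bij_betw g C C" "bij_betw h C C" "g \<in> Bij C" "h \<in> Bij C" by (auto simp: Aut_iff Bij_def)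
    have e: "g \<otimes>\<^bsub>BijGroup C\<^esub> h = restrict (g \<circ> h) C"
      using b by (simp add: BijGroup_def compose_def comp_def)
    show "g \<otimes>\<^bsub>BijGroup C\<^esub> h \<in> carrier Aut"
      unfolding e by (rule restrict_in_Aut[OF bij_betw_trans[OF b(2,1)]]) (use gh Aut_dist Aut_closed in simp)
  qed
  then have "group (BijGroup C\<lparr>carrier := carrier Aut\<rparr>)" by (rule subgroup.subgroup_is_group) unfold_locales
  then show ?thesis by (simp add: Aut_plus_def)
qed

sublocale Aut: group Aut
  by (rule group_Aut)

lemma Aut_inv_apply: "g \<in> carrier Aut \<Longrightarrow> x \<in> C \<Longrightarrow> (inv\<^bsub>Aut\<^esub> g) (g x) = x"
  using Aut_mult[of "inv\<^bsub>Aut\<^esub> g" g x] Aut_one by simp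

lemma Aut_panel: "g \<in> carrier Aut \<Longrightarrow> x \<in> C \<Longrightarrow> y \<in> C \<Longrightarrow> g y \<in> pan i (g x) \<longleftrightarrow> y \<in> pan i x"
  using Aut_dist Aut_closed Aut_inj by (simp add: panel_iff)

lemma Aut_wing: "g \<in> carrier Aut \<Longrightarrow> x \<in> C \<Longrightarrow> c \<in> C \<Longrightarrow> g x \<in> wing i (g c) \<longleftrightarrow> x \<in> wing i c"
  using Aut_dist Aut_closed by (simp add: wing_def)

lemma Aut_wing_image:
  assumes "g \<in> carrier Aut" "c \<in> C" shows "g ` wing i c = wing i (g c)"
proof
  show "g ` wing i c \<subseteq> wing i (g c)" using Aut_wing assms wing_subset by blast
  show "wing i (g c) \<subseteq> g ` wing i c"
  proof
    fix y assume y: "y \<in> wing i (g c)"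
    then obtain x where "x \<in> C" "g x = y" using Aut_surj[OF assms(1)] wing_subset by blast
    then show "y \<in> g ` wing i c" using Aut_wing assms y by blast
  qed
qed

lemma group_action_Aut: "group_action Aut C (\<lambda>g. g)"
proof -
  have "(\<lambda>g. g) \<in> hom Aut (BijGroup C)"
    using Aut_carrier_subset by (auto simp: hom_def Aut_plus_def)
  then show ?thesis
    unfolding group_action_def group_hom_def group_hom_axioms_def
    using group_Aut group_BijGroup by blast
qed

end

section \<open>Transitivity on chambers and apartments, and gluing along wings\<close>

context semi_regular_building
begin

lemma extend_isometry_Aut:
  assumes "D \<subseteq> C" "c0 \<in> D" "\<phi> ` D \<subseteq> C"
    and "\<And>x y. x \<in> D \<Longrightarrow> y \<in> D \<Longrightarrow> \<delta> (\<phi> x) (\<phi> y) = \<delta> x y"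
    and "\<And>i x p. i \<in> I \<Longrightarrow> x \<in> D \<Longrightarrow> p \<in> pan i x \<Longrightarrow> i \<notin> inversions (\<delta> p c0) \<Longrightarrow> p \<in> D"
    and "\<And>i x. i \<in> I \<Longrightarrow> x \<in> D \<Longrightarrow> \<exists>y b. y \<in> D \<and> same_wall i x y \<and>
      bij_betw b (pan i y) (pan i (\<phi> y)) \<and>
      (\<forall>d z. d \<in> D \<longrightarrow> z \<in> pan i y \<longrightarrow> parallel i d z \<longrightarrow> parallel i (\<phi> d) (b z))"
  shows "\<exists>g\<in>carrier Aut. \<forall>x\<in>D. g x = \<phi> x"
proof -
  obtain f where f: "bij_betw f C C" "\<And>x y. x \<in> C \<Longrightarrow> y \<in> C \<Longrightarrow> \<delta> (f x) (f y) = \<delta> x y"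
    "\<And>x. x \<in> D \<Longrightarrow> f x = \<phi> x"
  proof -
    have "\<exists>f. bij_betw f C C \<and> (\<forall>x\<in>C. \<forall>y\<in>C. \<delta> (f x) (f y) = \<delta> x y) \<and> (\<forall>x\<in>D. f x = \<phi> x)"
      by (rule extend_isometry[of D c0 \<phi>]) (fact assms)+
    then show ?thesis using that by blast
  qed
  show ?thesis
    by (rule bexI[of _ "restrict f C"]) (use f assms(1) restrict_in_Aut in \<open>auto simp: restrict_apply\<close>)
qed

lemma chamber_transitive:
  assumes "x \<in> C" "y \<in> C" shows "\<exists>g\<in>carrier Aut. g x = y"
proof -
  have "\<exists>g\<in>carrier Aut. \<forall>z\<in>{x}. g z = (\<lambda>_. y) z"
  proof (rule extend_isometry_Aut)
    fix i z p assume "i \<in> I" "z \<in> {x}" "p \<in> pan i z" "i \<notin> inversions (\<delta> p x)"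
    then show "p \<in> {x}" using gate_unique[of i x x p x] assms by simp
  next
    fix i z assume i: "i \<in> I" and "z \<in> {x}"
    obtain b where b: "bij_betw b (pan i x) (pan i y)" "b x = y"
      using ex_panel_bij[OF i assms, of x y] assms by auto
    have "parallel i y (b z)" if "z \<in> pan i x" "parallel i x z" for z
      using panel_parallel_eq[OF i assms(1) _ that] b parallel_refl assms by (metis panel_self)
    then show "\<exists>w b. w \<in> {x} \<and> same_wall i z w \<and> bij_betw b (pan i w) (pan i y) \<and>
      (\<forall>d z. d \<in> {x} \<longrightarrow> z \<in> pan i w \<longrightarrow> parallel i d z \<longrightarrow> parallel i y (b z))"
      using b \<open>z \<in> {x}\<close> same_wall_refl assms by (intro exI[of _ x] exI[of _ b]) auto
  qed (use assms in auto)
  then show ?thesis by simp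
qed

text \<open>The partial isometry from one apartment to the other extends, with the apartment as
  domain.\<close>

lemma apartment_maps_conjugate:
  assumes \<beta>: "\<And>w. w \<in> carrier W \<Longrightarrow> \<beta> w \<in> C"
      "\<And>v w. v \<in> carrier W \<Longrightarrow> w \<in> carrier W \<Longrightarrow> \<delta> (\<beta> v) (\<beta> w) = inv v \<otimes> w"
    and \<beta>': "\<And>w. w \<in> carrier W \<Longrightarrow> \<beta>' w \<in> C"
      "\<And>v w. v \<in> carrier W \<Longrightarrow> w \<in> carrier W \<Longrightarrow> \<delta> (\<beta>' v) (\<beta>' w) = inv v \<otimes> w"
  shows "\<exists>g\<in>carrier Aut. \<forall>w\<in>carrier W. g (\<beta> w) = \<beta>' w"
proof -
  have inj: "v = w" if "v \<in> carrier W" "w \<in> carrier W" "\<beta> v = \<beta> w" for v w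
  proof -
    have "inv v \<otimes> w = \<one>" using \<beta>(2)[OF that(1,2)] that \<beta>(1) by simp
    then show ?thesis using that by (metis inv_closed inv_equality inv_inv)
  qed
  define \<phi> where "\<phi> x = \<beta>' (inv_into (carrier W) \<beta> x)" for x
  have \<phi>: "\<phi> (\<beta> w) = \<beta>' w" if "w \<in> carrier W" for w
    using that inj by (simp add: \<phi>_def inj_on_def)
  have adj: "\<beta> (w \<otimes> i) \<in> pan i (\<beta> w)" "\<beta> (w \<otimes> i) \<noteq> \<beta> w" "\<beta>' (w \<otimes> i) \<in> pan i (\<beta>' w)"
      "\<beta>' (w \<otimes> i) \<noteq> \<beta>' w" if "w \<in> carrier W" "i \<in> I" for w i
  proof -
    have d: "\<delta> (\<beta> w) (\<beta> (w \<otimes> i)) = i" "\<delta> (\<beta>' w) (\<beta>' (w \<otimes> i)) = i"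
      using \<beta>(2)[of w "w \<otimes> i"] \<beta>'(2)[of w "w \<otimes> i"] that by (simp_all flip: m_assoc)
    then show "\<beta> (w \<otimes> i) \<in> pan i (\<beta> w)" "\<beta>' (w \<otimes> i) \<in> pan i (\<beta>' w)"
      using \<beta>(1) \<beta>'(1) that by (simp_all add: panel_iff)
    show "\<beta> (w \<otimes> i) \<noteq> \<beta> w" "\<beta>' (w \<otimes> i) \<noteq> \<beta>' w"
      using d dist_gen_neq[OF that(2)] \<beta>(1) \<beta>'(1) that(1) by metis+
  qed
  let ?D = "\<beta> ` carrier W"
  have "\<exists>g\<in>carrier Aut. \<forall>x\<in>?D. g x = \<phi> x"
  proof (rule extend_isometry_Aut)
    show "?D \<subseteq> C" using \<beta>(1) by blast
    show "\<beta> \<one> \<in> ?D" by simp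
    show "\<phi> ` ?D \<subseteq> C" using \<phi> \<beta>'(1) by auto
    show "\<delta> (\<phi> x) (\<phi> y) = \<delta> x y" if "x \<in> ?D" "y \<in> ?D" for x y
      using that \<phi> \<beta>(2) \<beta>'(2) by auto
  next
    fix i x p assume i: "i \<in> I" and x: "x \<in> ?D" and p: "p \<in> pan i x" "i \<notin> inversions (\<delta> p (\<beta> \<one>))"
    obtain w where w: "w \<in> carrier W" "x = \<beta> w" using x by blast
    show "p \<in> ?D"
    proof (cases "p = x")
      case False
      have xC: "x \<in> C" "p \<in> C" "\<beta> \<one> \<in> C" using w \<beta>(1) p panel_in_C by auto
      have "x \<in> pan i p" using panel_sym i xC p by blast
      then have ix: "i \<in> inversions (\<delta> x (\<beta> \<one>))"
        using panel_gate(2)[OF i xC(2,3) _ _ p(2), of x] False by blast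
      have e: "\<delta> x (\<beta> \<one>) = inv w" "\<delta> (\<beta> (w \<otimes> i)) (\<beta> \<one>) = i \<otimes> inv w"
        using \<beta>(2) w i by (simp_all add: inv_mult_group)
      \<comment> \<open>If \<open>x\<close> is not the gate of the base chamber on its panel, then
        the other apartment chamber of that panel is.\<close>
      have "i \<notin> inversions (\<delta> (\<beta> (w \<otimes> i)) (\<beta> \<one>))" using ix e w i by simp
      then have "p = \<beta> (w \<otimes> i)"
        using gate_unique[OF i xC(1,3) p(1) _ p(2)] adj(1)[OF w(1) i] w(2) by blast
      then show ?thesis using w i by blast
    qed (use x in simp)
  next
    fix i x assume i: "i \<in> I" and x: "x \<in> ?D"
    obtain w where w: "w \<in> carrier W" "x = \<beta> w" using x by blast
    have C: "\<beta> w \<in> C" "\<beta>' w \<in> C" using \<beta>(1) \<beta>'(1) w by auto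
    obtain b0 where b0: "bij_betw b0 (pan i (\<beta> w)) (pan i (\<beta>' w))" "b0 (\<beta> w) = \<beta>' w"
      using ex_panel_bij[OF i C, of "\<beta> w" "\<beta>' w"] C by auto
    \<comment> \<open>An \<open>i\<close>-tree-wall meets the apartment in two parallelism classes,
      represented by \<open>\<beta> w\<close> and \<open>\<beta> (w \<otimes> i)\<close>, so a
      bijection with two prescribed values suffices.\<close>
    obtain b where b: "bij_betw b (pan i (\<beta> w)) (pan i (\<beta>' w))" "b (\<beta> w) = \<beta>' w"
        "b (\<beta> (w \<otimes> i)) = \<beta>' (w \<otimes> i)"
      using bij_betw_two_pointed[OF b0 panel_self[OF C(1)] adj(1,2)[OF w(1) i] adj(3,4)[OF w(1) i]]
      by blast
    have "parallel i (\<phi> d) (b z)" if d: "d \<in> ?D" "z \<in> pan i (\<beta> w)" "parallel i d z" for d z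
    proof -
      obtain v where v: "v \<in> carrier W" "d = \<beta> v" using d by blast
      have "same_wall i (\<beta> w) d"
        using panel_same_wall[OF i C(1) d(2)] parallel_same_wall[OF parallel_sym[OF d(3)]] same_wall_trans i
        by blast
      then have "inv w \<otimes> v \<in> parabolic (insert i (perp i))"
        using \<beta>(2)[OF w(1) v(1)] v by (simp add: same_wall_def)
      then consider "inv w \<otimes> v \<in> parabolic (perp i)" | "i \<otimes> (inv w \<otimes> v) \<in> parabolic (perp i)"
        using parabolic_insert_perp i by blast
      then obtain u where u: "u \<in> {w, w \<otimes> i}" "inv u \<otimes> v \<in> parabolic (perp i)"
      proof cases
        case 1 then show ?thesis using that by blast
      next
        case 2
        have "inv (w \<otimes> i) \<otimes> v = i \<otimes> (inv w \<otimes> v)" using w v i by (simp add: inv_mult_group m_assoc)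
        then show ?thesis using 2 that[of "w \<otimes> i"] by simp
      qed
      have uW: "u \<in> carrier W" using u w i by auto
      have up: "\<beta> u \<in> pan i (\<beta> w)" "b (\<beta> u) = \<beta>' u" using u adj w i C b by auto
      have "parallel i (\<beta> u) d" "parallel i (\<beta>' v) (\<beta>' u)"
        using u uW v \<beta> \<beta>' parallel_sym[of i "\<beta>' u" "\<beta>' v"] by (auto simp: parallel_def)
      then have "\<beta> u = z" using panel_parallel_eq[OF i C(1) up(1) d(2)] d(3) parallel_trans by blast
      then show ?thesis using up \<open>parallel i (\<beta>' v) (\<beta>' u)\<close> v \<phi> by auto
    qed
    then show "\<exists>y b. y \<in> ?D \<and> same_wall i x y \<and> bij_betw b (pan i y) (pan i (\<phi> y)) \<and>
      (\<forall>d z. d \<in> ?D \<longrightarrow> z \<in> pan i y \<longrightarrow> parallel i d z \<longrightarrow> parallel i (\<phi> d) (b z))"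
      using w x b(1) \<phi>[OF w(1)] same_wall_refl[OF C(1)] by (intro exI[of _ x] exI[of _ b]) auto
  qed
  then show ?thesis using \<phi> by simp
qed

theorem strongly_transitive_Aut: "strongly_transitive Aut (\<lambda>g. g) W C \<delta>"
  unfolding strongly_transitive_def
proof (intro conjI ballI group_action_Aut)
  fix A A' c c' assume A: "A \<in> apartments W C \<delta>" "A' \<in> apartments W C \<delta>" and c: "c \<in> A" "c' \<in> A'"
  \<comment> \<open>Left translation in \<open>W\<close> recentres the parametrisation of an
    apartment at any of its chambers.\<close>
  have *: "\<exists>\<beta>. (\<forall>w\<in>carrier W. \<beta> w \<in> C) \<and> (\<forall>v\<in>carrier W. \<forall>w\<in>carrier W. \<delta> (\<beta> v) (\<beta> w) = inv v \<otimes> w) \<and>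
      \<beta> \<one> = e \<and> \<beta> ` carrier W = B" if B: "B \<in> apartments W C \<delta>" "e \<in> B" for B e
  proof -
    obtain \<alpha> where \<alpha>: "\<alpha> \<in> carrier W \<rightarrow> C" "B = \<alpha> ` carrier W"
      "\<And>v w. v \<in> carrier W \<Longrightarrow> w \<in> carrier W \<Longrightarrow> \<delta> (\<alpha> v) (\<alpha> w) = inv v \<otimes> w"
      using B(1) by (auto simp: apartments_def)
    obtain u where u: "u \<in> carrier W" "e = \<alpha> u" using B(2) \<alpha>(2) by blast
    have "\<alpha> w \<in> (\<lambda>w. \<alpha> (u \<otimes> w)) ` carrier W" if "w \<in> carrier W" for w
      by (rule image_eqI[of _ _ "inv u \<otimes> w"]) (use u that in \<open>simp_all flip: m_assoc\<close>)
    then have "(\<lambda>w. \<alpha> (u \<otimes> w)) ` carrier W = B" using \<alpha>(2) u by auto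
    moreover have "inv (u \<otimes> v) \<otimes> (u \<otimes> w) = inv v \<otimes> w" if "v \<in> carrier W" "w \<in> carrier W" for v w
      using u that by (simp add: inv_mult_group m_assoc) (simp flip: m_assoc)
    ultimately show ?thesis using \<alpha>(1,3) u by (intro exI[of _ "\<lambda>w. \<alpha> (u \<otimes> w)"]) auto
  qed
  obtain \<beta> where \<beta>: "\<forall>w\<in>carrier W. \<beta> w \<in> C" "\<forall>v\<in>carrier W. \<forall>w\<in>carrier W. \<delta> (\<beta> v) (\<beta> w) = inv v \<otimes> w"
    "\<beta> \<one> = c" "\<beta> ` carrier W = A" using *[OF A(1) c(1)] by blast
  obtain \<beta>' where \<beta>': "\<forall>w\<in>carrier W. \<beta>' w \<in> C" "\<forall>v\<in>carrier W. \<forall>w\<in>carrier W. \<delta> (\<beta>' v) (\<beta>' w) = inv v \<otimes> w"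
    "\<beta>' \<one> = c'" "\<beta>' ` carrier W = A'" using *[OF A(2) c(2)] by blast
  obtain g where g: "g \<in> carrier Aut" "\<forall>w\<in>carrier W. g (\<beta> w) = \<beta>' w"
    using apartment_maps_conjugate[of \<beta> \<beta>'] \<beta>(1,2) \<beta>'(1,2) by blast
  have "g ` A = A'" using g(2) \<beta>(4)[symmetric] \<beta>'(4)[symmetric] by (simp add: image_image)
  moreover have "g c = c'" using g(2) \<beta>(3) \<beta>'(3) one_closed by metis
  ultimately show "\<exists>g\<in>carrier Aut. g c = c' \<and> g ` A = A'" using g(1) by blast
qed

text \<open>The identity on the wing and \<open>\<rho>\<close> on the rest of the residue fit
  together because minimal galleries between the two parts can be led through boundary chambers,
  which \<open>\<rho>\<close> fixes. It provides both the wing fixators and the corrections used for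
  simplicity.\<close>

lemma extend_residue_isometry:
  assumes J: "J \<subseteq> I" "k \<in> J" and c: "c \<in> C"
    and R: "R = {x \<in> C. \<delta> c x \<in> parabolic J}"
    and \<rho>: "bij_betw \<rho> R R" "\<And>x y. x \<in> R \<Longrightarrow> y \<in> R \<Longrightarrow> \<delta> (\<rho> x) (\<rho> y) = \<delta> x y"
    and fix_boundary: "\<And>r. r \<in> R \<Longrightarrow> parallel k c r \<Longrightarrow> \<rho> r = r"
  shows "\<exists>h\<in>carrier Aut. (\<forall>x\<in>wing k c. h x = x) \<and> (\<forall>x\<in>R - wing k c. h x = \<rho> x)"
proof -
  have kI: "k \<in> I" using J by blast
  have RC: "R \<subseteq> C" and cR: "c \<in> R" using R c by auto
  have \<rho>R: "\<rho> x \<in> R" if "x \<in> R" for x using that \<rho>(1) bij_betwE by blast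
  have panR: "pan i x \<subseteq> R" if "i \<in> J" "x \<in> R" for i x
    using that panel_residue[OF J(1) that(1)] residue_trans[OF J(1) c] panel_in_C by (auto simp: R)
  have \<rho>pan: "bij_betw \<rho> (pan i x) (pan i (\<rho> x))" if i: "i \<in> J" and x: "x \<in> R" for i x
  proof (rule bij_betw_imageI)
    show "inj_on \<rho> (pan i x)" using \<rho>(1) panR[OF i x] by (meson bij_betw_def inj_on_subset)
    have mem: "\<rho> y \<in> pan i (\<rho> x) \<longleftrightarrow> y \<in> pan i x" if "y \<in> R" for y
    proof -
      have "x \<in> C" "y \<in> C" "\<rho> x \<in> C" "\<rho> y \<in> C" using that x \<rho>R RC by auto
      then show ?thesis using \<rho>(2)[OF x that] by (auto simp: panel_def)
    qed
    show "\<rho> ` pan i x = pan i (\<rho> x)"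
    proof
      show "\<rho> ` pan i x \<subseteq> pan i (\<rho> x)" using mem panR[OF i x] by blast
      show "pan i (\<rho> x) \<subseteq> \<rho> ` pan i x"
      proof
        fix y assume y: "y \<in> pan i (\<rho> x)"
        then have "y \<in> R" using panR[OF i \<rho>R[OF x]] by blast
        then obtain z where "z \<in> R" "y = \<rho> z" using \<rho>(1) by (metis bij_betw_imp_surj_on imageE)
        then show "y \<in> \<rho> ` pan i x" using mem y by blast
      qed
    qed
  qed
  define D where "D = R \<union> wing k c"
  define \<phi> where "\<phi> x = (if x \<in> wing k c then x else \<rho> x)" for x
  have DC: "D \<subseteq> C" using RC wing_subset[of k c] by (auto simp: D_def)
  have \<phi>C: "\<phi> x \<in> C" if "x \<in> D" for x using that \<rho>R RC wing_subset[of k c] by (auto simp: D_def \<phi>_def)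
  have mixed: "\<delta> (\<rho> y) x = \<delta> y x" if y: "y \<in> R" "y \<notin> wing k c" and x: "x \<in> wing k c" for x y
  proof -
    have C: "x \<in> C" "y \<in> C" "\<rho> y \<in> C" using x y \<rho>R RC wing_subset[of k c] by auto
    obtain r where r: "parallel k c r" "\<delta> c r \<in> parabolic J" "reduced_product (\<delta> y r) (\<delta> r x)"
      using residue_wing_crossing[OF J(1) kI c x C(2) _ y(2)] y(1) R by blast
    have rC: "r \<in> C" using r parallel_in_C by blast
    have "r \<in> R" using r rC R by blast
    then have d: "\<delta> (\<rho> y) r = \<delta> y r" using \<rho>(2)[OF y(1), of r] fix_boundary r(1) by simp
    show ?thesis using dist_comp[OF C(2) rC C(1) r(3)] dist_comp[OF C(3) rC C(1)] d r(3) by simp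
  qed
  have iso: "\<delta> (\<phi> x) (\<phi> y) = \<delta> x y" if xy: "x \<in> D" "y \<in> D" for x y
  proof -
    have C: "x \<in> C" "y \<in> C" "\<phi> x \<in> C" "\<phi> y \<in> C" using that DC \<phi>C by auto
    consider "x \<in> wing k c" "y \<in> wing k c" | "x \<in> R" "x \<notin> wing k c" "y \<in> wing k c"
      | "x \<in> wing k c" "y \<in> R" "y \<notin> wing k c" | "x \<in> R" "x \<notin> wing k c" "y \<in> R" "y \<notin> wing k c"
      using xy by (auto simp: D_def)
    then show ?thesis
    proof cases
      case 3
      then have "\<delta> (\<phi> y) (\<phi> x) = \<delta> y x" using mixed by (simp add: \<phi>_def)
      then show ?thesis using dist_inv C by metis
    qed (use mixed \<rho>(2) in \<open>simp_all add: \<phi>_def\<close>)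
  qed
  have par\<phi>: "parallel i (\<phi> x) (\<phi> y) \<longleftrightarrow> parallel i x y" if "x \<in> D" "y \<in> D" for i x y
    using that iso \<phi>C DC by (auto simp: parallel_def)
  have "\<exists>g\<in>carrier Aut. \<forall>x\<in>D. g x = \<phi> x"
  proof (rule extend_isometry_Aut[OF DC])
    show "c \<in> D" using cR by (simp add: D_def)
    show "\<phi> ` D \<subseteq> C" using \<phi>C by blast
    show "\<delta> (\<phi> x) (\<phi> y) = \<delta> x y" if "x \<in> D" "y \<in> D" for x y using iso that .
  next
    fix i x p assume i: "i \<in> I" and x: "x \<in> D" and p: "p \<in> pan i x" "i \<notin> inversions (\<delta> p c)"
    show "p \<in> D"
    proof (cases "x \<in> wing k c \<or> p = x")
      case True
      then show ?thesis using wing_gate_closed[OF kI c _ i p] x by (auto simp: D_def)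
    next
      case False
      then have xR: "x \<in> R" using x by (auto simp: D_def)
      have C: "x \<in> C" "p \<in> C" using x DC p panel_in_C by auto
      have "i \<in> inversions (\<delta> x c)"
        using panel_gate(2)[OF i C(2) c panel_sym[OF i C(1) p(1)] _ p(2)] False by blast
      moreover have "\<delta> x c \<in> parabolic J" using xR residue_sym[OF J(1) c] by (simp add: R)
      ultimately have "i \<in> J" using inversions_parabolic[OF J(1)] gen_in_parabolic_iff[OF J(1) i] by blast
      then show ?thesis using panR xR p by (auto simp: D_def)
    qed
  next
    fix i x assume i: "i \<in> I" and x: "x \<in> D"
    have xC: "x \<in> C" using x DC by blast
    show "\<exists>y b. y \<in> D \<and> same_wall i x y \<and> bij_betw b (pan i y) (pan i (\<phi> y)) \<and>
      (\<forall>d z. d \<in> D \<longrightarrow> z \<in> pan i y \<longrightarrow> parallel i d z \<longrightarrow> parallel i (\<phi> d) (b z))"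
    proof (cases "\<exists>y\<in>wing k c. same_wall i x y")
      case True
      then obtain y where y: "y \<in> wing k c" "same_wall i x y" by blast
      have yD: "y \<in> D" "\<phi> y = y" using y by (auto simp: D_def \<phi>_def)
      show ?thesis
      proof (cases "pan i y \<subseteq> wing k c")
        case True
        have "parallel i (\<phi> d) z" if "d \<in> D" "z \<in> pan i y" "parallel i d z" for d z
        proof -
          have "z \<in> D" "\<phi> z = z" using that True by (auto simp: D_def \<phi>_def)
          then show ?thesis using par\<phi>[of d z] that by simp
        qed
        then show ?thesis using y yD by (intro exI[of _ y] exI[of _ id]) auto
      next
        case False
        then obtain z where z: "z \<in> pan i y" "z \<notin> wing k c" by blast
        \<comment> \<open>A panel leaving the wing is a \<open>k\<close>-panel on its boundary, so
          the tree-wall is that of \<open>c\<close>, where \<open>\<rho>\<close> itself supplies the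
          bijection.\<close>
        have b: "i = k" "parallel k c y" using wing_boundary[OF kI c i y(1) z] by auto
        have wall: "same_wall i x c"
          using y(2) parallel_same_wall[OF parallel_sym[OF b(2)]] b(1) same_wall_trans i by blast
        have \<rho>c: "\<rho> c = c" using fix_boundary[OF cR] parallel_refl c by blast
        have \<phi>c: "\<phi> c = c" using wing_self[OF c] by (simp add: \<phi>_def)
        have \<phi>\<rho>: "\<phi> z = \<rho> z" if "z \<in> pan k c" for z
          using panel_wing[OF kI c that] \<rho>c by (auto simp: \<phi>_def)
        have "parallel i (\<phi> d) (\<rho> z)" if "d \<in> D" "z \<in> pan i c" "parallel i d z" for d z
        proof -
          have "z \<in> D" using that panR[OF J(2) cR] b(1) by (auto simp: D_def)
          then show ?thesis using par\<phi>[of d z] that \<phi>\<rho> b(1) by simp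
        qed
        then show ?thesis using wall cR \<rho>pan[OF J(2) cR] \<rho>c \<phi>c b(1)
          by (intro exI[of _ c] exI[of _ \<rho>]) (auto simp: D_def)
      qed
    next
      case False
      have out: "y \<notin> wing k c" if "same_wall i x y" for y using False that by blast
      have xR: "x \<in> R" "x \<notin> wing k c" using x out[OF same_wall_refl[OF xC]] by (auto simp: D_def)
      have \<phi>x: "\<phi> x = \<rho> x" using xR by (simp add: \<phi>_def)
      show ?thesis
      proof (cases "i \<in> J")
        case True
        have "parallel i (\<phi> d) (\<rho> z)" if "d \<in> D" "z \<in> pan i x" "parallel i d z" for d z
        proof -
          have zR: "z \<in> R" using panR[OF True xR(1)] that by blast
          have "\<phi> z = \<rho> z" using out[OF panel_same_wall[OF i xC that(2)]] by (simp add: \<phi>_def)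
          then show ?thesis using par\<phi>[of d z] that zR by (simp add: D_def)
        qed
        then show ?thesis using x \<rho>pan[OF True xR(1)] \<phi>x same_wall_refl[OF xC]
          by (intro exI[of _ x] exI[of _ \<rho>]) auto
      next
        case iJ: False
        have \<phi>xC: "\<phi> x \<in> C" using \<phi>C x by blast
        obtain b where b: "bij_betw b (pan i x) (pan i (\<phi> x))" "b x = \<phi> x"
          using ex_panel_bij[OF i xC \<phi>xC, of x "\<phi> x"] xC \<phi>xC by auto
        \<comment> \<open>As \<open>i\<close> is not in \<open>J\<close>, the chambers of
          \<open>R\<close> on this tree-wall are all parallel to \<open>x\<close>; only the value at
          \<open>x\<close> is constrained.\<close>
        have "parallel i (\<phi> d) (b z)" if d: "d \<in> D" "z \<in> pan i x" "parallel i d z" for d z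
        proof -
          have wall: "same_wall i x d"
            using panel_same_wall[OF i xC d(2)] parallel_same_wall[OF parallel_sym[OF d(3)]] same_wall_trans i
            by blast
          then have dR: "d \<in> R" using out d(1) by (auto simp: D_def)
          then have "\<delta> x d \<in> parabolic J"
            using xR(1) residue_trans[OF J(1) xC c] residue_sym[OF J(1) c xC] by (simp add: R)
          then have "\<delta> x d \<in> parabolic (J \<inter> insert i (perp i))"
            using wall parabolic_Int[OF J(1) insert_perp_subset[OF i]] by (auto simp: same_wall_def)
          then have "\<delta> x d \<in> parabolic (perp i)"
            using parabolic_mono[of "J \<inter> insert i (perp i)" "perp i"] iJ by blast
          then have xd: "parallel i x d" using xC dR RC by (auto simp: parallel_def)
          then have "x = z" using panel_parallel_eq[OF i xC _ d(2)] d(3) parallel_trans xC by (metis panel_self)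
          then show ?thesis using b(2) par\<phi>[OF d(1) x] parallel_sym[OF xd] by simp
        qed
        then show ?thesis using x b(1) same_wall_refl[OF xC] by (intro exI[of _ x] exI[of _ b]) auto
      qed
    qed
  qed
  then obtain g where g: "g \<in> carrier Aut" "\<And>x. x \<in> D \<Longrightarrow> g x = \<phi> x" by blast
  show ?thesis by (rule bexI[OF _ g(1)]) (use g(2) in \<open>simp add: D_def \<phi>_def\<close>)
qed

text \<open>Gluing with \<open>J = {k}\<close>: the residue is the panel itself, and
  \<open>\<rho>\<close> transposes \<open>y\<close> and \<open>y'\<close>.\<close>

lemma wing_fixator_transitive:
  assumes k: "k \<in> I" and p: "p \<in> C" and y: "y \<in> pan k p" "y \<noteq> p" and y': "y' \<in> pan k p" "y' \<noteq> p"
  shows "\<exists>h\<in>carrier Aut. (\<forall>x\<in>wing k p. h x = x) \<and> h y = y'"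
proof -
  have "val u \<in> {\<one>, k}" if "u \<in> lists {k}" for u
    using that k by (induction u) auto
  then have "parabolic {k} \<subseteq> {\<one>, k}" unfolding parabolic_def by blast
  then have "parabolic {k} = {\<one>, k}" using parabolic_gen[of "{k}" k] k by auto
  then have R: "pan k p = {x \<in> C. \<delta> p x \<in> parabolic {k}}" by (simp add: panel_def)
  let ?\<rho> = "id(y := y', y' := y)"
  have bij: "bij_betw ?\<rho> (pan k p) (pan k p)"
    by (rule bij_betwI[of _ _ _ ?\<rho>]) (use y y' in auto)
  have iso: "\<delta> (?\<rho> a) (?\<rho> b) = \<delta> a b" if "a \<in> pan k p" "b \<in> pan k p" for a b
  proof (cases "a = b")
    case True
    then show ?thesis using that y y' panel_in_C by simp
  next
    case False
    have "?\<rho> a \<noteq> ?\<rho> b" "?\<rho> a \<in> pan k p" "?\<rho> b \<in> pan k p" using False that y y' by auto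
    then show ?thesis using panel_dist[OF k p] that False by metis
  qed
  have "?\<rho> r = r" if "r \<in> pan k p" "parallel k p r" for r
    using panel_parallel_eq[OF k p _ that] p y y' by auto
  then obtain h where "h \<in> carrier Aut" "\<forall>x\<in>wing k p. h x = x" "\<forall>x\<in>pan k p - wing k p. h x = ?\<rho> x"
    using extend_residue_isometry[of "{k}" k p "pan k p" ?\<rho>] k p R bij iso by blast
  moreover have "y \<notin> wing k p" using panel_wing[OF k p y(1)] y(2) by blast
  ultimately show ?thesis using y by auto
qed

end

section \<open>Simplicity\<close>

locale thick_semi_regular_building = semi_regular_building W I m C \<delta>
  for W :: "('w, 'b) monoid_scheme" (structure)
    and I :: "'w set" and m :: "'w \<Rightarrow> 'w \<Rightarrow> enat"
    and C :: "'c set" and \<delta> :: "'c \<Rightarrow> 'c \<Rightarrow> 'w" +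
  assumes thick: "thick W I C \<delta>"
    and finite_I: "finite I"
    and irreducible: "irreducible_type W I"
    and non_spherical: "non_spherical W"
begin

lemma ex_third:
  assumes "i \<in> I" "x \<in> C" obtains y where "y \<in> pan i x" "y \<noteq> a" "y \<noteq> b"
proof -
  have "\<not> pan i x \<subseteq> {a, b}"
  proof
    assume sub: "pan i x \<subseteq> {a, b}"
    then have "card (pan i x) \<le> card {a, b}" by (intro card_mono) auto
    also have "\<dots> \<le> 2" by (simp add: card_insert_if)
    finally have "card (pan i x) \<le> 2" .
    moreover have "finite (pan i x)" using sub finite_subset by blast
    ultimately show False using thick assms by (fastforce simp: thick_def)
  qed
  then show ?thesis using that by blast
qed

text \<open>Otherwise \<open>i\<close> splits off from the diagram, which irreducibility forbids, or
  \<open>I = {i}\<close> and \<open>W\<close> has at most two elements.\<close>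

lemma ex_noncommuting:
  assumes "i \<in> I" obtains j where "j \<in> I" "j \<noteq> i" "m i j \<noteq> 2"
proof -
  have "\<exists>j\<in>I. j \<noteq> i \<and> m i j \<noteq> 2"
  proof (rule ccontr)
    assume "\<not> ?thesis"
    then have c: "i \<otimes> j = j \<otimes> i" if "j \<in> I - {i}" for j using that gen_commute assms by blast
    show False
    proof (cases "I = {i}")
      case True
      have "val u \<in> {\<one>, i}" if "u \<in> lists {i}" for u
        using that assms by (induction u) auto
      then have "parabolic {i} \<subseteq> {\<one>, i}" unfolding parabolic_def by blast
      then have "finite (parabolic I)" using True finite_subset by blast
      then show False using parabolic_I non_spherical by (simp add: non_spherical_def)
    next
      case False
      have "{i} \<noteq> {} \<and> I - {i} \<noteq> {} \<and> {i} \<inter> (I - {i}) = {} \<and> {i} \<union> (I - {i}) = I \<and>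
          (\<forall>j\<in>{i}. \<forall>k\<in>I - {i}. j \<otimes> k = k \<otimes> j)"
        using False assms c by blast
      then show False using irreducible unfolding irreducible_type_def by blast
    qed
  qed
  then show ?thesis using that by blast
qed

end

locale normal_in_Aut = thick_semi_regular_building W I m C \<delta>
  for W :: "('w, 'b) monoid_scheme" (structure)
    and I :: "'w set" and m :: "'w \<Rightarrow> 'w \<Rightarrow> enat"
    and C :: "'c set" and \<delta> :: "'c \<Rightarrow> 'c \<Rightarrow> 'w" +
  fixes N :: "('c \<Rightarrow> 'c) set"
  assumes normal: "N \<lhd> Aut_plus C \<delta>" and nontrivial: "N \<noteq> {\<one>\<^bsub>Aut_plus C \<delta>\<^esub>}"
begin

section \<open>Orbits of a normal subgroup\<close>

lemma N_subgroup: "subgroup N Aut"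
  using normal by (rule normal_imp_subgroup)

lemma N_Aut: "n \<in> N \<Longrightarrow> n \<in> carrier Aut"
  using N_subgroup subgroup.mem_carrier by metis

lemma N_mult: "n \<in> N \<Longrightarrow> n' \<in> N \<Longrightarrow> n \<otimes>\<^bsub>Aut\<^esub> n' \<in> N"
  using N_subgroup subgroup.m_closed by metis

lemma N_inv: "n \<in> N \<Longrightarrow> inv\<^bsub>Aut\<^esub> n \<in> N"
  using N_subgroup subgroup.m_inv_closed by metis

lemma N_one: "\<one>\<^bsub>Aut\<^esub> \<in> N"
  using N_subgroup subgroup.one_closed by metis

lemma N_conj: "n \<in> N \<Longrightarrow> g \<in> carrier Aut \<Longrightarrow> g \<otimes>\<^bsub>Aut\<^esub> n \<otimes>\<^bsub>Aut\<^esub> inv\<^bsub>Aut\<^esub> g \<in> N"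
  using normal.inv_op_closed2[OF normal] by simp

definition orbit_rel :: "'c \<Rightarrow> 'c \<Rightarrow> bool" where
  "orbit_rel x y \<longleftrightarrow> x \<in> C \<and> (\<exists>n\<in>N. n x = y)"

lemma orbit_rel_C: "orbit_rel x y \<Longrightarrow> x \<in> C \<and> y \<in> C"
  using N_Aut Aut_closed by (auto simp: orbit_rel_def)

lemma orbit_rel_refl: "x \<in> C \<Longrightarrow> orbit_rel x x"
  unfolding orbit_rel_def using N_one Aut_one by blast

lemma orbit_rel_sym: assumes "orbit_rel x y" shows "orbit_rel y x"
proof -
  obtain n where n: "n \<in> N" "n x = y" "x \<in> C" using assms by (auto simp: orbit_rel_def)
  then have "(inv\<^bsub>Aut\<^esub> n) y = x" using Aut_inv_apply N_Aut by blast
  then show ?thesis using n N_inv orbit_rel_C[OF assms] by (auto simp: orbit_rel_def)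
qed

lemma orbit_rel_trans: assumes "orbit_rel x y" "orbit_rel y z" shows "orbit_rel x z"
proof -
  obtain n n' where n: "n \<in> N" "n x = y" "x \<in> C" "n' \<in> N" "n' y = z"
    using assms by (auto simp: orbit_rel_def)
  then have "(n' \<otimes>\<^bsub>Aut\<^esub> n) x = z" using Aut_mult N_Aut by blast
  then show ?thesis using n N_mult by (auto simp: orbit_rel_def)
qed

lemma orbit_rel_Aut: assumes "orbit_rel x y" "g \<in> carrier Aut" shows "orbit_rel (g x) (g y)"
proof -
  obtain n where n: "n \<in> N" "n x = y" "x \<in> C" using assms by (auto simp: orbit_rel_def)
  have "(g \<otimes>\<^bsub>Aut\<^esub> n \<otimes>\<^bsub>Aut\<^esub> inv\<^bsub>Aut\<^esub> g) (g x) = g y"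
    using n assms(2) N_Aut Aut_mult Aut_inv_apply Aut_closed by simp
  then show ?thesis using N_conj n assms(2) Aut_closed by (auto simp: orbit_rel_def)
qed

text \<open>The orbit relation is invariant under \<open>Aut\<close>, which moves any ordered pair
  of distinct chambers of an \<open>i\<close>-panel to any other: first the chamber, then its
  neighbour by a wing fixator.\<close>

lemma orbit_rel_panel:
  assumes i: "i \<in> I" and xy: "x \<in> C" "y \<in> pan i x" "y \<noteq> x" "orbit_rel x y"
    and ab: "a \<in> C" "b \<in> pan i a"
  shows "orbit_rel a b"
proof (cases "b = a")
  case False
  obtain h where h: "h \<in> carrier Aut" "h x = a" using chamber_transitive xy ab by blast
  have yC: "y \<in> C" using xy panel_in_C by blast
  have "h y \<in> pan i a" "h y \<noteq> a" using Aut_panel[OF h(1) xy(1) yC] Aut_inj[OF h(1) xy(1) yC] h xy by auto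
  then obtain h' where h': "h' \<in> carrier Aut" "\<forall>x\<in>wing i a. h' x = x" "h' (h y) = b"
    using wing_fixator_transitive[OF i ab(1) _ _ ab(2) False] by blast
  have "orbit_rel (h' (h x)) (h' (h y))" using orbit_rel_Aut xy(4) h h' by blast
  then show ?thesis using h h' wing_self[OF ab(1), of i] by simp
qed (use orbit_rel_refl ab in simp)

text \<open>An automorphism fixing the wing of the gate \<open>p\<close>, hence \<open>x\<close>,
  moves \<open>y\<close> to a third chamber \<open>y'\<close> of the panel. Then \<open>x\<close> is
  related to both, so two distinct \<open>i\<close>-adjacent chambers are related.\<close>

lemma orbit_rel_descent:
  assumes i: "i \<in> I" and xy: "orbit_rel x y" "i \<in> inversions (\<delta> y x)"
    and ab: "a \<in> C" "b \<in> pan i a"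
  shows "orbit_rel a b"
proof -
  have C: "x \<in> C" "y \<in> C" using orbit_rel_C xy by auto
  obtain p where p: "p \<in> C" "p \<in> pan i y" "p \<noteq> y" "i \<notin> inversions (\<delta> p x)" "y \<in> pan i p"
    using descent_gate[OF C(2,1) i xy(2)] by metis
  obtain y' where y': "y' \<in> pan i p" "y' \<noteq> p" "y' \<noteq> y" using ex_third[OF i p(1)] by blast
  obtain h where h: "h \<in> carrier Aut" "\<forall>x\<in>wing i p. h x = x" "h y = y'"
    using wing_fixator_transitive[OF i p(1,5) p(3)[symmetric] y'(1,2)] by blast
  have "h x = x" using h(2) p(4) C by (simp add: wing_def)
  then have "orbit_rel x y'" using orbit_rel_Aut[OF xy(1) h(1)] h(3) by simp
  then have "orbit_rel y y'" using xy orbit_rel_sym orbit_rel_trans by blast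
  moreover have "y' \<in> pan i y" using y' panel_eq[OF i p(1,5)] by blast
  ultimately show ?thesis using orbit_rel_panel[OF i C(2) _ y'(3) _ ab] by blast
qed

text \<open>A chamber moved by an element of \<open>N\<close> puts some type in \<open>K\<close>,
  and \<open>K\<close> absorbs every type not commuting with one of its members; irreducibility
  gives \<open>K = I\<close>.\<close>

lemma orbit_rel_all: assumes "x \<in> C" "y \<in> C" shows "orbit_rel x y"
proof -
  define K where "K = {i \<in> I. \<forall>a b. a \<in> C \<longrightarrow> b \<in> pan i a \<longrightarrow> orbit_rel a b}"
  have "K \<noteq> {}"
  proof -
    obtain n where n: "n \<in> N" "n \<noteq> \<one>\<^bsub>Aut\<^esub>" using nontrivial N_one by blast
    then obtain z where z: "z \<in> C" "n z \<noteq> z" using Aut_eqI[OF N_Aut Aut.one_closed] Aut_one by metis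
    have nz: "n z \<in> C" using Aut_closed N_Aut n z by blast
    then have "\<delta> (n z) z \<noteq> \<one>" using z dist_one_iff by blast
    then obtain i where i: "i \<in> I" "i \<in> inversions (\<delta> (n z) z)"
      using ex_descent[of I "\<delta> (n z) z"] parabolic_I z nz by auto
    have "orbit_rel z (n z)" using n z by (auto simp: orbit_rel_def)
    then have "i \<in> K" using orbit_rel_descent[OF i(1) _ i(2)] i(1) unfolding K_def by blast
    then show ?thesis by blast
  qed
  moreover have "j \<in> K" if i: "i \<in> K" and j: "j \<in> I" "j \<noteq> i" "m i j \<noteq> 2" for i j
  proof -
    have iI: "i \<in> I" using i by (simp add: K_def)
    obtain x1 where x1: "x1 \<in> C" using chambers_nonempty by blast
    obtain x0 where x0: "x0 \<in> pan j x1" "x0 \<noteq> x1" using ex_third[OF j(1) x1] by blast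
    obtain x2 where x2: "x2 \<in> pan i x1" "x2 \<noteq> x1" using ex_third[OF iI x1] by blast
    have C: "x0 \<in> C" "x2 \<in> C" using x0 x2 panel_in_C by blast+
    \<comment> \<open>The chambers \<open>x0\<close>, \<open>x1\<close>, \<open>x2\<close>,
      \<open>n x0\<close> form a gallery of type \<open>j i j\<close>. It is reduced as
      \<open>i\<close> and \<open>j\<close> do not commute, so \<open>j\<close> is a descent from
      \<open>n x0\<close> to \<open>x0\<close>.\<close>
    obtain n where n: "n \<in> N" "n x1 = x2" using i x1 x2 by (auto simp: K_def orbit_rel_def)
    have nC: "n x0 \<in> C" using n N_Aut Aut_closed C by blast
    have np: "n x0 \<in> pan j x2" "n x0 \<noteq> x2"
      using Aut_panel[OF N_Aut[OF n(1)] x1 C(1)] Aut_inj[OF N_Aut[OF n(1)] C(1) x1] x0 n by auto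
    have "\<delta> x1 x0 = j" using x0 x1 panel_iff by blast
    then have "inversions (\<delta> x1 x0) = {j}" using inversions_gen[OF j(1)] by simp
    then have "i \<notin> inversions (\<delta> x1 x0)" using j(2) by simp
    then have "i \<in> inversions (\<delta> x2 x0)" using panel_gate(2)[OF iI x1 C(1) x2] by blast
    then have "j \<notin> inversions (\<delta> x2 x0)" using two_descents[OF iI j(1) j(2)[symmetric], of "\<delta> x2 x0"] j(3) C by auto
    then have "j \<in> inversions (\<delta> (n x0) x0)" using panel_gate(2)[OF j(1) C(2,1) np] by blast
    moreover have "orbit_rel x0 (n x0)" using n C by (auto simp: orbit_rel_def)
    ultimately show ?thesis using orbit_rel_descent[OF j(1)] j(1) unfolding K_def by blast
  qed
  moreover have KI: "K \<subseteq> I" by (auto simp: K_def)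
  ultimately have "i \<otimes> j = j \<otimes> i" if "i \<in> K" "j \<in> I - K" for i j
    using gen_commute[of i j] that by blast
  then have "K \<noteq> {} \<and> K \<inter> (I - K) = {} \<and> K \<union> (I - K) = I \<and> (\<forall>j\<in>K. \<forall>k\<in>I - K. j \<otimes> k = k \<otimes> j)"
    using \<open>K \<noteq> {}\<close> KI by blast
  then have "I - K = {}" using irreducible unfolding irreducible_type_def by meson
  then have "K = I" using KI by blast
  then have K: "orbit_rel a b" if "i \<in> I" "a \<in> C" "b \<in> pan i a" for i a b using that by (auto simp: K_def)
  show ?thesis
    using assms(1)
  proof (induction "len (\<delta> x y)" arbitrary: x rule: less_induct)
    case less
    show ?case
    proof (cases "x = y")
      case False
      then have "\<delta> x y \<noteq> \<one>" using less.prems assms(2) dist_one_iff by blast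
      then obtain i where i: "i \<in> I" "i \<in> inversions (\<delta> x y)"
        using ex_descent[of I "\<delta> x y"] parabolic_I less.prems assms(2) by auto
      obtain p where p: "p \<in> C" "p \<in> pan i x" "len (\<delta> p y) < len (\<delta> x y)"
        using descent_gate[OF less.prems assms(2) i] by metis
      then show ?thesis using less.hyps[OF p(3,1)] K[OF i(1) less.prems p(2)] orbit_rel_trans by blast
    qed (use orbit_rel_refl assms in simp)
  qed
qed

text \<open>Tits' commutator trick: the translates of a wing under a suitable \<open>g \<in> N\<close> are pairwise
  disjoint, so the product \<open>u\<close> of all \<open>g\<^sup>n v g\<^sup>-\<^sup>n\<close>, \<open>n \<ge> 0\<close>, makes sense, and \<open>v = [u, g]\<close>.\<close>

lemma wing_supported_in_N:
  assumes v: "v \<in> carrier Aut" and j: "j \<in> I" and c: "c \<in> C"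
    and fixed: "\<And>x. x \<in> C \<Longrightarrow> x \<notin> wing j c \<Longrightarrow> v x = x"
  shows "v \<in> N"
proof -
  obtain i where i: "i \<in> I" "i \<noteq> j" "m j i \<noteq> 2" using ex_noncommuting[OF j] by blast
  obtain a where a: "a \<in> pan j c" "a \<noteq> c" using ex_third[OF j c] by blast
  obtain b where b: "b \<in> pan j c" "b \<noteq> c" "b \<noteq> a" using ex_third[OF j c] by blast
  have aC: "a \<in> C" and bC: "b \<in> C" using a b panel_in_C by blast+
  \<comment> \<open>Taking \<open>b\<close> to \<open>a'\<close> makes \<open>g\<close> map the
    wings of all other chambers of the panel into the wing of \<open>a\<close>: from there, the way
    back to \<open>a\<close> has type \<open>j i\<close>, with \<open>j\<close> and \<open>i\<close>
    not commuting.\<close>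
  obtain a' where a': "a' \<in> pan i a" "a' \<noteq> a" using ex_third[OF i(1) aC] by blast
  have a'C: "a' \<in> C" using a' panel_in_C by blast
  obtain g where gN: "g \<in> N" and gb: "g b = a'" using orbit_rel_all[OF bC a'C] by (auto simp: orbit_rel_def)
  have g: "g \<in> carrier Aut" using gN N_Aut by blast
  have into: "g ` wing j y \<subseteq> wing j a" if y: "y \<in> pan j c" "y \<noteq> b" for y
  proof
    fix z assume "z \<in> g ` wing j y"
    have yC: "y \<in> C" "g y \<in> C" using y panel_in_C Aut_closed g by blast+
    have z: "z \<in> wing j (g y)" using \<open>z \<in> _\<close> Aut_wing_image[OF g yC(1)] by blast
    then have zC: "z \<in> C" using wing_subset by blast
    have "y \<in> pan j b" using panel_eq[OF j c b(1)] y by blast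
    then have gy: "g y \<in> pan j a'" "g y \<noteq> a'"
      using Aut_panel[OF g bC yC(1)] Aut_inj[OF g yC(1) bC] gb y by auto
    have "a' \<in> pan j (g y)" using panel_sym[OF j a'C gy(1)] .
    then have "j \<in> inversions (\<delta> a' z)"
      using panel_gate(2)[OF j yC(2) zC] gy(2) z by (auto simp: wing_def)
    then have "i \<notin> inversions (\<delta> a' z)" using two_descents[OF j i(1) i(2)[symmetric], of "\<delta> a' z"] i(3) a'C zC by auto
    then have "i \<in> inversions (\<delta> a z)"
      using panel_gate(2)[OF i(1) a'C zC panel_sym[OF i(1) aC a'(1)]] a'(2) by blast
    then have "j \<notin> inversions (\<delta> a z)" using two_descents[OF j i(1) i(2)[symmetric], of "\<delta> a z"] i(3) aC zC by auto
    then show "z \<in> wing j a" using zC by (simp add: wing_def)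
  qed
  \<comment> \<open>The first translate lies in the wing of \<open>a\<close>, and \<open>g\<close>
    maps that wing into itself, since neither \<open>c\<close> nor \<open>a\<close> is
    \<open>b\<close>. The wing of \<open>c\<close> is disjoint from the wing of \<open>a\<close>, so
    by injectivity all translates are disjoint.\<close>
  define T where "T n = ((`) g ^^ n) (wing j c)" for n
  have T0: "T 0 = wing j c" and TSuc: "T (Suc n) = g ` T n" for n by (simp_all add: T_def)
  have Twing: "\<exists>d\<in>C. T n = wing j d" for n
  proof (induction n)
    case 0 then show ?case using T0 c by blast
  next
    case (Suc n)
    then obtain d where "d \<in> C" "T n = wing j d" by blast
    then show ?case using Aut_wing_image[OF g] Aut_closed[OF g] TSuc by metis
  qed
  have TC: "T n \<subseteq> C" for n using Twing wing_subset by metis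
  have Tin: "T (Suc n) \<subseteq> wing j a" for n
  proof (induction n)
    case 0 then show ?case using into[of c] c b TSuc T0 by simp
  next
    case (Suc n)
    then have "T (Suc (Suc n)) \<subseteq> g ` wing j a" using TSuc by blast
    then show ?case using into[OF a(1)] b(3) by blast
  qed
  have disj_wing: "wing j c \<inter> wing j a = {}"
    using wing_in_panel[OF _ c j] a panel_self[OF c] wing_subset by blast
  have disj: "n = k" if x: "x \<in> T n" "x \<in> T k" for n k x
  proof -
    have lt: False if "n < k" "x \<in> T n" "x \<in> T k" for n k x
      using that
    proof (induction n arbitrary: k x)
      case 0
      then obtain k' where "k = Suc k'" by (cases k) auto
      then show ?case using 0 Tin disj_wing T0 by blast
    next
      case (Suc n)
      then obtain k' where k': "k = Suc k'" by (cases k) auto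
      obtain y z where "y \<in> T n" "z \<in> T k'" "x = g y" "x = g z" using Suc k' TSuc by blast
      then have "y \<in> T n" "y \<in> T k'" using Aut_inj[OF g] TC by (metis subsetD)+
      then show ?case using Suc.IH Suc.prems k' by blast
    qed
    show ?thesis using lt x by (metis linorder_neqE_nat)
  qed
  \<comment> \<open>The conjugate of \<open>v\<close> by the \<open>n\<close>-th power of
    \<open>g\<close>, supported in \<open>T n\<close>.\<close>
  define w where "w n = ((\<lambda>h. g \<otimes>\<^bsub>Aut\<^esub> h \<otimes>\<^bsub>Aut\<^esub> inv\<^bsub>Aut\<^esub> g) ^^ n) v" for n
  have w0: "w 0 = v" and wSuc: "w (Suc n) = g \<otimes>\<^bsub>Aut\<^esub> w n \<otimes>\<^bsub>Aut\<^esub> inv\<^bsub>Aut\<^esub> g" for n by (simp_all add: w_def)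
  have wA: "w n \<in> carrier Aut" for n
    by (induction n) (use w0 wSuc v g in simp_all)
  have w_g: "w (Suc n) (g x) = g (w n x)" if "x \<in> C" for n x
    using that wA[of n] g Aut_mult Aut_inv_apply Aut_closed by (simp add: wSuc)
  have w_fix: "w n x = x" if "x \<in> C" "x \<notin> T n" for n x
    using that
  proof (induction n arbitrary: x)
    case 0 then show ?case using fixed w0 T0 by simp
  next
    case (Suc n)
    obtain y where y: "y \<in> C" "g y = x" using Aut_surj[OF g] Suc by blast
    then have "y \<notin> T n" using Suc TSuc by blast
    then show ?case using w_g[OF y(1)] Suc.IH y by metis
  qed
  have w_in: "w n x \<in> T n \<longleftrightarrow> x \<in> T n" if x: "x \<in> C" for n x
  proof -
    have "w n (w n x) = w n x" if "w n x \<notin> T n" using w_fix Aut_closed wA x that by blast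
    then have "w n x = x" if "w n x \<notin> T n" using Aut_inj[OF wA] Aut_closed[OF wA] x that by metis
    then show ?thesis using w_fix x by metis
  qed
  define u where "u x = (if \<exists>n. x \<in> T n then w (THE n. x \<in> T n) x else x)" for x
  have u_in: "u x = w n x" if "x \<in> T n" for x n
  proof -
    have "(THE n. x \<in> T n) = n" using that disj by blast
    then show ?thesis using that by (auto simp: u_def)
  qed
  have u_out: "u x = x" if "\<And>n. x \<notin> T n" for x using that by (simp add: u_def)
  have u_T: "u x \<in> T n \<longleftrightarrow> x \<in> T n" if x: "x \<in> C" for x n
  proof (cases "\<exists>k. x \<in> T k")
    case True
    then obtain k where k: "x \<in> T k" by blast
    then have "u x \<in> T k" using u_in w_in x by metis
    then show ?thesis using k disj by blast
  qed (use u_out in auto)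
  have uC: "u x \<in> C" if "x \<in> C" for x using u_in u_out wA Aut_closed that by metis
  have "inj_on u C"
  proof
    fix x y assume xy: "x \<in> C" "y \<in> C" "u x = u y"
    show "x = y"
    proof (cases "\<exists>n. x \<in> T n")
      case True
      then obtain n where n: "x \<in> T n" by blast
      then have "y \<in> T n" using u_T xy by metis
      then show ?thesis using u_in n xy Aut_inj[OF wA] by metis
    next
      case False
      then have "\<And>n. y \<notin> T n" using u_T xy by metis
      then show ?thesis using False u_out xy by metis
    qed
  qed
  moreover have "u ` C = C"
  proof
    show "C \<subseteq> u ` C"
    proof
      fix y assume y: "y \<in> C"
      show "y \<in> u ` C"
      proof (cases "\<exists>n. y \<in> T n")
        case True
        then obtain n where n: "y \<in> T n" by blast
        obtain x where x: "x \<in> C" "w n x = y" using Aut_surj[OF wA y] by blast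
        then have "x \<in> T n" using w_in n by blast
        then have "y = u x" using u_in x(2) by simp
        then show ?thesis using x(1) by blast
      qed (use u_out y in force)
    qed
  qed (use uC in blast)
  ultimately have u_bij: "bij_betw u C C" by (simp add: bij_betw_def)
  \<comment> \<open>Needed for \<open>u\<close> to respect adjacency across the edge of a translate:
    \<open>w n\<close> fixes the outer neighbour, hence preserves the panel, and it preserves the
    wing, which meets the panel in one chamber.\<close>
  have boundary: "w n x = x" if xy: "x \<in> T n" "k \<in> I" "y \<in> pan k x" "y \<notin> T n" for n x y k
  proof -
    obtain d where d: "d \<in> C" "T n = wing j d" using Twing by blast
    have kj: "k = j" and par: "parallel j d x"
      using wing_boundary[OF j d(1) xy(2) _ xy(3)] xy d by auto
    have C: "x \<in> C" "y \<in> C" using xy TC panel_in_C by blast+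
    have "w n y = y" using w_fix C xy by blast
    then have "w n x \<in> pan j y" using Aut_panel[OF wA C(2,1)] panel_sym[OF j C(1)] xy(3) kj by metis
    then have "w n x \<in> pan j x" using panel_eq[OF j C(1)] xy(3) kj by blast
    moreover have "w n x \<in> wing j x" using w_in[OF C(1)] xy(1) d wing_parallel[OF j par] by blast
    ultimately show ?thesis using panel_wing[OF j C(1)] by blast
  qed
  have u_adj: "u y \<in> pan k (u x)" if xy: "k \<in> I" "x \<in> C" "y \<in> pan k x" for k x y
  proof -
    have yC: "y \<in> C" using xy panel_in_C by blast
    have one: "u p = p" if "p \<in> C" "q \<in> pan k p" "\<not> (\<exists>n. p \<in> T n \<and> q \<in> T n)" for p q
    proof (cases "\<exists>n. p \<in> T n")
      case True
      then obtain n where "p \<in> T n" by blast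
      then show ?thesis using boundary[of p n k q] u_in[of p n] xy(1) that by metis
    qed (use u_out in blast)
    show ?thesis
    proof (cases "\<exists>n. x \<in> T n \<and> y \<in> T n")
      case True
      then obtain n where "x \<in> T n" "y \<in> T n" by blast
      then show ?thesis using u_in Aut_panel[OF wA xy(2) yC] xy(3) by metis
    next
      case False
      then have "u x = x" "u y = y" using one[OF xy(2,3)] one[OF yC panel_sym[OF xy]] by blast+
      then show ?thesis using xy by simp
    qed
  qed
  have u_iso: "\<delta> (u x) (u y) = \<delta> x y" if "x \<in> C" "y \<in> C" for x y
    using isometry_if_adjacency_preserving[of u x y] u_bij u_adj that by (simp add: bij_betw_def)
  define h where "h = restrict u C"
  have h: "h \<in> carrier Aut" unfolding h_def using restrict_in_Aut u_bij u_iso by blast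
  have hu: "h x = u x" if "x \<in> C" for x using that by (simp add: h_def)
  \<comment> \<open>Conjugating \<open>u\<close> by \<open>g\<close> shifts the index by one and so
    removes exactly the factor \<open>v\<close> with index 0.\<close>
  have "v \<otimes>\<^bsub>Aut\<^esub> (g \<otimes>\<^bsub>Aut\<^esub> h) = h \<otimes>\<^bsub>Aut\<^esub> g"
  proof (rule Aut_eqI)
    fix x assume x: "x \<in> C"
    have gx: "g x \<in> C" using Aut_closed g x by blast
    have Tg: "g x \<in> T (Suc n) \<longleftrightarrow> x \<in> T n" for n
      unfolding TSuc by (rule inj_on_image_mem_iff[OF inj_onI x TC]) (use Aut_inj[OF g] in blast)
    have "v (g (u x)) = u (g x)"
    proof (cases "\<exists>n. x \<in> T n")
      case True
      then obtain n where n: "x \<in> T n" by blast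
      then have "u (g x) = g (u x)" using u_in Tg w_g[OF x] by metis
      moreover have "g (u x) \<in> T (Suc n)" using u_T[OF x] n TSuc by blast
      then have "g (u x) \<notin> T 0" using disj by blast
      then have "v (g (u x)) = g (u x)" using fixed T0 Aut_closed[OF g uC[OF x]] by metis
      ultimately show ?thesis by simp
    next
      case False
      then have ux: "u x = x" using u_out by blast
      show ?thesis
      proof (cases "g x \<in> T 0")
        case True then show ?thesis using u_in w0 ux by metis
      next
        case gx0: False
        have "g x \<notin> T n" for n using False Tg gx0 by (cases n) auto
        then show ?thesis using u_out ux fixed gx gx0 T0 by metis
      qed
    qed
    then show "(v \<otimes>\<^bsub>Aut\<^esub> (g \<otimes>\<^bsub>Aut\<^esub> h)) x = (h \<otimes>\<^bsub>Aut\<^esub> g) x"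
      using x gx v g h hu uC by (simp add: Aut_mult)
  qed (use v g h in simp_all)
  then have "v = h \<otimes>\<^bsub>Aut\<^esub> g \<otimes>\<^bsub>Aut\<^esub> inv\<^bsub>Aut\<^esub> (g \<otimes>\<^bsub>Aut\<^esub> h)"
    using Aut.inv_solve_right[of v "h \<otimes>\<^bsub>Aut\<^esub> g" "g \<otimes>\<^bsub>Aut\<^esub> h"] v g h by simp
  then have "v = (h \<otimes>\<^bsub>Aut\<^esub> g \<otimes>\<^bsub>Aut\<^esub> inv\<^bsub>Aut\<^esub> h) \<otimes>\<^bsub>Aut\<^esub> inv\<^bsub>Aut\<^esub> g"
    using v g h by (simp add: Aut.m_assoc Aut.inv_mult_group)
  then show ?thesis using N_mult N_conj N_inv gN h by metis
qed

text \<open>For \<open>j\<close> not commuting with \<open>i\<close> no distance has both as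
  descents, so every chamber outside the \<open>j\<close>-wing lies in the \<open>i\<close>-wing;
  \<open>v\<close> is therefore supported in the \<open>j\<close>-wing.\<close>

lemma wing_fixator_in_N:
  assumes v: "v \<in> carrier Aut" and i: "i \<in> I" and c: "c \<in> C"
    and fixed: "\<And>x. x \<in> wing i c \<Longrightarrow> v x = x"
  shows "v \<in> N"
proof -
  obtain j where j: "j \<in> I" "j \<noteq> i" "m i j \<noteq> 2" using ex_noncommuting[OF i] by blast
  have "x \<in> wing i c" if "x \<in> C" "x \<notin> wing j c" for x
    using that two_descents[OF i j(1) j(2)[symmetric], of "\<delta> c x"] j(3) c by (auto simp: wing_def)
  then show ?thesis using wing_supported_in_N[OF v j(1) c] fixed by blast
qed

text \<open>Let \<open>R\<close> be the residue of the enlarged type. First \<open>h\<close> copies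
  \<open>g\<close> on \<open>R\<close> outside the wing of \<open>c\<close>, leaving
  \<open>g' = inv h g\<close> trivial there. Then \<open>h'\<close>, built at another chamber
  \<open>d\<close> of the \<open>k\<close>-panel, agrees with \<open>g'\<close> on all of
  \<open>R\<close>. Both corrections fix a wing, so they lie in \<open>N\<close>.\<close>

lemma residue_fixator_step:
  assumes J: "J \<subseteq> I" "k \<in> I" "k \<notin> J" and c: "c \<in> C" and g: "g \<in> carrier Aut"
    and fixed: "\<And>x. x \<in> C \<Longrightarrow> \<delta> c x \<in> parabolic J \<Longrightarrow> g x = x"
    and IH: "\<And>g. g \<in> carrier Aut \<Longrightarrow>
      (\<And>x. x \<in> C \<Longrightarrow> \<delta> c x \<in> parabolic (insert k J) \<Longrightarrow> g x = x) \<Longrightarrow> g \<in> N"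
  shows "g \<in> N"
proof -
  let ?K = "insert k J"
  have K: "?K \<subseteq> I" "k \<in> ?K" using J by auto
  define R where "R = {x \<in> C. \<delta> c x \<in> parabolic ?K}"
  have cR: "c \<in> R" using c by (simp add: R_def)
  have gc: "g c = c" using fixed c by simp
  have R_of: "R = {x \<in> C. \<delta> d x \<in> parabolic ?K}" if "d \<in> R" for d
  proof -
    have "d \<in> C" "\<delta> c d \<in> parabolic ?K" using that by (auto simp: R_def)
    then show ?thesis
      using residue_trans[OF K(1)] residue_sym[OF K(1)] c unfolding R_def by blast
  qed
  have bijR: "bij_betw f R R" if f: "f \<in> carrier Aut" "f c = c" for f
  proof -
    have mem: "f x \<in> R \<longleftrightarrow> x \<in> R" if "x \<in> C" for x
      using Aut_dist[OF f(1) c that] Aut_closed[OF f(1)] that f(2) by (simp add: R_def)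
    have "R \<subseteq> C" by (auto simp: R_def)
    moreover have "inj_on f R" using Aut_inj[OF f(1)] \<open>R \<subseteq> C\<close> by (meson inj_onI subsetD)
    moreover have "f ` R = R" using mem Aut_surj[OF f(1)] \<open>R \<subseteq> C\<close> by blast
    ultimately show ?thesis by (simp add: bij_betw_def)
  qed
  have isoR: "\<delta> (f x) (f y) = \<delta> x y" if "f \<in> carrier Aut" "x \<in> R" "y \<in> R" for f x y
    using Aut_dist that by (simp add: R_def)
  \<comment> \<open>The boundary of the wing inside \<open>R\<close> has distances from
    \<open>c\<close> in \<open>parabolic J\<close>, because \<open>k\<close> is not in
    \<open>perp k\<close>; so the hypothesis on \<open>g\<close> is exactly what gluing
    requires.\<close>
  have "g r = r" if r: "r \<in> R" "parallel k c r" for r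
  proof -
    have "\<delta> c r \<in> parabolic (?K \<inter> perp k)"
      using r parabolic_Int[OF K(1) perp_subset] by (auto simp: R_def parallel_def)
    moreover have "?K \<inter> perp k \<subseteq> J" by (auto simp: perp_def)
    ultimately have "\<delta> c r \<in> parabolic J" using parabolic_mono by blast
    then show ?thesis using fixed r(1) by (simp add: R_def)
  qed
  then obtain h where h: "h \<in> carrier Aut" "\<forall>x\<in>wing k c. h x = x" "\<forall>x\<in>R - wing k c. h x = g x"
    using extend_residue_isometry[OF K c R_def bijR[OF g gc] isoR[OF g]] by blast
  define g' where "g' = inv\<^bsub>Aut\<^esub> h \<otimes>\<^bsub>Aut\<^esub> g"
  have g': "g' \<in> carrier Aut" using g h by (simp add: g'_def)
  have g'_fix: "g' x = x" if "x \<in> R" "x \<notin> wing k c" for x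
  proof -
    have "x \<in> C" using that by (simp add: R_def)
    then have "g' x = (inv\<^bsub>Aut\<^esub> h) (h x)" using g h that by (simp add: g'_def Aut_mult)
    then show ?thesis using Aut_inv_apply h(1) \<open>x \<in> C\<close> by simp
  qed
  have "h c = c" using h(2) wing_self[OF c] by blast
  then have g'c: "g' c = c" using g h(1) gc c Aut_inv_apply[OF h(1) c] by (simp add: g'_def Aut_mult)
  \<comment> \<open>The wings of \<open>d\<close> and \<open>c\<close> are disjoint, so
    \<open>g'\<close> is already trivial on the part of \<open>R\<close> in the wing of
    \<open>d\<close>, in agreement with \<open>h'\<close>.\<close>
  obtain d where d: "d \<in> pan k c" "d \<noteq> c" using ex_third[OF J(2) c] by blast
  have dC: "d \<in> C" using d panel_in_C by blast
  have dR: "d \<in> R" using panel_residue[OF K(1,2) c d(1)] dC by (simp add: R_def)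
  have disj: "x \<notin> wing k c" if "x \<in> wing k d" for x
    using wing_in_panel[OF _ c J(2), of x] d panel_self[OF c] that wing_subset by blast
  have "g' r = r" if r: "r \<in> R" "parallel k d r" for r
  proof -
    have "r \<in> wing k d" using wing_parallel[OF J(2) r(2)] wing_self r(1) by (simp add: R_def)
    then show ?thesis using disj g'_fix r by blast
  qed
  then obtain h' where h': "h' \<in> carrier Aut" "\<forall>x\<in>wing k d. h' x = x" "\<forall>x\<in>R - wing k d. h' x = g' x"
    using extend_residue_isometry[OF K dC R_of[OF dR] bijR[OF g' g'c] isoR[OF g']] by blast
  have h'g': "h' x = g' x" if "x \<in> R" for x
    using that h' g'_fix disj by (cases "x \<in> wing k d") auto
  have "inv\<^bsub>Aut\<^esub> h' \<otimes>\<^bsub>Aut\<^esub> g' \<in> N"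
  proof (rule IH)
    fix x assume "x \<in> C" "\<delta> c x \<in> parabolic ?K"
    then have "(inv\<^bsub>Aut\<^esub> h' \<otimes>\<^bsub>Aut\<^esub> g') x = (inv\<^bsub>Aut\<^esub> h') (h' x)"
      using h'g'[of x] h' g' by (simp add: R_def Aut_mult)
    then show "(inv\<^bsub>Aut\<^esub> h' \<otimes>\<^bsub>Aut\<^esub> g') x = x" using Aut_inv_apply h'(1) \<open>x \<in> C\<close> by simp
  qed (use h' g' in simp)
  moreover have "h \<in> N" using wing_fixator_in_N[OF h(1) J(2) c] h(2) by blast
  moreover have "h' \<in> N" using wing_fixator_in_N[OF h'(1) J(2) dC] h'(2) by blast
  ultimately have "h \<otimes>\<^bsub>Aut\<^esub> (h' \<otimes>\<^bsub>Aut\<^esub> (inv\<^bsub>Aut\<^esub> h' \<otimes>\<^bsub>Aut\<^esub> g')) \<in> N" using N_mult by blast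
  moreover have "h' \<otimes>\<^bsub>Aut\<^esub> (inv\<^bsub>Aut\<^esub> h' \<otimes>\<^bsub>Aut\<^esub> g') = g'" "h \<otimes>\<^bsub>Aut\<^esub> g' = g"
    using h(1) h'(1) g g' by (simp_all add: g'_def flip: Aut.m_assoc)
  ultimately show ?thesis by simp
qed

text \<open>Induction on the set \<open>S\<close> of types not yet fixed. For \<open>S = {}\<close>
  only the identity remains; \<open>S = I\<close> is the case of a chamber stabiliser.\<close>

lemma residue_fixator_in_N:
  assumes "S \<subseteq> I" "c \<in> C" "g \<in> carrier Aut"
    "\<And>x. x \<in> C \<Longrightarrow> \<delta> c x \<in> parabolic (I - S) \<Longrightarrow> g x = x"
  shows "g \<in> N"
proof -
  have "finite S" using assms(1) finite_I finite_subset by blast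
  then show ?thesis using assms
  proof (induction S arbitrary: g rule: finite_induct)
    case empty
    then have "g = \<one>\<^bsub>Aut\<^esub>" using Aut_one parabolic_I by (intro Aut_eqI) auto
    then show ?case using N_one by simp
  next
    case (insert k S)
    have ins: "insert k (I - insert k S) = I - S" using insert by auto
    show ?case
      by (rule residue_fixator_step[of "I - insert k S" k c g]) (use insert ins in auto)
  qed
qed

lemma N_eq_Aut: "N = carrier Aut"
proof
  show "N \<subseteq> carrier Aut" using N_Aut by blast
  show "carrier Aut \<subseteq> N"
  proof
    fix g assume g: "g \<in> carrier Aut"
    obtain c where c: "c \<in> C" using chambers_nonempty by blast
    have gc: "g c \<in> C" using Aut_closed g c by blast
    obtain n where n: "n \<in> N" "n c = g c" using orbit_rel_all[OF c gc] by (auto simp: orbit_rel_def)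
    have nA: "n \<in> carrier Aut" using n N_Aut by blast
    have "inv\<^bsub>Aut\<^esub> n \<otimes>\<^bsub>Aut\<^esub> g \<in> N"
    proof (rule residue_fixator_in_N[OF subset_refl c])
      fix x assume x: "x \<in> C" "\<delta> c x \<in> parabolic (I - I)"
      then have "x = c" using c dist_one_iff by (simp add: parabolic_def)
      then show "(inv\<^bsub>Aut\<^esub> n \<otimes>\<^bsub>Aut\<^esub> g) x = x"
        using Aut_mult[OF _ g c, of "inv\<^bsub>Aut\<^esub> n"] Aut_inv_apply[OF nA c] n nA by simp
    qed (use g nA in simp)
    then have "n \<otimes>\<^bsub>Aut\<^esub> (inv\<^bsub>Aut\<^esub> n \<otimes>\<^bsub>Aut\<^esub> g) \<in> N" using N_mult n by blast
    then show "g \<in> N" using g nA by (simp flip: Aut.m_assoc)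
  qed
qed

end

context thick_semi_regular_building
begin

theorem abstractly_simple_Aut: "abstractly_simple Aut"
  unfolding abstractly_simple_def
proof (intro conjI allI impI group_Aut)
  obtain c where c: "c \<in> C" using chambers_nonempty by blast
  obtain i where i: "i \<in> I" using irreducible by (auto simp: irreducible_type_def)
  obtain d where d: "d \<in> pan i c" "d \<noteq> c" using ex_third[OF i c] by blast
  obtain g where "g \<in> carrier Aut" "g c = d" using chamber_transitive[OF c] d panel_in_C by blast
  then show "carrier Aut \<noteq> {\<one>\<^bsub>Aut\<^esub>}" using d Aut_one[OF c] by auto
next
  fix N assume N: "N \<lhd> Aut"
  show "N = carrier Aut \<or> N = {\<one>\<^bsub>Aut\<^esub>}"
  proof (cases "N = {\<one>\<^bsub>Aut\<^esub>}")
    case False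
    interpret normal_in_Aut W I m C \<delta> N by (intro normal_in_Aut.intro normal_in_Aut_axioms.intro thick_semi_regular_building_axioms N False)
    show ?thesis using N_eq_Aut by simp
  qed simp
qed

end

theorem theorem1p1:
  fixes W :: "('w, 'b) monoid_scheme"
    and I :: "'w set"
    and m :: "'w \<Rightarrow> 'w \<Rightarrow> enat"
    and C :: "'c set"
    and \<delta> :: "'c \<Rightarrow> 'c \<Rightarrow> 'w"
  assumes "coxeter_system W I m"
    and "right_angled I m"
    and "finite I"
    and "building W I m C \<delta>"
    and "thick W I C \<delta>"
    and "semi_regular W I C \<delta>"
    and "irreducible_type W I"
    and "non_spherical W"
  shows "abstractly_simple (Aut_plus C \<delta>) \<and>
    strongly_transitive (Aut_plus C \<delta>) (\<lambda>g. g) W C \<delta>"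
proof -
  interpret building W I m C \<delta> by (rule assms(4))
  interpret thick_semi_regular_building W I m C \<delta>
    using assms by unfold_locales
  show ?thesis using abstractly_simple_Aut strongly_transitive_Aut by blast
qed

end
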